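(* Suppose that $$\mathbb{E}\log Z\in(-\infty,0)\quad\text{and}\quad \mathbb{E}\,W_1\log^+W_1<\infty.$$ Then $$\mathbb{E}\,W\log^+W\,a(\log^+W)<\infty\quad\text{if and only if}\quad \mathbb{E}\,W_1(\log^+W_1)^2a(\log^+W_1)<\infty.$$
   Context: Let $\mathcal{M}$ be a point process on $\mathbb{R}$ (a random locally finite counting measure) with $\mathcal{M}\{+\infty\}=0$, and let $L:=\mathcal{M}(\mathbb{R})$, which may be deterministic or random, finite or infinite with positive probability. The branching random walk (BRW) generated by $\mathcal{M}$ is the sequence of point processes $\mathcal{M}_n$, $n=0,1,\dots$, with $\mathcal{M}_0(B)=1_{\{0\in B\}}$ and $\mathcal{M}_{n+1}(B)=\sum_r\mathcal{M}_{n,r}(B-A_{n,r})$ for Borel $B\subset\mathbb{R}$, where $\{A_{n,r}\}_r$ are the points of $\mathcal{M}_n$ and $\{\mathcal{M}_{n,r}\}$ are independent copies of $\mathcal{M}$. The BRW is supercritical: if $\mathbb{P}\{L<\infty\}=1$, it is additionally assumed that $\mathbb{E}L>1$. Individuals are the nodes $u$ of the associated family tree; $|u|$ is the generation of $u$, $A_u$ its position (the initial ancestor has generation $0$ and position $0$), so that $\{A_u:|u|=n\}$ are the points of $\mathcal{M}_n$. It is assumed that for some fixed $\gamma>0$, $m(\gamma):=\mathbb{E}\int_{\mathbb{R}}e^{\gamma x}\,\mathcal{M}_1(dx)\in(0,\infty)$. Put $Y_u:=e^{\gamma A_u}/m(\gamma)^{|u|}$ and $W_n:=\sum_{|u|=n}Y_u=m(\gamma)^{-n}\int_{\mathbb{R}}e^{\gamma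 x}\mathcal{M}_n(dx)$, a non-negative martingale with respect to $\mathcal{F}_n=\sigma(\mathcal{M}_1,\dots,\mathcal{M}_n)$. $Z$ is a random variable whose distribution is defined by $\mathbb{E}\,r(Z)=\mathbb{E}\sum_{|u|=1}Y_u\,r(Y_u)$ for all non-negative bounded Borel functions $r$. Under the conditions $\mathbb{E}\log Z\in(-\infty,0)$ and $\mathbb{E}W_1\log^+W_1<\infty$ the martingale $W_n$ is uniformly integrable, and $W$ denotes its almost sure and $L_1$ limit ($\mathbb{E}W=1$). $a:\mathbb{R}^+\to\mathbb{R}^+$ is a function regularly varying at $\infty$ with exponent $\alpha>-1$; if $\alpha=0$ it is additionally assumed that $a$ does not decrease near $\infty$. Here $\log^+x=\max(\log x,0)$ (and $\log^+0=0$).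
   Formalization: It is additionally assumed that x·a(x) is bounded on every interval (0,c]; without this the claim fails, e.g. when a(x)=1/|x-1| near 1, W_1 takes the values 2/3 and 4/3, and W has a positive density at e. *)

theory Defs
  imports "HOL-Probability.Probability"
begin

section \<open>Point processes on the real line\<close>

text \<open>Locally finite counting measures. Multiple points are allowed, and the total mass may be
  infinite.\<close>

definition point_measures :: "real measure set" where
  "point_measures =
    {N. sets N = sets borel \<and>
        (\<forall>B \<in> sets borel. bounded B \<longrightarrow> (\<exists>k::nat. emeasure N B = of_nat k))}"

text \<open>The \<open>\<sigma>\<close>-algebra generated by the evaluations \<open>N \<mapsto> N B\<close>, built as in \<^const>\<open>subprob_algebra\<close>.\<close>

definition point_space :: "real measure measure" where
  "point_space =
    (SUP B \<in> sets borel. vimage_algebra point_measures (\<lambda>N. emeasure N B) borel)"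

abbreviation point_process :: "'w measure \<Rightarrow> ('w \<Rightarrow> real measure) \<Rightarrow> bool" where
  "point_process P N \<equiv> N \<in> measurable P point_space"

text \<open>The points of \<open>N\<close>, repeated according to multiplicity, are listed as
  \<open>\<dots> \<le> T (-2) \<le> T (-1) < 0 \<le> T 0 \<le> T 1 \<le> \<dots>\<close> where \<open>T j = point N j\<close>. Either side of this list
  may be finite or empty; \<open>has_point N j\<close> says that the list has an entry number \<open>j\<close>, and
  \<open>point N j\<close> is meaningless otherwise. Lemma \<open>point_measure_eq_distr\<close> below justifies the
  definition.\<close>

definition point_rank :: "int \<Rightarrow> nat" where
  "point_rank j = (if 0 \<le> j then nat j else nat (- j - 1))"

definition has_point :: "real measure \<Rightarrow> int \<Rightarrow> bool" where
  "has_point N j \<longleftrightarrow>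
    of_nat (point_rank j) < emeasure N (if 0 \<le> j then {0..} else {..<0})"

definition point :: "real measure \<Rightarrow> int \<Rightarrow> real" where
  "point N j =
    (if 0 \<le> j then Inf {x. 0 \<le> x \<and> of_nat (point_rank j) < emeasure N {0..x}}
     else Sup {x. x < 0 \<and> of_nat (point_rank j) < emeasure N {x..<0}})"


section \<open>The branching random walk\<close>

text \<open>An individual is coded by the list of indices leading to it, youngest first: child number
  \<open>j\<close> of \<open>u\<close> is \<open>j # u\<close>, and the initial ancestor is \<open>[]\<close>. A realization of the family tree is
  given by the point measures \<open>d u\<close> of displacements of the children of \<open>u\<close> relative to \<open>u\<close>.
  These are attached to all labels \<open>u\<close>, but only those of existing individuals matter.\<close>

primrec individual :: "(int list \<Rightarrow> real measure) \<Rightarrow> int list \<Rightarrow> bool" where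
  "individual d [] \<longleftrightarrow> True"
| "individual d (j # u) \<longleftrightarrow> individual d u \<and> has_point (d u) j"

primrec position :: "(int list \<Rightarrow> real measure) \<Rightarrow> int list \<Rightarrow> real" where
  "position d [] = 0"
| "position d (j # u) = position d u + point (d u) j"

definition generation :: "(int list \<Rightarrow> real measure) \<Rightarrow> nat \<Rightarrow> int list set" where
  "generation d n = {u. individual d u \<and> length u = n}"

text \<open>The point measure of the \<open>n\<close>-th generation: the summand for \<open>u\<close> is the mass that \<open>d u\<close> gives to
  \<open>B - position d u\<close>. That the points of this measure are the positions of the individuals in
  generation \<open>n\<close> is Lemma \<open>brw_eq_distr\<close> below.\<close>

primrec brw :: "(int list \<Rightarrow> real measure) \<Rightarrow> nat \<Rightarrow> real measure" where
  "brw d 0 = return borel 0"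
| "brw d (Suc n) = measure_of UNIV (sets borel)
    (\<lambda>B. \<integral>\<^sup>+ u. emeasure (d u) ((\<lambda>x. x - position d u) ` B) \<partial>count_space (generation d n))"

text \<open>\<open>M\<close> is the generating point process, \<open>D \<omega> u\<close> the copy of it used by \<open>u\<close>. The last assumption
  is supercriticality.\<close>

locale branching_random_walk = prob_space P
  for P :: "'w measure" +
  fixes M :: "'w \<Rightarrow> real measure" and D :: "'w \<Rightarrow> int list \<Rightarrow> real measure"
  assumes point_process_M: "point_process P M"
    and indep_copies: "indep_vars (\<lambda>_. point_space) (\<lambda>u \<omega>. D \<omega> u) UNIV"
    and distr_copies: "\<And>u. distr P point_space (\<lambda>\<omega>. D \<omega> u) = distr P point_space M"
    and supercritical:
      "(AE \<omega> in P. emeasure (M \<omega>) UNIV < \<infinity>) \<Longrightarrow> 1 < (\<integral>\<^sup>+ \<omega>. emeasure (M \<omega>) UNIV \<partial>P)"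

definition brw_m :: "'w measure \<Rightarrow> ('w \<Rightarrow> int list \<Rightarrow> real measure) \<Rightarrow> real \<Rightarrow> ennreal" where
  "brw_m P D \<gamma> = (\<integral>\<^sup>+ \<omega>. (\<integral>\<^sup>+ x. ennreal (exp (\<gamma> * x)) \<partial>brw (D \<omega>) 1) \<partial>P)"

definition brw_Y ::
  "'w measure \<Rightarrow> ('w \<Rightarrow> int list \<Rightarrow> real measure) \<Rightarrow> real \<Rightarrow> int list \<Rightarrow> 'w \<Rightarrow> real" where
  "brw_Y P D \<gamma> u \<omega> = exp (\<gamma> * position (D \<omega>) u) / enn2real (brw_m P D \<gamma>) ^ length u"

text \<open>If \<open>brw_m P D \<gamma>\<close> is finite and positive then the sum has expectation 1; on the null event
  where it is infinite, \<^const>\<open>infsum\<close> returns 0.\<close>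

definition brw_W ::
  "'w measure \<Rightarrow> ('w \<Rightarrow> int list \<Rightarrow> real measure) \<Rightarrow> real \<Rightarrow> nat \<Rightarrow> 'w \<Rightarrow> real" where
  "brw_W P D \<gamma> n \<omega> = (\<Sum>\<^sub>\<infinity>u\<in>generation (D \<omega>) n. brw_Y P D \<gamma> u \<omega>)"

text \<open>\<^term>\<open>ln 0 = (0::real)\<close>, so this gives the usual \<open>log\<^sup>+ 0 = 0\<close>; it is not meant for
  negative arguments.\<close>

definition ln_plus :: "real \<Rightarrow> real" where
  "ln_plus x = max (ln x) 0"

text \<open>Measurability on the positive half-line is part of the notion. Taking \<open>c = 1\<close> shows that
  \<open>a\<close> does not vanish near infinity.\<close>

definition regularly_varying :: "(real \<Rightarrow> real) \<Rightarrow> real \<Rightarrow> bool" where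
  "regularly_varying a \<alpha> \<longleftrightarrow>
    a \<in> borel_measurable (restrict_space borel {0<..}) \<and>
    (\<forall>c>0. ((\<lambda>x. a (c * x) / a x) \<longlongrightarrow> c powr \<alpha>) at_top)"


section \<open>The labelling lists the points with their multiplicities\<close>

lemma point_measures_sets: "N \<in> point_measures \<Longrightarrow> sets N = sets borel"
  by (simp add: point_measures_def)

lemma point_measures_nat:
  assumes "N \<in> point_measures" "B \<in> sets borel" "bounded B"
  obtains k :: nat where "emeasure N B = of_nat k"
  using assms unfolding point_measures_def by blast

lemma less_emeasure_decseq:
  fixes A :: "nat \<Rightarrow> real set" and k :: nat
  assumes N: "N \<in> point_measures" and A: "\<And>n. A n \<in> sets borel" "bounded (A 0)" "decseq A"
    and less: "\<And>n. of_nat k < emeasure N (A n)"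
  shows "of_nat k < emeasure N (\<Inter>n. A n)"
proof -
  have bdd: "bounded (A n)" for n
    using bounded_subset[OF A(2) decseqD[OF A(3) le0]] .
  have nat: "\<exists>l::nat. emeasure N (A n) = of_nat l" for n
    using N A(1)[of n] bdd[of n] by (simp add: point_measures_def)
  have "of_nat (Suc k) \<le> emeasure N (A n)" for n
  proof -
    obtain l :: nat where l: "emeasure N (A n) = of_nat l"
      using nat by blast
    show ?thesis using less[of n] unfolding l by (simp only: of_nat_less_iff of_nat_le_iff)
  qed
  moreover have "emeasure N (A n) \<noteq> \<infinity>" for n
    using nat[of n] by auto
  then have "(INF n. emeasure N (A n)) = emeasure N (\<Inter>n. A n)"
    using A(1,3) by (intro INF_emeasure_decseq) (auto simp: point_measures_sets[OF N])
  ultimately have "of_nat (Suc k) \<le> emeasure N (\<Inter>n. A n)"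
    by (metis INF_greatest)
  moreover have "(of_nat k :: ennreal) < of_nat (Suc k)"
    by (simp only: of_nat_less_iff)
  ultimately show ?thesis by (rule less_le_trans[rotated])
qed

lemma point_nonneg_iff:
  assumes N: "N \<in> point_measures" and j: "0 \<le> j" and x: "0 \<le> x"
  shows "has_point N j \<and> point N j \<le> x \<longleftrightarrow> of_nat (point_rank j) < emeasure N {0..x}"
    and "has_point N j \<Longrightarrow> 0 \<le> point N j"
proof -
  note [simp] = point_measures_sets[OF N]
  define S where "S = {x. 0 \<le> x \<and> of_nat (point_rank j) < emeasure N {0..x}}"
  have p: "point N j = Inf S" using j by (simp add: point_def S_def)
  have bdd: "bdd_below S" by (auto simp: S_def bdd_below_def)
  have up: "z \<in> S" if "y \<in> S" "y \<le> z" for y z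
  proof -
    have "emeasure N {0..y} \<le> emeasure N {0..z}"
      using that by (intro emeasure_mono) auto
    then show ?thesis using that by (auto simp: S_def)
  qed
  have Inf_in: "Inf S \<in> S" if nonempty: "S \<noteq> {}"
  proof -
    have ge: "0 \<le> Inf S" using nonempty by (intro cInf_greatest) (auto simp: S_def)
    have mem: "Inf S + 1 / Suc n \<in> S" for n
    proof -
      obtain y where "y \<in> S" "y < Inf S + 1 / Suc n"
        using cInf_lessD[OF nonempty, of "Inf S + 1 / Suc n"] by auto
      then show ?thesis using up by (meson less_imp_le)
    qed
    have "of_nat (point_rank j) < emeasure N (\<Inter>n. {0..Inf S + 1 / Suc n})"
    proof (rule less_emeasure_decseq[OF N])
      show "decseq (\<lambda>n. {0..Inf S + 1 / real (Suc n)})"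
      proof (rule decseq_SucI)
        fix n show "{0..Inf S + 1 / real (Suc (Suc n))} \<subseteq> {0..Inf S + 1 / real (Suc n)}"
          using frac_le[of 1 1 "real (Suc n)" "real (Suc (Suc n))"] by auto
      qed
    qed (use mem in \<open>auto simp: S_def\<close>)
    also have "(\<Inter>n. {0..Inf S + 1 / Suc n}) = {0..Inf S}"
    proof -
      have "z \<le> Inf S" if z: "\<And>n. z \<le> Inf S + 1 / real (Suc n)" for z
      proof (rule field_le_epsilon)
        fix e :: real assume "0 < e"
        then obtain n where "1 / real (Suc n) < e" using nat_approx_posE by blast
        then show "z \<le> Inf S + e" using z[of n] by linarith
      qed
      moreover have "z \<le> Inf S + 1 / real (Suc n)" if "z \<le> Inf S" for z n
      proof -
        have "0 \<le> 1 / real (Suc n)" by simp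
        with that show ?thesis by linarith
      qed
      ultimately show ?thesis
        unfolding set_eq_iff INT_iff atLeastAtMost_iff by blast
    qed
    finally show ?thesis using ge by (simp add: S_def)
  qed
  have ne: "S \<noteq> {}" if "has_point N j"
  proof -
    have "(\<Union>n. {0..real n}) = {0..}" by (auto intro: real_arch_simple)
    moreover have "(SUP n. emeasure N {0..real n}) = emeasure N (\<Union>n. {0..real n})"
      by (intro SUP_emeasure_incseq) (auto simp: incseq_def)
    ultimately have "of_nat (point_rank j) < (SUP n. emeasure N {0..real n})"
      using that j by (simp add: has_point_def)
    then obtain n where "of_nat (point_rank j) < emeasure N {0..real n}"
      by (auto simp: less_SUP_iff)
    then have "real n \<in> S" by (simp add: S_def)
    then show ?thesis by auto
  qed
  have hp: "has_point N j" if "y \<in> S" for y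
  proof -
    have "emeasure N {0..y} \<le> emeasure N {0..}" by (intro emeasure_mono) auto
    then show ?thesis using that j by (auto simp: S_def has_point_def)
  qed
  have "has_point N j \<and> point N j \<le> x \<longleftrightarrow> x \<in> S"
    using ne Inf_in up hp cInf_lower[OF _ bdd] unfolding p by blast
  then show "has_point N j \<and> point N j \<le> x \<longleftrightarrow> of_nat (point_rank j) < emeasure N {0..x}"
    using x by (simp add: S_def)
  show "0 \<le> point N j" if "has_point N j"
    using Inf_in[OF ne[OF that]] by (simp add: p S_def)
qed

lemma point_neg_iff:
  assumes N: "N \<in> point_measures" and j: "j < 0" and x: "x < 0"
  shows "has_point N j \<and> x \<le> point N j \<longleftrightarrow> of_nat (point_rank j) < emeasure N {x..<0}"
    and "has_point N j \<Longrightarrow> point N j < 0"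
proof -
  note [simp] = point_measures_sets[OF N]
  define S where "S = {x. x < 0 \<and> of_nat (point_rank j) < emeasure N {x..<0}}"
  have p: "point N j = Sup S" using j by (simp add: point_def S_def)
  have bdd: "bdd_above S" by (auto simp: S_def bdd_above_def intro!: exI[of _ 0])
  have down: "z \<in> S" if "y \<in> S" "z \<le> y" for y z
  proof -
    have "emeasure N {y..<0} \<le> emeasure N {z..<0}"
      using that by (intro emeasure_mono) auto
    then show ?thesis using that by (auto simp: S_def)
  qed
  have Sup_in: "Sup S \<in> S" if nonempty: "S \<noteq> {}"
  proof -
    have mem: "Sup S - 1 / Suc n \<in> S" for n
    proof -
      obtain y where "y \<in> S" "Sup S - 1 / Suc n < y"
        using less_cSupD[OF nonempty, of "Sup S - 1 / Suc n"] by auto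
      then show ?thesis using down by (meson less_imp_le)
    qed
    have "of_nat (point_rank j) < emeasure N (\<Inter>n. {Sup S - 1 / Suc n..<0})"
    proof (rule less_emeasure_decseq[OF N])
      show "decseq (\<lambda>n. {Sup S - 1 / real (Suc n)..<0})"
      proof (rule decseq_SucI)
        fix n show "{Sup S - 1 / real (Suc (Suc n))..<0} \<subseteq> {Sup S - 1 / real (Suc n)..<0}"
          using frac_le[of 1 1 "real (Suc n)" "real (Suc (Suc n))"] by auto
      qed
    qed (use mem in \<open>auto simp: S_def\<close>)
    also have "(\<Inter>n. {Sup S - 1 / Suc n..<0}) = {Sup S..<0}"
    proof -
      have "Sup S \<le> z" if z: "\<And>n. Sup S - 1 / real (Suc n) \<le> z" for z
      proof (rule field_le_epsilon)
        fix e :: real assume "0 < e"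
        then obtain n where "1 / real (Suc n) < e" using nat_approx_posE by blast
        then show "Sup S \<le> z + e" using z[of n] by linarith
      qed
      moreover have "Sup S - 1 / real (Suc n) \<le> z" if "Sup S \<le> z" for z n
        using that by (simp add: add_increasing2 diff_le_eq)
      ultimately show ?thesis by auto
    qed
    finally have less: "of_nat (point_rank j) < emeasure N {Sup S..<0}" .
    have "Sup S < 0"
    proof (rule ccontr)
      assume "\<not> Sup S < 0"
      then have "{Sup S..<0} = {}" by auto
      with less show False by simp
    qed
    with less show ?thesis by (simp add: S_def)
  qed
  have ne: "S \<noteq> {}" if "has_point N j"
  proof -
    have "\<exists>n. - real n \<le> z" for z
      using real_arch_simple[of "- z"] by (auto simp: minus_le_iff)
    then have "(\<Union>n. {- real n..<0}) = {..<0}" by auto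
    moreover have "(SUP n. emeasure N {- real n..<0}) = emeasure N (\<Union>n. {- real n..<0})"
      by (intro SUP_emeasure_incseq) (auto simp: incseq_def)
    ultimately have "of_nat (point_rank j) < (SUP n. emeasure N {- real n..<0})"
      using that j by (simp add: has_point_def)
    then obtain n where n: "of_nat (point_rank j) < emeasure N {- real n..<0}"
      by (auto simp: less_SUP_iff)
    have "n \<noteq> 0" using n by (intro notI) simp
    with n have "- real n \<in> S" by (simp add: S_def)
    then show ?thesis by auto
  qed
  have hp: "has_point N j" if "y \<in> S" for y
  proof -
    have "emeasure N {y..<0} \<le> emeasure N {..<0}" by (intro emeasure_mono) auto
    then show ?thesis using that j by (auto simp: S_def has_point_def)
  qed
  have "has_point N j \<and> x \<le> point N j \<longleftrightarrow> x \<in> S"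
    using ne Sup_in down hp cSup_upper[OF _ bdd] unfolding p by blast
  then show "has_point N j \<and> x \<le> point N j \<longleftrightarrow> of_nat (point_rank j) < emeasure N {x..<0}"
    using x by (simp add: S_def)
  show "point N j < 0" if "has_point N j"
    using Sup_in[OF ne[OF that]] by (simp add: p S_def)
qed

lemma borel_eq_sigma_split_zero:
  "(borel :: real measure) = sigma UNIV (range (\<lambda>x. {0..x}) \<union> range (\<lambda>x. {x..<0}))"
    (is "_ = ?S")
proof -
  let ?E = "range (\<lambda>x::real. {0..x}) \<union> range (\<lambda>x. {x..<0})"
  have "(borel :: real measure) = sigma UNIV ((\<lambda>x. x) ` ?E)"
  proof (rule borel_eq_sigmaI1[where X = "range greaterThan"])
    show "(borel :: real measure) = sigma UNIV (range greaterThan)"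
      unfolding borel_Ioi ..
  next
    fix X :: "real set" assume "X \<in> range greaterThan"
    then obtain a where X: "X = {a<..}" by auto
    have 1: "{0..x} \<in> sets ?S" "{x..<0} \<in> sets ?S" for x :: real
      by (auto intro!: sigma_sets.Basic)
    have nn: "{0..} = (\<Union>n. {0..real n})" by (auto intro: real_arch_simple)
    have 2: "{0::real..} \<in> sets ?S" unfolding nn using 1 by (intro sets.countable_UN) auto
    show "X \<in> sets (sigma UNIV ((\<lambda>x. x) ` ?E))"
      unfolding image_ident
    proof (cases "0 \<le> a")
      case True
      then have "X = {0..} - {0..a}" by (auto simp: X)
      then show "X \<in> sets ?S" using sets.Diff[OF 2 1(1)] by (simp only:)
    next
      case False
      have "X = (\<Union>n. {a + 1 / Suc n..<0}) \<union> {0..}"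
      proof -
        have "\<exists>n. a + 1 / real (Suc n) \<le> z" if "a < z" for z
        proof -
          have "0 < z - a" using that by simp
          then obtain n where "1 / real (Suc n) < z - a" by (rule nat_approx_posE)
          then show ?thesis by (intro exI[of _ n]) linarith
        qed
        moreover have "a < z" if "a + 1 / real (Suc n) \<le> z" for z n
        proof -
          have "0 < 1 / real (Suc n)" by simp
          with that show ?thesis by linarith
        qed
        ultimately have "a < z \<longleftrightarrow> (\<exists>n. a + 1 / real (Suc n) \<le> z)" for z
          by blast
        then have "{a<..} = (\<Union>n. {a + 1 / real (Suc n)..})" by auto
        moreover have "{a<..} = {a<..} \<inter> {..<0} \<union> {0..}" using False by auto
        ultimately show ?thesis unfolding X by auto
      qed
      moreover have "(\<Union>n. {a + 1 / Suc n..<0}) \<in> sets ?S"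
        using 1 by (intro sets.countable_UN) auto
      ultimately show "X \<in> sets ?S" using sets.Un[OF _ 2] by (simp only:)
    qed
  qed auto
  then show ?thesis by simp
qed

lemma point_measure_eq_distr:
  assumes N: "N \<in> point_measures"
  shows "N = distr (count_space {j. has_point N j}) borel (point N)" (is "N = ?R")
proof (rule measure_eqI_generator_eq_countable)
  let ?E = "range (\<lambda>x::real. {0..x}) \<union> range (\<lambda>x. {x..<0})"
  have R: "emeasure ?R B = emeasure (count_space {j. has_point N j}) {j. has_point N j \<and> point N j \<in> B}"
    if "B \<in> sets borel" for B
    using that by (subst emeasure_distr) (auto intro!: arg_cong2[where f = emeasure])
  have fin: "emeasure N X \<noteq> \<infinity>" if "X \<in> ?E" for X
  proof -
    have "X \<in> sets borel" "bounded X" using that by auto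
    then obtain k :: nat where "emeasure N X = of_nat k"
      using point_measures_nat[OF N] by blast
    then show ?thesis by simp
  qed
  show "Int_stable ?E"
  proof (rule Int_stableI)
    fix a b assume "a \<in> ?E" "b \<in> ?E"
    moreover have "{0..x} \<inter> {0..y} = {0..min x y}" "{x..<0} \<inter> {y..<0} = {max x y..<0}"
      "{0..x} \<inter> {y..<0} = {0<..<0}" "{y..<0} \<inter> {0..x} = {0..-1}" for x y :: real by auto
    moreover have "{0<..<0::real} = {0..-1}" by auto
    ultimately show "a \<inter> b \<in> ?E" by (elim UnE rangeE) (simp_all only:, blast+)
  qed
  show "emeasure N X = emeasure ?R X" if "X \<in> ?E" for X
    using that
  proof
    assume "X \<in> range (\<lambda>x::real. {0..x})"
    then obtain x where X: "X = {0..x}" by auto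
    have X_borel: "X \<in> sets borel" by (simp add: X)
    show ?thesis
    proof (cases "0 \<le> x")
      case True
      obtain c :: nat where c: "emeasure N {0..x} = of_nat c"
        using point_measures_nat[OF N, of "{0..x}"] by auto
      have "has_point N j \<and> point N j \<in> X \<longleftrightarrow> j \<in> {0..<int c}" for j
      proof (cases "0 \<le> j")
        case j: True
        have "has_point N j \<and> point N j \<in> X \<longleftrightarrow> has_point N j \<and> point N j \<le> x"
          using point_nonneg_iff(2)[OF N j True] by (auto simp: X)
        then show ?thesis
          using j point_nonneg_iff(1)[OF N j True] by (auto simp: c point_rank_def)
      next
        case False
        then show ?thesis using point_neg_iff(2)[OF N, of j "-1"] by (auto simp: X)
      qed
      then have eq: "{j. has_point N j \<and> point N j \<in> X} = {0..<int c}"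
        by (simp only: Collect_mem_eq)
      then have sub: "{0..<int c} \<subseteq> {j. has_point N j}" by blast
      have "emeasure ?R X = of_nat (card {0..<int c})"
        using R[of X] emeasure_count_space_finite[OF sub] by (simp add: eq X_borel)
      then show ?thesis by (simp add: X c)
    next
      case False
      then show ?thesis by (simp add: X)
    qed
  next
    assume "X \<in> range (\<lambda>x::real. {x..<0})"
    then obtain x where X: "X = {x..<0}" by auto
    have X_borel: "X \<in> sets borel" by (simp add: X)
    show ?thesis
    proof (cases "x < 0")
      case True
      obtain c :: nat where c: "emeasure N {x..<0} = of_nat c"
        using point_measures_nat[OF N, of "{x..<0}"] by auto
      have "has_point N j \<and> point N j \<in> X \<longleftrightarrow> j \<in> {- int c..<0}" for j
      proof (cases "j < 0")
        case j: True
        have "has_point N j \<and> point N j \<in> X \<longleftrightarrow> has_point N j \<and> x \<le> point N j"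
          using point_neg_iff(2)[OF N j True] by (auto simp: X)
        then show ?thesis
          using j point_neg_iff(1)[OF N j True] by (auto simp: c point_rank_def)
      next
        case False
        then show ?thesis using point_nonneg_iff(2)[OF N, of j 0] by (auto simp: X)
      qed
      then have eq: "{j. has_point N j \<and> point N j \<in> X} = {- int c..<0}"
        by (simp only: Collect_mem_eq)
      then have sub: "{- int c..<0} \<subseteq> {j. has_point N j}" by blast
      have "emeasure ?R X = of_nat (card {- int c..<0})"
        using R[of X] emeasure_count_space_finite[OF sub] by (simp add: eq X_borel)
      then show ?thesis by (simp add: X c)
    next
      case False
      then show ?thesis by (simp add: X)
    qed
  qed
  have sets_borel: "sets (borel :: real measure) = sigma_sets UNIV ?E"
    by (subst borel_eq_sigma_split_zero) simp
  then show "sets N = sigma_sets UNIV ?E"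
    by (simp only: point_measures_sets[OF N])
  show "sets ?R = sigma_sets UNIV ?E"
    using sets_borel by (simp only: sets_distr)
  let ?A = "range (\<lambda>n. {0..real n}) \<union> range (\<lambda>n. {- real n..<0})"
  show "?A \<subseteq> ?E" by auto
  show "\<Union>?A = UNIV"
  proof -
    have "\<exists>n. - real n \<le> z" "\<exists>n. z \<le> real n" for z
      using real_arch_simple[of "- z"] by (auto simp: minus_le_iff real_arch_simple)
    then show ?thesis by (auto simp: not_le)
  qed
  show "countable ?A" by simp
  show "emeasure N a \<noteq> \<infinity>" if "a \<in> ?A" for a
    using that by (intro fin) auto
qed auto

lemma brw_eq_distr:
  assumes d: "\<And>u. d u \<in> point_measures"
  shows "brw d n = distr (count_space (generation d n)) borel (position d)"
proof (cases n)
  case 0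
  have "generation d 0 = {[]}" by (auto simp: generation_def)
  then show ?thesis
    by (intro measure_eqI) (auto simp: 0 emeasure_distr indicator_def)
next
  case (Suc m)
  let ?R = "distr (count_space (generation d n)) borel (position d)"
  have "emeasure ?R B = (\<integral>\<^sup>+ u. emeasure (d u) ((\<lambda>x. x - position d u) ` B) \<partial>count_space (generation d m))"
    if B: "B \<in> sets borel" for B
  proof -
    let ?f = "\<lambda>u j. indicator (generation d n) (j # u) * indicator B (position d (j # u)) :: ennreal"
    have eq: "emeasure (d u) ((\<lambda>x. x - position d u) ` B) * indicator (generation d m) u =
        (\<integral>\<^sup>+ j. ?f u j \<partial>count_space UNIV)" for u
    proof -
      have im: "(\<lambda>x. x - position d u) ` B = (\<lambda>x. position d u + x) -` B"
        by (auto simp: image_iff) (metis add_diff_cancel_left')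
      have meas: "(\<lambda>x. position d u + x) -` B \<in> sets borel"
        using measurable_sets[of "\<lambda>x. position d u + x" borel borel B] B by simp
      have "emeasure (d u) ((\<lambda>x. x - position d u) ` B) =
          emeasure (distr (count_space {j. has_point (d u) j}) borel (point (d u)))
            ((\<lambda>x. position d u + x) -` B)"
        unfolding im using point_measure_eq_distr[OF d, of u] by simp
      also have "\<dots> = (\<integral>\<^sup>+ x. indicator ((\<lambda>x. position d u + x) -` B) x
          \<partial>distr (count_space {j. has_point (d u) j}) borel (point (d u)))"
        using meas by simp
      also have "\<dots> = (\<integral>\<^sup>+ j. indicator ((\<lambda>x. position d u + x) -` B) (point (d u) j)
          \<partial>count_space {j. has_point (d u) j})"
        using meas by (subst nn_integral_distr) auto
      also have "\<dots> = (\<integral>\<^sup>+ j. indicator B (position d (j # u)) * indicator {j. has_point (d u) j} j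
          \<partial>count_space UNIV)"
        by (subst nn_integral_count_space_indicator)
          (auto intro!: nn_integral_cong simp: indicator_def)
      finally show ?thesis
        by (auto simp: generation_def Suc indicator_def intro!: nn_integral_cong split: if_splits)
    qed
    have "emeasure ?R B = (\<integral>\<^sup>+ v. indicator B (position d v) \<partial>count_space (generation d n))"
    proof -
      have "emeasure ?R B = (\<integral>\<^sup>+ x. indicator B x \<partial>?R)" using B by simp
      also have "\<dots> = (\<integral>\<^sup>+ v. indicator B (position d v) \<partial>count_space (generation d n))"
        using B by (intro nn_integral_distr) auto
      finally show ?thesis .
    qed
    also have "\<dots> = (\<integral>\<^sup>+ v. indicator (generation d n) v * indicator B (position d v)
        \<partial>count_space (- {[]}))"
      by (subst (1 2) nn_integral_count_space_indicator)
        (auto intro!: nn_integral_cong simp: indicator_def generation_def Suc length_Suc_conv)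
    also have "\<dots> = (\<integral>\<^sup>+ (u, j). ?f u j \<partial>count_space UNIV)"
    proof -
      have "bij_betw (\<lambda>(u, j). j # u) UNIV (- {[]} :: int list set)"
      proof (rule bij_betw_byWitness[where f' = "\<lambda>v. (tl v, hd v)"])
        show "\<forall>v\<in>- {[]}. (case (tl v, hd v) of (u, j) \<Rightarrow> j # u) = (v :: int list)" by simp
      qed auto
      from nn_integral_bij_count_space[OF this, symmetric] show ?thesis
        by (simp only: case_prod_beta')
    qed
    also have "\<dots> = (\<integral>\<^sup>+ u. \<integral>\<^sup>+ j. ?f u j \<partial>count_space UNIV \<partial>count_space UNIV)"
      by (subst nn_integral_fst_count_space[symmetric]) simp
    also have "\<dots> = (\<integral>\<^sup>+ u. emeasure (d u) ((\<lambda>x. x - position d u) ` B) * indicator (generation d m) u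
        \<partial>count_space UNIV)"
      by (simp only: eq)
    finally show ?thesis
      by (simp add: nn_integral_count_space_indicator)
  qed
  then have "measure_of UNIV (sets borel) (emeasure ?R) = brw d n"
    unfolding Suc brw.simps by (intro measure_of_eq) (auto simp: sets.sigma_sets_eq[of borel, simplified])
  moreover have "measure_of UNIV (sets borel) (emeasure ?R) = ?R"
    using measure_of_of_measure[of ?R] by simp
  ultimately show ?thesis by simp
qed

end

theory Submission
  imports Defs
begin

text \<open>Write \<open>l = ln_plus\<close>. Since \<open>x a(x)\<close> varies regularly with positive exponent \<open>\<alpha> + 1\<close>, it is
  comparable near infinity to a nondecreasing weight \<open>b\<close> with \<open>b(x) / (1 + x)^p\<close> nonincreasing.
  Let \<open>B\<close> be the primitive of \<open>b\<close>, so that \<open>B(x)\<close> is comparable to \<open>x b(x)\<close>. The claim becomes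
  \<open>E W b(l W) < \<infinity>\<close> iff \<open>E W\<^sub>1 B(l W\<^sub>1) < \<infinity>\<close>, and both directions come from one step of the recursion
  \<open>S = \<Sum>\<^sub>j A\<^sub>j X\<^sub>j\<close>, where \<open>A\<^sub>j\<close> are the weights of the children of the ancestor and \<open>X\<^sub>j\<close> are independent
  copies of \<open>X = W\<^sub>n\<close> (then \<open>S = W\<^sub>n\<^sub>+\<^sub>1\<close>) or of \<open>X = W\<close> (then \<open>S = W\<close>).

  If child \<open>j\<close> is chosen with density \<open>A\<^sub>j X\<^sub>j\<close>, then \<open>l S - l X\<^sub>j\<close> is about \<open>ln A\<^sub>j\<close> when \<open>X\<^sub>j\<close> is large,
  and \<open>ln A\<^sub>j\<close> has the negative mean \<open>E ln Z\<close>. So \<open>B\<close> is a Lyapunov function: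
  \<open>E W\<^sub>n\<^sub>+\<^sub>1 B(l W\<^sub>n\<^sub>+\<^sub>1) \<le> E W\<^sub>n B(l W\<^sub>n) - c E W\<^sub>n b(l W\<^sub>n) + C\<close>, with \<open>C\<close> finite as soon as
  \<open>E W\<^sub>1 B(l W\<^sub>1)\<close> is. Summing over \<open>n\<close> bounds the Cesaro means of \<open>E W\<^sub>n b(l W\<^sub>n)\<close>, and Fatou's lemma
  gives \<open>E W b(l W) < \<infinity>\<close>.

  Conversely, for \<open>X = W\<close> and \<open>B\<close> truncated, the expected increment of \<open>B(l \<cdot>)\<close> is zero. Its negative
  part is at most \<open>E (ln Z)\<^sup>- E W b(l W)\<close>, and its positive part is at least a constant times
  \<open>E W\<^sub>1 B(l (W\<^sub>1 / 2))\<close>, because \<open>X\<^sub>j\<close> bounded and \<open>S \<ge> W\<^sub>1 / 2\<close> hold together with size-biased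
  probability at least \<open>1/4\<close> given the first generation.\<close>

section \<open>Regular variation\<close>

text \<open>Three obstacles shape the estimates. Comparing \<open>b\<close> at nearby points costs a
  factor (1 + \<delta>)^p in both directions; as E ln Z is strictly negative, a small \<delta>
  leaves a negative drift. Long jumps escape this comparison: upward ones are charged to the moment
  of W_1, downward ones are cut at a level \<open>t0\<close> that keeps most of E (ln Z)^-. Next,
  only a conditional mean of the siblings' contribution R is known. For X_j > exp K it shifts the
  logarithm by at most ln (1 + R exp (-K) / A_j), whose size-biased mean vanishes as K grows, by
  Jensen and dominated convergence; E W_1 l W_1 < \<infinity> provides the dominating function.
  Smaller X_j only contribute to the constant. Finally, both halves cancel expectations that could
  be infinite. Going forward, finiteness is carried along an induction starting from W_0 = 1 and
  B(0) = 0; in the converse it is forced by truncating B. The probability 1/4 there is 3/4 - 1/2: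
  X_j \<le> K has size-biased mass at least 3/4 for large K, independently of the weights, while S <
  W_1 / 2 has conditional size-biased mass at most 1/2, because a family enters with mass S /
  W_1.\<close>

lemma measure_lborel_incseq_gt:
  fixes E :: "nat \<Rightarrow> real set"
  assumes E: "\<And>n. E n \<in> sets borel" "incseq E" "(\<Union>n. E n) = {0..c}" and m: "m < c"
  shows "\<exists>n0. \<forall>n\<ge>n0. m < measure lborel (E n)"
proof -
  have "(\<lambda>n. measure lborel (E n)) \<longlonglongrightarrow> measure lborel (\<Union>n. E n)"
    by (rule Lim_measure_incseq) (use E in \<open>auto simp: emeasure_lborel_Icc_eq\<close>)
  moreover have "m < measure lborel (\<Union>n. E n)"
    unfolding E(3) using m by (cases "0 \<le> c") auto
  ultimately show ?thesis
    by (metis order_tendstoD(1) eventually_sequentially)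
qed

text \<open>The measure-theoretic half of the uniform convergence theorem: if the bound failed at
  \<open>t n\<close>, \<open>s n\<close>, the sets of increments that are harmless from \<open>t n\<close> and from \<open>t n + s n\<close> would
  still intersect after translation by \<open>s n\<close>.\<close>

lemma additive_limit_locally_bounded:
  fixes h :: "real \<Rightarrow> real"
  assumes h [measurable]: "h \<in> borel_measurable borel"
    and lim: "\<And>s. ((\<lambda>t. h (t + s) - h t) \<longlongrightarrow> \<beta> * s) at_top"
  obtains T C where "\<And>t s. T \<le> t \<Longrightarrow> 0 \<le> s \<Longrightarrow> s \<le> 1 \<Longrightarrow> \<bar>h (t + s) - h t\<bar> \<le> C"
proof (rule ccontr)
  assume contr: "\<not> thesis"
  have "\<exists>t s. real n \<le> t \<and> 0 \<le> s \<and> s \<le> 1 \<and> real n < \<bar>h (t + s) - h t\<bar>" for n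
    using that[of "real n" "real n"] contr by (meson not_le)
  then obtain t s where ts: "\<And>n. real n \<le> t n" "\<And>n. 0 \<le> s n" "\<And>n. s n \<le> 1"
    "\<And>n. real n < \<bar>h (t n + s n) - h (t n)\<bar>"
    by metis
  \<comment> \<open>A bound for the limits \<beta> r with r in [0, 2], with slack 1 so that each
    difference is eventually below it.\<close>
  define c where "c = 2 * \<bar>\<beta>\<bar> + 1"
  have close: "\<exists>n0. \<forall>m\<ge>n0. \<bar>h (\<tau> m + r) - h (\<tau> m)\<bar> \<le> c"
    if r: "0 \<le> r" "r \<le> 2" and \<tau>: "\<And>n. real n \<le> \<tau> n" for r and \<tau> :: "nat \<Rightarrow> real"
  proof -
    have "filterlim \<tau> at_top sequentially"
      using filterlim_at_top_mono[OF filterlim_real_sequentially] \<tau> by simp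
    from filterlim_compose[OF lim[of r] this]
    have "(\<lambda>n. \<bar>h (\<tau> n + r) - h (\<tau> n)\<bar>) \<longlonglongrightarrow> \<bar>\<beta> * r\<bar>"
      by (rule tendsto_rabs)
    moreover have "\<bar>\<beta>\<bar> * r \<le> \<bar>\<beta>\<bar> * 2" using r by (intro mult_left_mono) auto
    then have "\<bar>\<beta> * r\<bar> < c" unfolding c_def using r by (simp add: abs_mult)
    ultimately have "\<forall>\<^sub>F n in sequentially. \<bar>h (\<tau> n + r) - h (\<tau> n)\<bar> < c"
      by (rule order_tendstoD)
    then show ?thesis by (auto simp: eventually_sequentially intro: less_imp_le)
  qed
  \<comment> \<open>\<open>E\<close> lives on [0, 2] and \<open>F\<close> on [0, 1] because
    \<open>F n\<close> will be translated by \<open>s n\<close> \<le> 1. Requiring the bound for all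
    later m makes the sets increase, so their measures converge.\<close>
  define E where "E = (\<lambda>n. {r \<in> {0..2}. \<forall>m\<ge>n. \<bar>h (t m + r) - h (t m)\<bar> \<le> c})"
  define F where "F = (\<lambda>n. {r \<in> {0..1}. \<forall>m\<ge>n. \<bar>h (t m + s m + r) - h (t m + s m)\<bar> \<le> c})"
  have [measurable]: "E n \<in> sets borel" "F n \<in> sets borel" for n
    unfolding E_def F_def by measurable
  \<comment> \<open>The thresholds 3/2 and 1/2 add up to 2, the length of the interval containing
    both \<open>E n\<close> and the translate of \<open>F n\<close>; strict inequality forces a
    common point.\<close>
  have "\<exists>n0. \<forall>n\<ge>n0. 3/2 < measure lborel (E n)"
  proof (rule measure_lborel_incseq_gt)
    show "incseq E" by (auto simp: E_def incseq_def)
    show "(\<Union>n. E n) = {0..2}" using close[OF _ _ ts(1)] by (auto simp: E_def)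
  qed auto
  moreover have "\<exists>n0. \<forall>n\<ge>n0. 1/2 < measure lborel (F n)"
  proof (rule measure_lborel_incseq_gt)
    show "incseq F" by (auto simp: F_def incseq_def)
    have "real n \<le> t n + s n" for n using ts(1,2)[of n] by linarith
    note close[OF _ _ this]
    then show "(\<Union>n. F n) = {0..1}" by (auto simp: F_def)
  qed auto
  ultimately obtain n0 n1 where n01: "\<And>n. n \<ge> n0 \<Longrightarrow> 3/2 < measure lborel (E n)"
    "\<And>n. n \<ge> n1 \<Longrightarrow> 1/2 < measure lborel (F n)" by blast
  define n where "n = max (max n0 n1) (nat \<lceil>2 * c\<rceil>)"
  have n: "3/2 < measure lborel (E n)" "1/2 < measure lborel (F n)" "2 * c \<le> real n"
    using n01[of n] real_nat_ceiling_ge[of "2 * c"] unfolding n_def by auto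
  define G where "G = (\<lambda>r. s n + r) ` F n"
  have G_eq: "G = (\<lambda>r. r - s n) -` F n" 
    by (auto simp: G_def image_iff algebra_simps) (metis add_diff_cancel_left' diff_add_cancel)
  have G_borel [measurable]: "G \<in> sets borel"
    unfolding G_eq using measurable_sets[of "\<lambda>r. r - s n" borel borel "F n"] by simp
  have "emeasure lborel G = emeasure lborel (F n)"
  proof -
    have "emeasure lborel (F n) = emeasure (distr lborel borel ((+) (- s n))) (F n)"
      by (simp only: lborel_distr_plus)
    also have "\<dots> = emeasure lborel ((+) (- s n) -` F n)"
      by (subst emeasure_distr) auto
    also have "(+) (- s n) -` F n = G" by (auto simp: G_eq vimage_def)
    finally show ?thesis by simp
  qed
  then have mG: "measure lborel G = measure lborel (F n)" by (simp add: measure_def)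
  have sub: "E n \<subseteq> {0..2}" "G \<subseteq> {0..2}"
    using ts(2,3)[of n] by (auto simp: E_def F_def G_def) 
  have fin2: "{0..2::real} \<in> fmeasurable lborel" by (rule fmeasurableI) auto
  then have fin: "E n \<in> fmeasurable lborel" "G \<in> fmeasurable lborel"
    using fmeasurableI2[of "{0..2::real}" lborel] sub by auto
  have "E n \<inter> G \<noteq> {}"
  proof
    assume "E n \<inter> G = {}"
    then have "measure lborel (E n \<union> G) = measure lborel (E n) + measure lborel G"
      using fin by (intro measure_Union) (auto simp: fmeasurable_def)
    moreover have "measure lborel (E n \<union> G) \<le> measure lborel {0..2::real}"
      using sub fin2 by (intro measure_mono_fmeasurable) auto
    ultimately show False using n mG by simp
  qed
  then obtain r where r: "r \<in> F n" "s n + r \<in> E n" by (auto simp: G_def)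
  then have "\<bar>h (t n + (s n + r)) - h (t n)\<bar> \<le> c" "\<bar>h (t n + s n + r) - h (t n + s n)\<bar> \<le> c"
    by (auto simp: E_def F_def)
  then have "\<bar>h (t n + s n) - h (t n)\<bar> \<le> 2 * c" by (simp add: add.assoc)
  with ts(4)[of n] n(3) show False by linarith
qed

text \<open>From t to u one first moves by the fractional part of u - t, at a cost of at most K, and
  then by unit steps, none of which decreases g and each of which adds at most K.\<close>

lemma almost_increasing_of_steps:
  fixes g :: "real \<Rightarrow> real"
  assumes K: "\<And>t s. T \<le> t \<Longrightarrow> 0 \<le> s \<Longrightarrow> s \<le> 1 \<Longrightarrow> \<bar>g (t + s) - g t\<bar> \<le> K"
    and step: "\<And>t. T \<le> t \<Longrightarrow> g t \<le> g (t + 1)"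
    and t: "T \<le> t" "t \<le> u"
  shows "g t \<le> g u + K" "g u \<le> g t + (u - t + 1) * K"
proof -
  define k where "k = nat \<lfloor>u - t\<rfloor>"
  define r where "r = frac (u - t)"
  have r: "0 \<le> r" "r \<le> 1" by (auto simp: r_def frac_ge_0 less_imp_le[OF frac_lt_1])
  have "real k = of_int \<lfloor>u - t\<rfloor>" using t by (simp add: k_def)
  then have u: "u = t + r + real k" by (simp add: r_def frac_def)
  have "0 \<le> K" using K[OF t(1), of 0] by simp
  have "g (t + r) \<le> g (t + r + real i) \<and> g (t + r + real i) \<le> g (t + r) + real i * K" for i
  proof (induction i)
    case (Suc i)
    have "T \<le> t + r + real i" using t r by simp
    from K[OF this, of 1] step[OF this] Suc show ?case
      by (simp add: algebra_simps)
  qed simp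
  from this[of k] K[OF t(1) r]
  have *: "g t \<le> g u + K" "g u \<le> g t + (real k + 1) * K"
    unfolding u by (auto simp: algebra_simps abs_le_iff)
  have "(real k + 1) * K \<le> (u - t + 1) * K"
    using \<open>0 \<le> K\<close> r by (intro mult_right_mono) (auto simp: u)
  with * show "g t \<le> g u + K" "g u \<le> g t + (u - t + 1) * K" by linarith+
qed

text \<open>In the variable t = ln x, the logarithm of x a(x) is g(t) = t + h(t), whose increments
  over distance s tend to (\<alpha> + 1) s. Local boundedness of increments and eventual growth over
  unit steps then give almost monotonicity and a linear bound on g, which is a power bound on x
  a(x).\<close>

lemma regularly_varying_almost_increasing:
  assumes rv: "regularly_varying a \<alpha>" and \<alpha>: "-1 < \<alpha>" and nonneg: "\<And>x. 0 < x \<Longrightarrow> 0 \<le> a x"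
  obtains X C p where "1 \<le> X" "1 \<le> C" "\<And>x. X \<le> x \<Longrightarrow> 0 < a x"
    "\<And>x y. X \<le> x \<Longrightarrow> x \<le> y \<Longrightarrow> x * a x \<le> C * (y * a y)"
    "\<And>x y. X \<le> x \<Longrightarrow> x \<le> y \<Longrightarrow> y * a y * (1 + x) ^ p \<le> C * (x * a x) * (1 + y) ^ p"
proof -
  have a_meas: "a \<in> borel_measurable (restrict_space borel {0<..})"
    and a_lim: "\<And>c. 0 < c \<Longrightarrow> ((\<lambda>x. a (c * x) / a x) \<longlongrightarrow> c powr \<alpha>) at_top"
    using rv by (auto simp: regularly_varying_def)
  have half: "\<forall>\<^sub>F x in at_top. (1/2::real) < a (1 * x) / a x"
    by (rule order_tendstoD(1)[OF a_lim]) auto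
  \<comment> \<open>Division by zero yields 0, so a ratio above 1/2 excludes a x = 0.\<close>
  have pos: "0 < a x" if "0 < x" "(1/2::real) < a (1 * x) / a x" for x
    using nonneg[OF that(1)] that(2) by (cases "a x = 0") auto
  have ev_pos: "\<forall>\<^sub>F x in at_top. 0 < a x"
    using eventually_gt_at_top[of 0] half by eventually_elim (rule pos)
  have exp_top: "filterlim (\<lambda>t::real. exp t) at_top at_top" by (rule exp_at_top)
  define h where "h = (\<lambda>t. ln (a (exp t)))"
  have [measurable]: "(\<lambda>t. a (exp t)) \<in> borel_measurable borel"
    using measurable_compose[OF measurable_restrict_space2[of exp borel "{0<..}" borel] a_meas] by simp
  have h_meas: "h \<in> borel_measurable borel" unfolding h_def by measurable
  have lim_h: "((\<lambda>t. h (t + s) - h t) \<longlongrightarrow> \<alpha> * s) at_top" for s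
  proof -
    have "((\<lambda>x. ln (a (exp s * x) / a x)) \<longlongrightarrow> ln (exp s powr \<alpha>)) at_top"
      by (intro tendsto_ln a_lim) auto
    from filterlim_compose[OF this exp_top]
    have "((\<lambda>t. ln (a (exp s * exp t) / a (exp t))) \<longlongrightarrow> \<alpha> * s) at_top" by (simp add: ln_powr)
    moreover have "\<forall>\<^sub>F t in at_top. 0 < a (exp t)"
      using exp_top[unfolded filterlim_iff] ev_pos by blast
    then have "\<forall>\<^sub>F t in at_top. ln (a (exp s * exp t) / a (exp t)) = h (t + s) - h t"
    proof -
      have "filterlim (\<lambda>t::real. exp s * exp t) at_top at_top"
        using filterlim_tendsto_pos_mult_at_top[OF tendsto_const _ exp_top, of "exp s"] by simp
      then have "\<forall>\<^sub>F t in at_top. 0 < a (exp s * exp t)"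
        using ev_pos unfolding filterlim_iff by blast
      with \<open>\<forall>\<^sub>F t in at_top. 0 < a (exp t)\<close> show ?thesis
        by eventually_elim (simp add: h_def ln_div exp_add mult.commute)
    qed
    ultimately show ?thesis by (rule Lim_transform_eventually)
  qed
  obtain T0 C0 where TC: "\<And>t s. T0 \<le> t \<Longrightarrow> 0 \<le> s \<Longrightarrow> s \<le> 1 \<Longrightarrow> \<bar>h (t + s) - h t\<bar> \<le> C0"
    using additive_limit_locally_bounded[OF h_meas lim_h] by blast
  \<comment> \<open>Here \<alpha> > -1 enters: the unit increments of h tend to \<alpha>, so those
    of t + h(t) are eventually positive.\<close>
  have "\<forall>\<^sub>F t in at_top. -1 < h (t + 1) - h t"
    using order_tendstoD(1)[OF lim_h[of 1], of "-1"] \<alpha> by simp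
  then obtain T1 where T1: "\<And>t. T1 \<le> t \<Longrightarrow> -1 < h (t + 1) - h t"
    by (auto simp: eventually_at_top_linorder)
  obtain X0 where X0: "\<And>x. X0 \<le> x \<Longrightarrow> 0 < a x" using ev_pos by (auto simp: eventually_at_top_linorder)
  define g where "g t = t + h t" for t
  define K where "K = C0 + 1"
  define T where "T = max T0 T1"
  define X where "X = max (max 1 X0) (exp T)"
  have g1: "\<bar>g (t + s) - g t\<bar> \<le> K" if "T \<le> t" "0 \<le> s" "s \<le> 1" for t s
    using TC[of t s] that by (simp add: g_def K_def T_def)
  have g2: "g t \<le> g (t + 1)" if "T \<le> t" for t
    using T1[of t] that by (simp add: g_def T_def)
  have K0: "0 \<le> K" using g1[of T 0] by simp
  have eg: "x * a x = exp (g (ln x))" and x0: "0 < x" and Tx: "T \<le> ln x" if "X \<le> x" for x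
  proof -
    show "0 < x" using that by (simp add: X_def)
    then show "x * a x = exp (g (ln x))" "T \<le> ln x"
      using that X0[of x] by (auto simp: g_def h_def exp_add X_def ln_ge_iff)
  qed
  define p where "p = nat \<lceil>K\<rceil>"
  \<comment> \<open>The factor exp K is the defect of monotonicity; 2^p comes from replacing y / x
    by (1 + y) / (1 + x), which costs at most a factor 2 when x \<ge> 1.\<close>
  define C where "C = exp K * 2 ^ p"
  have expK: "1 \<le> exp K" using K0 by simp
  have C: "exp K \<le> C" unfolding C_def using mult_left_mono[of 1 "2 ^ p" "exp K"] by simp
  show ?thesis
  proof
    show "1 \<le> X" by (simp add: X_def)
    show "1 \<le> C" using C expK by linarith
    show "0 < a x" if "X \<le> x" for x using that by (auto intro: X0 simp: X_def)
    fix x y assume xy: "X \<le> x" "x \<le> y"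
    then have y: "X \<le> y" by simp
    note xy0 = x0[OF xy(1)] x0[OF y]
    have ln: "ln x \<le> ln y" using xy xy0 by simp
    note g = almost_increasing_of_steps[of T g K, OF g1 g2 Tx[OF xy(1)] ln, simplified]
    have "x * a x \<le> exp K * (y * a y)"
      unfolding eg[OF xy(1)] eg[OF y] using g(1) by (simp add: exp_add[symmetric] add.commute)
    also have "\<dots> \<le> C * (y * a y)"
      using C by (intro mult_right_mono) (auto simp: eg[OF y])
    finally show "x * a x \<le> C * (y * a y)" .
    have "g (ln y) \<le> g (ln x) + K + (ln y - ln x) * K" using g(2) by (simp add: algebra_simps)
    also have "(ln y - ln x) * K \<le> (ln y - ln x) * real p"
      using ln K0 by (intro mult_left_mono) (auto simp: p_def)
    finally have "y * a y \<le> exp (g (ln x) + K + real p * (ln y - ln x))"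
      unfolding eg[OF y] by (simp add: mult.commute)
    also have "\<dots> = x * a x * exp K * (y / x) ^ p"
      using xy0 by (simp add: exp_add eg[OF xy(1)] exp_of_nat_mult exp_diff)
    also have "\<dots> \<le> x * a x * exp K * (2 * ((1 + y) / (1 + x))) ^ p"
    proof -
      have "1 \<le> x" using xy by (simp add: X_def)
      then have "y * 1 + 0 \<le> x * y + x * 2" using xy0 by (intro add_mono) auto
      then have "y / x \<le> 2 * ((1 + y) / (1 + x))" using xy0
        by (simp add: field_simps)
      then show ?thesis using xy0 by (intro mult_left_mono power_mono) (auto simp: eg[OF xy(1)])
    qed
    also have "\<dots> = C * (x * a x) * (1 + y) ^ p / (1 + x) ^ p"
      unfolding C_def power_mult_distrib power_divide by (simp add: mult_ac)
    finally show "y * a y * (1 + x) ^ p \<le> C * (x * a x) * (1 + y) ^ p"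
      using xy0 by (simp add: field_simps)
  qed
qed

section \<open>Weights of polynomial growth\<close>

locale growth_weight =
  fixes b :: "real \<Rightarrow> real" and p :: nat
  assumes b_mono: "mono b" and b_pos: "\<And>x. 0 < b x"
    and b_poly: "\<And>x y. 0 \<le> x \<Longrightarrow> x \<le> y \<Longrightarrow> b y * (1 + x) ^ p \<le> b x * (1 + y) ^ p"
begin

text \<open>The interval is empty for negative x, so \<open>B\<close> vanishes there and is monotone
  on the whole line.\<close>

definition B :: "real \<Rightarrow> real" where "B x = integral {0..x} b"

definition \<Psi> :: "real \<Rightarrow> real" where "\<Psi> x = x * b x"

lemma b_le: "x \<le> y \<Longrightarrow> b x \<le> b y" using b_mono by (rule monoD)

text \<open>The form in which polynomial growth is used: shifts that are small relative to 1 + x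
  change \<open>b\<close> by a factor close to 1, whether they go up or down.\<close>

lemma b_le_power:
  assumes "0 \<le> x" "0 \<le> y" "1 + y \<le> c * (1 + x)" "1 \<le> c"
  shows "b y \<le> c ^ p * b x"
proof (cases "x \<le> y")
  case True
  have "b y * (1 + x) ^ p \<le> b x * (1 + y) ^ p" by (rule b_poly[OF assms(1) True])
  also have "\<dots> \<le> b x * (c * (1 + x)) ^ p"
    using assms b_pos[of x] by (intro mult_left_mono power_mono) auto
  finally have "b y * (1 + x) ^ p \<le> (c ^ p * b x) * (1 + x) ^ p"
    by (simp add: power_mult_distrib mult_ac)
  then show ?thesis using assms(1) by (simp add: mult_le_cancel_right not_less)
next
  case False
  then have "b y \<le> 1 * b x" using b_le[of y x] by simp
  also have "\<dots> \<le> c ^ p * b x" using assms b_pos[of x] by (intro mult_right_mono) auto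
  finally show ?thesis .
qed

lemma b_scale: "0 \<le> x \<Longrightarrow> 1 \<le> c \<Longrightarrow> b (c * x) \<le> c ^ p * b x"
  by (rule b_le_power) (auto simp: algebra_simps)

lemma b_integrable: "b integrable_on {x..y}"
  by (rule integrable_on_mono_on) (use b_le in \<open>auto simp: mono_on_def\<close>)

lemma B_diff:
  assumes "0 \<le> x" "x \<le> y"
  shows "(y - x) * b x \<le> B y - B x" "B y - B x \<le> (y - x) * b y"
proof -
  have "B x + integral {x..y} b = B y"
    unfolding B_def using assms b_integrable by (intro Henstock_Kurzweil_Integration.integral_combine) auto
  then have eq: "B y - B x = integral {x..y} b" by simp
  have "integral {x..y} (\<lambda>_. b x) \<le> integral {x..y} b" "integral {x..y} b \<le> integral {x..y} (\<lambda>_. b y)"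
    using b_le b_integrable by (intro integral_le; auto)+
  then show "(y - x) * b x \<le> B y - B x" "B y - B x \<le> (y - x) * b y"
    using assms unfolding eq by auto
qed

lemma B_0: "B 0 = 0" by (simp add: B_def)

lemma B_mono: "mono B"
proof
  fix x y :: real assume "x \<le> y"
  show "B x \<le> B y"
  proof (cases "0 \<le> x")
    case True
    have "0 \<le> (y - x) * b x" using \<open>x \<le> y\<close> less_imp_le[OF b_pos] by (intro mult_nonneg_nonneg) auto
    with B_diff(1)[OF True \<open>x \<le> y\<close>] show ?thesis by simp
  next
    case False
    then have "B x = 0" by (simp add: B_def)
    moreover have "0 \<le> B y" unfolding B_def
      using less_imp_le[OF b_pos] b_integrable by (intro integral_nonneg) auto
    ultimately show ?thesis by simp
  qed
qed

lemma B_le: "x \<le> y \<Longrightarrow> B x \<le> B y" using B_mono by (rule monoD)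

lemma B_nonneg: "0 \<le> B x"
  unfolding B_def using less_imp_le[OF b_pos] b_integrable by (intro integral_nonneg) auto

lemma B_le_\<Psi>: "0 \<le> x \<Longrightarrow> B x \<le> \<Psi> x"
  using B_diff(2)[of 0 x] by (simp add: B_0 \<Psi>_def)

text \<open>Only the upper half [x/2, x] of the integral is kept: it is at least (x/2) b(x/2), and
  halving the argument costs 2^p.\<close>

lemma \<Psi>_le_B:
  assumes "0 \<le> x"
  shows "\<Psi> x \<le> 2 ^ (p + 1) * B x"
proof -
  have "b x = b (2 * (x / 2))" by simp
  also have "\<dots> \<le> 2 ^ p * b (x / 2)" using assms by (intro b_scale) auto
  finally have "x * b x \<le> x * (2 ^ p * b (x / 2))" using assms by (intro mult_left_mono) auto
  also have "\<dots> = 2 ^ (p + 1) * ((x - x / 2) * b (x / 2))" by simp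
  also have "\<dots> \<le> 2 ^ (p + 1) * (B x - B (x / 2))" using assms by (intro mult_left_mono B_diff) auto
  also have "\<dots> \<le> 2 ^ (p + 1) * B x" using B_nonneg by simp
  finally show ?thesis by (simp add: \<Psi>_def)
qed

lemma \<Psi>_nonneg: "0 \<le> x \<Longrightarrow> 0 \<le> \<Psi> x"
  using b_pos[of x] by (simp add: \<Psi>_def)

lemma \<Psi>_le: "0 \<le> x \<Longrightarrow> x \<le> y \<Longrightarrow> \<Psi> x \<le> \<Psi> y"
  unfolding \<Psi>_def using b_pos[of x] by (intro mult_mono b_le) auto

lemma \<Psi>_add:
  assumes "0 \<le> s" "0 \<le> t"
  shows "\<Psi> (s + t) \<le> 2 ^ (p + 1) * (\<Psi> s + \<Psi> t)"
proof -
  have *: "\<Psi> (2 * x) \<le> 2 ^ (p + 1) * \<Psi> x" if "0 \<le> x" for x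
    using mult_left_mono[OF b_scale[OF that, of 2], of "2 * x"] that by (simp add: \<Psi>_def mult_ac)
  have "\<Psi> (s + t) \<le> \<Psi> (2 * max s t)" using assms by (intro \<Psi>_le) auto
  also have "\<dots> \<le> 2 ^ (p + 1) * \<Psi> (max s t)" using assms by (intro *) auto
  also have "\<dots> \<le> 2 ^ (p + 1) * (\<Psi> s + \<Psi> t)"
    using assms \<Psi>_nonneg by (intro mult_left_mono) (auto simp: max_def)
  finally show ?thesis .
qed

lemma b_measurable [measurable]: "b \<in> borel_measurable borel" 
  by (rule borel_measurable_mono[OF b_mono])

lemma B_measurable [measurable]: "B \<in> borel_measurable borel"
  by (rule borel_measurable_mono[OF B_mono])

lemma \<Psi>_measurable [measurable]: "\<Psi> \<in> borel_measurable borel"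
  unfolding \<Psi>_def by measurable

end

section \<open>Elementary logarithmic inequalities\<close>

lemma ln_plus_measurable [measurable]: "ln_plus \<in> borel_measurable borel"
  unfolding ln_plus_def by measurable

lemma ln_plus_nonneg: "0 \<le> ln_plus x" by (simp add: ln_plus_def)

lemma ln_plus_mono: "0 \<le> x \<Longrightarrow> x \<le> y \<Longrightarrow> ln_plus x \<le> ln_plus y"
  by (cases "x = 0") (auto simp: ln_plus_def max.coboundedI1)

lemma ln_plus_mult_le: "0 < x \<Longrightarrow> 0 < y \<Longrightarrow> ln_plus (x * y) \<le> ln_plus x + ln_plus y"
  by (auto simp: ln_plus_def ln_mult)

lemma ln_1_plus_le: "0 \<le> x \<Longrightarrow> ln (1 + x) \<le> 1 + ln_plus x"
proof -
  assume x: "0 \<le> x"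
  have "ln (1 + x) \<le> ln (2 * max 1 x)" using x by (subst ln_le_cancel_iff) auto
  also have "\<dots> = ln 2 + ln_plus x" using x by (cases "x = 0"; cases "1 \<le> x") (auto simp: ln_mult ln_plus_def max_def)
  also have "ln 2 \<le> (1::real)" using ln_le_minus_one[of 2] by simp
  finally show ?thesis by simp
qed

text \<open>A single term z^m / m! of the exponential series is at most exp z; take z = k + ln (1 +
  r).\<close>

lemma power_ln_le_linear:
  fixes k :: real
  assumes "0 \<le> k"
  shows "\<exists>C\<ge>0. \<forall>r\<ge>0. (k + ln (1 + r)) ^ m \<le> C * (1 + r)"
proof (intro exI conjI allI impI)
  fix r :: real assume r: "0 \<le> r"
  have "(k + ln (1 + r)) ^ m / fact m \<le> exp (k + ln (1 + r))"
  proof -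
    define z where "z = k + ln (1 + r)"
    have z: "0 \<le> z" using r assms by (simp add: z_def)
    have "(\<lambda>n. z ^ n /\<^sub>R fact n) sums exp z" by (rule exp_converges)
    then have "summable (\<lambda>n. z ^ n /\<^sub>R fact n)" "exp z = (\<Sum>n. z ^ n /\<^sub>R fact n)"
      by (auto simp: sums_iff)
    moreover from this(1) have "(\<Sum>n\<in>{m}. z ^ n /\<^sub>R fact n) \<le> (\<Sum>n. z ^ n /\<^sub>R fact n)"
      using z by (intro sum_le_suminf) auto
    ultimately have "(\<Sum>n\<in>{m}. z ^ n /\<^sub>R fact n) \<le> exp z" by simp
    then show ?thesis by (simp add: z_def scaleR_conv_of_real divide_inverse_commute)
  qed
  then show "(k + ln (1 + r)) ^ m \<le> (fact m * exp k) * (1 + r)"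
    using r by (simp add: exp_add divide_le_eq mult_ac)
qed simp

section \<open>Pointwise estimates for one step, with one chosen child\<close>

context growth_weight
begin

text \<open>Read y as the weight of the chosen child, x as its value, s as the total and w as the
  total weight. On the good event, B(l x) is at most B(l K) and the whole of B(l (w/2)) is covered
  by B(l s). Off it, l x - l s is at most (ln y)^-, and \<open>b\<close> at l x bounds the slope of
  \<open>B\<close> over the drop. Truncation by T does not increase a drop.\<close>

lemma B_step_lower:
  fixes K T :: real
  assumes y: "0 < y" and x: "0 \<le> x" and s: "y * x \<le> s" "0 \<le> s" and w: "0 \<le> w"
  defines "good \<equiv> (if x \<le> K \<and> w / 2 \<le> s then 1 else 0 :: real)"
  shows "B (min (ln_plus x) T) + good * B (min (ln_plus (w / 2)) T)
    \<le> B (min (ln_plus s) T) + max 0 (- ln y) * b (ln_plus x) + good * B (ln_plus K)"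
proof -
  have neg: "0 \<le> max 0 (- ln y) * b (ln_plus x)" using b_pos[of "ln_plus x"] by simp
  show ?thesis
  proof (cases "x \<le> K \<and> w / 2 \<le> s")
    case True
    then have "B (min (ln_plus x) T) \<le> B (ln_plus K)"
      using ln_plus_mono[OF x] by (intro B_le) (auto simp: min.coboundedI1)
    moreover have "B (min (ln_plus (w / 2)) T) \<le> B (min (ln_plus s) T)"
      using ln_plus_mono[of "w / 2" s] w True by (intro B_le) auto
    ultimately show ?thesis using True neg by (simp add: good_def)
  next
    case False
    then have g: "good = 0" by (auto simp: good_def)
    show ?thesis
    proof (cases "ln_plus x \<le> ln_plus s")
      case True
      then have "B (min (ln_plus x) T) \<le> B (min (ln_plus s) T)" by (intro B_le) auto
      with neg g show ?thesis by simp
    next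
      case less: False
      then have pos: "0 < ln_plus x" using ln_plus_nonneg[of s] by linarith
      then have x0: "0 < x" "ln_plus x = ln x" using x by (cases "x = 0"; auto simp: ln_plus_def max_def split: if_splits)+
      have "ln (y * x) \<le> ln s" using s x0 y by (subst ln_le_cancel_iff) (auto intro: less_le_trans[of 0 "y * x"])
      then have d: "ln_plus x - ln_plus s \<le> - ln y"
        using x0 y by (simp add: ln_mult ln_plus_def)
      have "B (min (ln_plus x) T) \<le> B (min (ln_plus s) T) + (ln_plus x - ln_plus s) * b (ln_plus x)"
      proof (cases "0 \<le> min (ln_plus s) T")
        case True
        have "B (min (ln_plus x) T) - B (min (ln_plus s) T)
            \<le> (min (ln_plus x) T - min (ln_plus s) T) * b (min (ln_plus x) T)"
          using True less by (intro B_diff) auto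
        also have "\<dots> \<le> (ln_plus x - ln_plus s) * b (ln_plus x)"
          using True less less_imp_le[OF b_pos] by (intro mult_mono b_le) auto
        finally show ?thesis by simp
      next
        case False
        then have "T < 0" using ln_plus_nonneg[of s] by (auto simp: min_def split: if_splits)
        then have "min (ln_plus x) T = min (ln_plus s) T" using ln_plus_nonneg[of s] ln_plus_nonneg[of x] by auto
        then show ?thesis using less b_pos[of "ln_plus x"] by simp
      qed
      also have "(ln_plus x - ln_plus s) * b (ln_plus x) \<le> max 0 (- ln y) * b (ln_plus x)"
        using d less_imp_le[OF b_pos] by (intro mult_right_mono) auto
      finally show ?thesis using g by simp
    qed
  qed
qed

text \<open>A first-order expansion of \<open>B\<close> at L. If 0 \<le> z \<le> \<delta> (1 + L),
  the slope grows by at most (1 + \<delta>)^p; for larger z one has L \<le> z / \<delta>, and the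
  whole increment is paid by \<Psi>(z). Downward only the first t0 units are counted, over which the
  slope stays above b(L) / (1 + \<delta>)^p.\<close>

lemma B_drift:
  assumes \<delta>: "0 < \<delta>" and t0: "0 \<le> t0" and L: "t0 \<le> L" "1 + L \<le> (1 + \<delta>) * (1 + L - t0)"
  shows "B (max 0 (L + z)) + b L * min (max 0 (- z)) t0 / (1 + \<delta>) ^ p
    \<le> B L + (1 + \<delta>) ^ p * b L * max 0 z + (1 + 1 / \<delta>) ^ p * \<Psi> (max 0 z)"
proof (cases "0 \<le> z")
  case True
  have L0: "0 \<le> L" using L t0 by simp
  have "B (L + z) - B L \<le> z * b (L + z)" using B_diff(2)[of L "L + z"] True L0 by simp
  also have "\<dots> \<le> (1 + \<delta>) ^ p * b L * z + (1 + 1 / \<delta>) ^ p * \<Psi> z"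
  proof (cases "z \<le> \<delta> * (1 + L)")
    case le: True
    have "b (L + z) \<le> (1 + \<delta>) ^ p * b L"
      using le True L0 \<delta> by (intro b_le_power) (auto simp: algebra_simps)
    then have "z * b (L + z) \<le> (1 + \<delta>) ^ p * b L * z" using True by (simp add: mult_left_mono mult_ac)
    moreover have "0 \<le> (1 + 1 / \<delta>) ^ p * \<Psi> z" using \<delta> \<Psi>_nonneg[OF True] by simp
    ultimately show ?thesis by simp
  next
    case False
    then have "L \<le> z / \<delta>" using \<delta> by (simp add: field_simps)
    then have "b (L + z) \<le> b ((1 + 1 / \<delta>) * z)" by (intro b_le) (simp add: algebra_simps)
    also have "\<dots> \<le> (1 + 1 / \<delta>) ^ p * b z" using True \<delta> by (intro b_scale) auto
    finally have "z * b (L + z) \<le> (1 + 1 / \<delta>) ^ p * \<Psi> z"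
      using True by (simp add: \<Psi>_def mult_left_mono mult_ac)
    moreover have "0 \<le> (1 + \<delta>) ^ p * b L * z" using \<delta> True b_pos[of L] by simp
    ultimately show ?thesis by simp
  qed
  finally show ?thesis using True t0 L0 by (auto simp: max_def \<Psi>_def)
next
  case False
  define \<tau> where "\<tau> = min (- z) t0"
  have \<tau>: "0 \<le> \<tau>" "\<tau> \<le> t0" "\<tau> \<le> - z" using False t0 by (auto simp: \<tau>_def)
  have "b L \<le> (1 + \<delta>) ^ p * b (L - t0)" using L t0 \<delta> by (intro b_le_power) (auto simp: algebra_simps)
  also have "\<dots> \<le> (1 + \<delta>) ^ p * b (L - \<tau>)" using \<tau> \<delta> by (intro mult_left_mono b_le) auto
  finally have "b L / (1 + \<delta>) ^ p \<le> b (L - \<tau>)" using \<delta> by (simp add: divide_le_eq mult_ac)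
  then have "\<tau> * (b L / (1 + \<delta>) ^ p) \<le> \<tau> * b (L - \<tau>)" using \<tau> by (intro mult_left_mono) auto
  also have "\<dots> \<le> B L - B (L - \<tau>)" using B_diff(1)[of "L - \<tau>" L] \<tau> L by simp
  finally have "B (L - \<tau>) + b L * \<tau> / (1 + \<delta>) ^ p \<le> B L" by (simp add: mult_ac)
  moreover have "B (max 0 (L + z)) \<le> B (L - \<tau>)" using \<tau> L by (intro B_le) auto
  ultimately show ?thesis using False by (simp add: \<tau>_def \<Psi>_def)
qed

text \<open>Here r is the contribution of the siblings. If x > exp K, then y x + r \<le> x (y + r
  exp (-K)), so the logarithm moves by at most ln y + \<theta> and \<open>B_drift\<close> applies.
  If x \<le> exp K, then the total is at most exp K (w + r), and the left side is absorbed by the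
  last term; \<open>e\<close> is zero in that case.\<close>

lemma B_step_upper:
  assumes \<delta>: "0 < \<delta>" and t0: "0 \<le> t0" "t0 \<le> K" "1 + K \<le> (1 + \<delta>) * (1 + K - t0)"
    and y: "0 < y" "y \<le> w" and x: "0 \<le> x" and r: "0 \<le> r"
  defines "q \<equiv> (1 + \<delta>) ^ p" and "e \<equiv> (if exp K < x then b (ln_plus x) else 0)"
    and "\<theta> \<equiv> ln (1 + r * exp (- K) / y)"
  shows "B (ln_plus (y * x + r)) + e * min (max 0 (- ln y)) t0 / q
    \<le> B (ln_plus x) + q * e * (max 0 (ln y) + \<theta>)
      + (1 + (1 + 1 / \<delta>) ^ p) * \<Psi> (K + ln_plus (w + r))"
proof (cases "exp K < x")
  case False
  have K: "0 \<le> K" using t0 by simp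
  have "y * x + r \<le> exp K * (w + r)"
  proof -
    have "y * x \<le> w * exp K" using False y x by (intro mult_mono) auto
    moreover have "1 * r \<le> exp K * r" using K r by (intro mult_right_mono) auto
    ultimately show ?thesis by (simp add: algebra_simps)
  qed
  then have "ln_plus (y * x + r) \<le> ln_plus (exp K * (w + r))"
    using y x r by (intro ln_plus_mono) auto
  also have "\<dots> \<le> ln_plus (exp K) + ln_plus (w + r)" using y r by (intro ln_plus_mult_le) auto
  also have "ln_plus (exp K) = K" using K by (simp add: ln_plus_def)
  finally have "B (ln_plus (y * x + r)) \<le> B (K + ln_plus (w + r))" by (rule B_le)
  also have "\<dots> \<le> \<Psi> (K + ln_plus (w + r))" using K ln_plus_nonneg by (intro B_le_\<Psi>) auto
  also have "\<dots> \<le> (1 + (1 + 1 / \<delta>) ^ p) * \<Psi> (K + ln_plus (w + r))"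
    using \<delta> K ln_plus_nonneg \<Psi>_nonneg[of "K + ln_plus (w + r)"] by (simp add: distrib_right)
  finally show ?thesis using False B_nonneg[of "ln_plus x"] by (simp add: e_def)
next
  case True
  have K: "0 \<le> K" using t0 by simp
  have "0 < exp K" by simp
  with True have x0: "0 < x" by linarith
  define L where "L = ln x"
  have L: "K \<le> L" unfolding L_def using True x0 by (simp add: ln_ge_iff)
  have lx: "ln_plus x = L" using L K by (simp add: ln_plus_def L_def)
  have q: "1 \<le> q" using \<delta> by (simp add: q_def)
  define z where "z = ln y + \<theta>"
  have pos: "0 < 1 + r * exp (- K) / y" using r y by (simp add: add_pos_nonneg)
  have \<theta>: "0 \<le> \<theta>" unfolding \<theta>_def using r y by simp
  have z: "z = ln (y + r * exp (- K))" 
  proof -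
    have "y + r * exp (- K) = y * (1 + r * exp (- K) / y)" using y by (simp add: field_simps)
    then show ?thesis unfolding z_def \<theta>_def using pos y by (simp only: ln_mult_pos)
  qed
  have zpos: "0 < y + r * exp (- K)" using y r by (simp add: add_pos_nonneg)
  have "r * 1 \<le> r * (exp (- K) * x)"
    using True r by (intro mult_left_mono) (auto simp: exp_minus field_simps)
  then have "y * x + r \<le> x * (y + r * exp (- K))" by (simp add: algebra_simps)
  then have "ln_plus (y * x + r) \<le> ln_plus (x * (y + r * exp (- K)))"
    using y x r by (intro ln_plus_mono) auto
  also have "\<dots> = max 0 (L + z)"
    unfolding ln_plus_def z L_def using x0 zpos by (simp add: ln_mult max.commute)
  finally have "B (ln_plus (y * x + r)) \<le> B (max 0 (L + z))" by (rule B_le)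
  moreover have "B (max 0 (L + z)) + b L * min (max 0 (- z)) t0 / q
    \<le> B L + q * b L * max 0 z + (1 + 1 / \<delta>) ^ p * \<Psi> (max 0 z)"
    unfolding q_def
  proof (rule B_drift[OF \<delta> t0(1)])
    show "t0 \<le> L" using t0 L by simp
    have "(1 + \<delta>) * (1 + K - t0) + (L - K) \<le> (1 + \<delta>) * (1 + K - t0) + (1 + \<delta>) * (L - K)"
      using mult_right_mono[of 1 "1 + \<delta>" "L - K"] L \<delta> by simp
    with t0(3) show "1 + L \<le> (1 + \<delta>) * (1 + L - t0)" by (simp add: algebra_simps)
  qed
  \<comment> \<open>Passing from z back to ln y = z - \<theta>: the truncated negative part changes
    by at most \<theta>, and since q \<ge> 1 a cost at rate 1/q may be charged at rate q.\<close>
  moreover have "b L * (q * max 0 z + min (max 0 (- ln y)) t0 / q)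
      \<le> b L * (q * (max 0 (ln y) + \<theta>) + min (max 0 (- z)) t0 / q)"
  proof (rule mult_left_mono)
    have qq: "c / q \<le> q * c" if "0 \<le> c" for c
    proof -
      have "c * 1 \<le> c * (q * q)" using q that mult_mono[of 1 q 1 q] by (intro mult_left_mono) auto
      then show ?thesis using q by (simp add: divide_le_eq mult_ac)
    qed
    show "q * max 0 z + min (max 0 (- ln y)) t0 / q
      \<le> q * (max 0 (ln y) + \<theta>) + min (max 0 (- z)) t0 / q"
    proof (cases "0 \<le> ln y")
      case True
      then show ?thesis using \<theta> t0 by (simp add: z_def)
    next
      case neg: False
      show ?thesis
      proof (cases "0 \<le> z")
        case True
        have "min (- ln y) t0 / q \<le> q * min (- ln y) t0" using neg t0 by (intro qq) auto
        also have "\<dots> \<le> q * (- ln y)" using q by (intro mult_left_mono) auto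
        finally show ?thesis using neg True t0 by (simp add: z_def algebra_simps)
      next
        case False
        have "min (- ln y) t0 - min (- z) t0 \<le> \<theta>" using \<theta> by (auto simp: z_def min_def)
        then have "(min (- ln y) t0 - min (- z) t0) / q \<le> \<theta> / q" using q by (intro divide_right_mono) auto
        also have "\<dots> \<le> q * \<theta>" by (rule qq[OF \<theta>])
        finally show ?thesis using neg False by (simp add: diff_divide_distrib)
      qed
    qed
  qed (use b_pos[of L] in simp)
  moreover have "\<Psi> (max 0 z) \<le> \<Psi> (K + ln_plus (w + r))"
  proof (rule \<Psi>_le)
    have "r * exp (- K) \<le> r * 1" using K r by (intro mult_left_mono) auto
    then have "z \<le> ln (w + r)" unfolding z using zpos y by (subst ln_le_cancel_iff) auto
    then show "max 0 z \<le> K + ln_plus (w + r)" using K by (auto simp: ln_plus_def)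
  qed simp
  then have "(1 + 1 / \<delta>) ^ p * \<Psi> (max 0 z) \<le> (1 + (1 + 1 / \<delta>) ^ p) * \<Psi> (K + ln_plus (w + r))"
    using \<delta> \<Psi>_nonneg[of "max 0 z"] by (intro mult_mono) auto
  ultimately show ?thesis using True by (simp add: e_def lx algebra_simps)
qed

text \<open>\<Psi> is polynomially bounded and r enters only through ln (1 + r / w), so the bound
  can be made linear in r / w. Linearity matters because only the mean of the siblings' contribution
  is controlled.\<close>

lemma \<Psi>_ln_plus_add_le:
  assumes K: "0 \<le> K"
  shows "\<exists>C\<ge>0. \<forall>w>0. \<forall>r\<ge>0. \<Psi> (K + ln_plus (w + r)) \<le> C * (\<Psi> (ln_plus w) + 1 + r / w)"
proof -
  obtain C0 where C0: "0 \<le> C0" "\<And>r. 0 \<le> r \<Longrightarrow> ((1 + K) + ln (1 + r)) ^ (p + 1) \<le> C0 * (1 + r)"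
    using power_ln_le_linear[of "1 + K" "p + 1"] K by auto
  define C where "C = 2 ^ (p + 1) * (1 + b 0 * C0)"
  have *: "\<Psi> (K + ln_plus (w + r)) \<le> C * (\<Psi> (ln_plus w) + 1 + r / w)" if wr: "0 < w" "0 \<le> r" for w r
  proof -
    define v where "v = K + ln (1 + r / w)"
    have rw: "0 \<le> r / w" using wr by simp
    then have v: "0 \<le> v" using K by (simp add: v_def)
    have "w + r = w * (1 + r / w)" using wr by (simp add: field_simps)
    then have "ln_plus (w + r) \<le> ln_plus w + ln_plus (1 + r / w)"
      using wr rw by (simp only:) (intro ln_plus_mult_le add_pos_nonneg, auto)
    also have "ln_plus (1 + r / w) = ln (1 + r / w)" using rw by (simp add: ln_plus_def)
    finally have "\<Psi> (K + ln_plus (w + r)) \<le> \<Psi> (ln_plus w + v)"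
      using K ln_plus_nonneg by (intro \<Psi>_le) (auto simp: v_def)
    also have "\<dots> \<le> 2 ^ (p + 1) * (\<Psi> (ln_plus w) + \<Psi> v)" by (rule \<Psi>_add[OF ln_plus_nonneg v])
    also have "\<Psi> v \<le> b 0 * (1 + v) ^ (p + 1)"
    proof -
      have "b v \<le> b 0 * (1 + v) ^ p" using b_poly[of 0 v] v by simp
      then have "v * b v \<le> (1 + v) * (b 0 * (1 + v) ^ p)" using v b_pos[of v] by (intro mult_mono) auto
      then show ?thesis by (simp add: \<Psi>_def mult_ac)
    qed
    also have "(1 + v) ^ (p + 1) \<le> C0 * (1 + r / w)"
      using C0(2)[OF rw] by (simp add: v_def add.assoc)
    finally have "\<Psi> (K + ln_plus (w + r)) \<le> 2 ^ (p + 1) * (\<Psi> (ln_plus w) + b 0 * (C0 * (1 + r / w)))"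
      using b_pos[of 0] by simp
    also have "\<dots> \<le> C * (\<Psi> (ln_plus w) + 1 + r / w)"
    proof -
      have "\<Psi> (ln_plus w) + b 0 * (C0 * (1 + r / w)) \<le> (1 + b 0 * C0) * (\<Psi> (ln_plus w) + 1 + r / w)"
        using \<Psi>_nonneg[OF ln_plus_nonneg, of w] b_pos[of 0] C0 rw by (simp add: algebra_simps)
      then show ?thesis unfolding C_def by simp
    qed
    finally show ?thesis .
  qed
  have "0 \<le> C" using b_pos[of 0] C0 by (simp add: C_def)
  with * show ?thesis by blast
qed

end

section \<open>A monotone weight comparable to x a(x)\<close>

lemma growth_weight_exists:
  assumes rv: "regularly_varying a \<alpha>" and \<alpha>: "-1 < \<alpha>" and nonneg: "\<And>x. 0 < x \<Longrightarrow> 0 \<le> a x"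
  obtains b p X C where "growth_weight b p" "0 < X" "0 < C"
    "\<And>x. X \<le> x \<Longrightarrow> x * a x \<le> b x" "\<And>x. X \<le> x \<Longrightarrow> b x \<le> C * (x * a x)"
proof -
  obtain X C p where X: "1 \<le> X" and C: "1 \<le> C" and pos: "\<And>x. X \<le> x \<Longrightarrow> 0 < a x"
    and inc: "\<And>x y. X \<le> x \<Longrightarrow> x \<le> y \<Longrightarrow> x * a x \<le> C * (y * a y)"
    and poly: "\<And>x y. X \<le> x \<Longrightarrow> x \<le> y \<Longrightarrow> y * a y * (1 + x) ^ p \<le> C * (x * a x) * (1 + y) ^ p"
    using regularly_varying_almost_increasing[OF rv \<alpha> nonneg] by blast
  \<comment> \<open>each \<open>\<lambda>x. m x y\<close> is nondecreasing, and nonincreasing after division by \<open>(1 + x) ^ p\<close>;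
    both properties pass to the supremum over \<open>y\<close>\<close>
  define m where "m = (\<lambda>x y. y * a y * min 1 (((1 + max x 0) / (1 + y)) ^ p))"
  define b where "b = (\<lambda>x. SUP y\<in>{X..}. m x y)"
  have ya: "0 < y * a y" if "X \<le> y" for y using pos[OF that] that X by simp
  \<comment> \<open>For y up to max x X almost monotonicity gives the bound, beyond it the power
    bound does. Writing max x X also covers arguments below X, so the supremum is finite on the
    whole line.\<close>
  have m_le: "m x y \<le> C * (max x X * a (max x X))" if "X \<le> y" for x y
  proof (cases "y \<le> max x X")
    case True
    have "m x y \<le> y * a y * 1" unfolding m_def using ya[OF that] by (intro mult_left_mono) auto
    with inc[OF that True] show ?thesis by simp
  next
    case False
    have "m x y \<le> y * a y * ((1 + max x X) / (1 + y)) ^ p" unfolding m_def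
    proof (rule mult_left_mono)
      have "((1 + max x 0) / (1 + y)) ^ p \<le> ((1 + max x X) / (1 + y)) ^ p"
        using X that by (intro power_mono divide_right_mono) auto
      then show "min 1 (((1 + max x 0) / (1 + y)) ^ p) \<le> ((1 + max x X) / (1 + y)) ^ p" by simp
    qed (use ya[OF that] in simp)
    also have "\<dots> \<le> C * (max x X * a (max x X))"
      using poly[of "max x X" y] False X that by (simp add: power_divide divide_le_eq)
    finally show ?thesis .
  qed
  have bdd: "bdd_above (m x ` {X..})" for x using m_le by (auto simp: bdd_above_def)
  have m_le_b: "m x y \<le> b x" if "X \<le> y" for x y
    unfolding b_def using that bdd by (intro cSUP_upper) auto
  have m_pos: "0 < m x y" if "X \<le> y" for x y
    unfolding m_def using X that by (intro mult_pos_pos[OF ya[OF that]]) (auto simp: min_def)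
  have "growth_weight b p"
  proof
    show "mono b"
    proof
      fix x x' :: real assume "x \<le> x'"
      have "m x y \<le> m x' y" if "X \<le> y" for y
      proof -
        have "((1 + max x 0) / (1 + y)) ^ p \<le> ((1 + max x' 0) / (1 + y)) ^ p"
          using X that \<open>x \<le> x'\<close> by (intro power_mono divide_right_mono) auto
        then show ?thesis unfolding m_def using ya[OF that] by (intro mult_left_mono) auto
      qed
      then show "b x \<le> b x'" unfolding b_def using bdd by (intro cSUP_mono) auto
    qed
    show "0 < b x" for x using m_pos[of X x] m_le_b[of X x] by simp
    fix x z :: real assume xz: "0 \<le> x" "x \<le> z"
    have "m z y \<le> b x * (1 + z) ^ p / (1 + x) ^ p" if "X \<le> y" for y
    proof -
      have "min 1 (((1 + z) / (1 + y)) ^ p) \<le> min 1 (((1 + x) / (1 + y)) ^ p) * ((1 + z) / (1 + x)) ^ p"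
      proof -
        have "1 \<le> ((1 + z) / (1 + x)) ^ p" using xz by (intro one_le_power) auto
        moreover have "((1 + z) / (1 + y)) ^ p = ((1 + x) / (1 + y)) ^ p * ((1 + z) / (1 + x)) ^ p"
          using xz by (simp add: power_divide)
        moreover have "1 * 1 \<le> ((1 + x) / (1 + y)) ^ p * ((1 + z) / (1 + x)) ^ p"
          if "1 \<le> ((1 + x) / (1 + y)) ^ p"
          using that calculation(1) by (intro mult_mono) auto
        ultimately show ?thesis by (auto simp: min_def)
      qed
      from mult_left_mono[OF this less_imp_le[OF ya[OF that]]]
      have "m z y \<le> m x y * ((1 + z) / (1 + x)) ^ p"
        using xz by (simp add: m_def max_absorb1 mult.assoc)
      also have "\<dots> \<le> b x * ((1 + z) / (1 + x)) ^ p"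
        using m_le_b[OF that] xz by (intro mult_right_mono) auto
      finally show ?thesis by (simp add: power_divide)
    qed
    then have "b z \<le> b x * (1 + z) ^ p / (1 + x) ^ p"
      unfolding b_def by (intro cSUP_least) auto
    then show "b z * (1 + x) ^ p \<le> b x * (1 + z) ^ p" using xz by (simp add: field_simps)
  qed
  moreover have "x * a x \<le> b x" if "X \<le> x" for x
    using m_le_b[OF that, of x] X that by (simp add: m_def)
  moreover have "b x \<le> C * (x * a x)" if "X \<le> x" for x
    unfolding b_def using m_le[of _ x] that by (intro cSUP_least) (auto simp: max_absorb1)
  ultimately show thesis using that[of b p X C] X C by simp
qed

section \<open>One step of the smoothing recursion\<close>

lemma borel_measurable_nn_integral_countable [measurable (raw)]:
  fixes f :: "'a \<Rightarrow> 'i::countable \<Rightarrow> ennreal"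
  assumes [measurable]: "\<And>i. (\<lambda>x. f x i) \<in> borel_measurable M"
  shows "(\<lambda>x. \<integral>\<^sup>+ i. f x i \<partial>count_space UNIV) \<in> borel_measurable M"
proof (cases "finite (UNIV :: 'i set)")
  case True
  then show ?thesis by (simp add: nn_integral_count_space_finite)
next
  case False
  have "bij_betw (from_nat_into UNIV) UNIV (UNIV :: 'i set)"
    using False by (intro bij_betw_from_nat_into) auto
  then have "(\<integral>\<^sup>+ i. f x i \<partial>count_space UNIV) = (\<Sum>n. f x (from_nat_into UNIV n))" for x
    by (simp add: nn_integral_bij_count_space[symmetric] nn_integral_count_space_nat)
  then show ?thesis by simp
qed

lemma nn_integral_countable_swap:
  fixes f :: "'a \<Rightarrow> 'i::countable \<Rightarrow> ennreal"
  assumes "\<And>i. (\<lambda>x. f x i) \<in> borel_measurable M"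
  shows "(\<integral>\<^sup>+ x. \<integral>\<^sup>+ i. f x i \<partial>count_space UNIV \<partial>M) = (\<integral>\<^sup>+ i. \<integral>\<^sup>+ x. f x i \<partial>M \<partial>count_space UNIV)"
  using assms by (intro nn_integral_count_space_nn_integral) auto

text \<open>\<open>factor\<close> expresses through integrals that X j has the law of X0 and is
  independent of all weights and of the other X i. Coordinate j is set to 0 so that g cannot see X
  j. The weights among themselves may be dependent in any way.\<close>

locale smoothing = prob_space P
  for P :: "'w measure" +
  fixes A X :: "int \<Rightarrow> 'w \<Rightarrow> real" and X0 :: "'w \<Rightarrow> real"
  assumes A_measurable [measurable]: "\<And>j. A j \<in> borel_measurable P"
    and X_measurable [measurable]: "\<And>j. X j \<in> borel_measurable P"
    and X0_measurable [measurable]: "X0 \<in> borel_measurable P"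
    and A_nonneg: "\<And>j \<omega>. 0 \<le> A j \<omega>"
    and X_nonneg: "\<And>j \<omega>. 0 \<le> X j \<omega>"
    and X0_nonneg: "\<And>\<omega>. 0 \<le> X0 \<omega>"
    and sum_A: "(\<integral>\<^sup>+ j. \<integral>\<^sup>+ \<omega>. ennreal (A j \<omega>) \<partial>P \<partial>count_space UNIV) = 1"
    and mean_X0: "(\<integral>\<^sup>+ \<omega>. ennreal (X0 \<omega>) \<partial>P) = 1"
    and factor: "\<And>j f g. f \<in> borel_measurable borel \<Longrightarrow>
      g \<in> borel_measurable (PiM UNIV (\<lambda>_. borel) \<Otimes>\<^sub>M PiM UNIV (\<lambda>_. borel)) \<Longrightarrow>
      (\<integral>\<^sup>+ \<omega>. f (X j \<omega>) * g (\<lambda>i. A i \<omega>, \<lambda>i. if i = j then 0 else X i \<omega>) \<partial>P) =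
      (\<integral>\<^sup>+ \<omega>. f (X0 \<omega>) \<partial>P) *
      (\<integral>\<^sup>+ \<omega>. (g (\<lambda>i. A i \<omega>, \<lambda>i. if i = j then 0 else X i \<omega>) :: ennreal) \<partial>P)"
begin

text \<open>\<open>SB\<close> is the expectation under the size-biased law, in which child \<open>j\<close> is chosen with density
  \<open>A j * X j\<close>; \<open>R j\<close> below is the contribution of its siblings.\<close>

abbreviation SB :: "(int \<Rightarrow> 'w \<Rightarrow> ennreal) \<Rightarrow> ennreal" where
  "SB F \<equiv> (\<integral>\<^sup>+ j. \<integral>\<^sup>+ \<omega>. ennreal (A j \<omega> * X j \<omega>) * F j \<omega> \<partial>P \<partial>count_space UNIV)"

abbreviation SA :: "(int \<Rightarrow> 'w \<Rightarrow> ennreal) \<Rightarrow> ennreal" where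
  "SA F \<equiv> (\<integral>\<^sup>+ j. \<integral>\<^sup>+ \<omega>. ennreal (A j \<omega>) * F j \<omega> \<partial>P \<partial>count_space UNIV)"

definition V :: "int \<Rightarrow> 'w \<Rightarrow> (int \<Rightarrow> real) \<times> (int \<Rightarrow> real)" where
  "V j \<omega> = (\<lambda>i. A i \<omega>, \<lambda>i. if i = j then 0 else X i \<omega>)"

text \<open>A divergent sum gets the value 0; hence the identities for \<open>W1\<close> and
  \<open>S\<close> below hold only almost everywhere, where the sums are finite.\<close>

definition total :: "(int \<Rightarrow> real) \<Rightarrow> real" where
  "total \<alpha> = enn2real (\<integral>\<^sup>+ k. ennreal (\<alpha> k) \<partial>count_space UNIV)"

definition W1 :: "'w \<Rightarrow> real" where "W1 \<omega> = total (\<lambda>i. A i \<omega>)"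

definition S :: "'w \<Rightarrow> real" where "S \<omega> = total (\<lambda>i. A i \<omega> * X i \<omega>)"

definition cross :: "(int \<Rightarrow> real) \<times> (int \<Rightarrow> real) \<Rightarrow> real" where
  "cross z = total (\<lambda>i. fst z i * snd z i)"

definition R :: "int \<Rightarrow> 'w \<Rightarrow> real" where "R j \<omega> = cross (V j \<omega>)"

lemma total_measurable [measurable]: "total \<in> borel_measurable (PiM UNIV (\<lambda>_. borel))"
  unfolding total_def by measurable

lemma V_measurable [measurable]:
  "V j \<in> measurable P (PiM UNIV (\<lambda>_. borel) \<Otimes>\<^sub>M PiM UNIV (\<lambda>_. borel))"
  unfolding V_def by (intro measurable_Pair measurable_abs_UNIV) auto

lemma W1_measurable [measurable]: "W1 \<in> borel_measurable P"
  unfolding W1_def total_def by measurable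

lemma S_measurable [measurable]: "S \<in> borel_measurable P"
  unfolding S_def total_def by measurable

lemma cross_measurable [measurable]:
  "cross \<in> borel_measurable (PiM UNIV (\<lambda>_. borel) \<Otimes>\<^sub>M PiM UNIV (\<lambda>_. borel))"
  unfolding cross_def total_def by measurable

lemma R_measurable [measurable]: "R j \<in> borel_measurable P"
  unfolding R_def by measurable

lemma total_nonneg: "0 \<le> total \<alpha>" by (simp add: total_def)

lemma W1_nonneg: "0 \<le> W1 \<omega>" and S_nonneg: "0 \<le> S \<omega>" and R_nonneg: "0 \<le> R j \<omega>"
  by (auto simp: W1_def S_def R_def cross_def total_nonneg)

text \<open>The density A_j X_j splits: under the size-biased law X_j is independent of the
  surroundings V_j, its own law is that of X0 biased by its size, and V_j is weighted by A_j
  alone.\<close>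

lemma SB_factor:
  fixes f :: "real \<Rightarrow> ennreal" and g :: "int \<Rightarrow> (int \<Rightarrow> real) \<times> (int \<Rightarrow> real) \<Rightarrow> ennreal"
  assumes f [measurable]: "f \<in> borel_measurable borel"
    and g [measurable]: "\<And>j. g j \<in> borel_measurable (PiM UNIV (\<lambda>_. borel) \<Otimes>\<^sub>M PiM UNIV (\<lambda>_. borel))"
  shows "SB (\<lambda>j \<omega>. f (X j \<omega>) * g j (V j \<omega>)) =
    (\<integral>\<^sup>+ \<omega>. ennreal (X0 \<omega>) * f (X0 \<omega>) \<partial>P) * SA (\<lambda>j \<omega>. g j (V j \<omega>))"
proof -
  have "(\<integral>\<^sup>+ \<omega>. ennreal (A j \<omega> * X j \<omega>) * (f (X j \<omega>) * g j (V j \<omega>)) \<partial>P) =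
      (\<integral>\<^sup>+ \<omega>. ennreal (X0 \<omega>) * f (X0 \<omega>) \<partial>P) * (\<integral>\<^sup>+ \<omega>. ennreal (A j \<omega>) * g j (V j \<omega>) \<partial>P)" for j
  proof -
    have "(\<lambda>z. ennreal (fst z j) * g j z) \<in>
        borel_measurable (PiM UNIV (\<lambda>_. borel) \<Otimes>\<^sub>M PiM UNIV (\<lambda>_. borel))"
      by measurable
    from factor[OF _ this, of "\<lambda>x. ennreal x * f x" j] show ?thesis
      by (simp add: V_def ennreal_mult A_nonneg X_nonneg mult_ac)
  qed
  then show ?thesis by (simp add: nn_integral_cmult)
qed

lemma AE_W1: "AE \<omega> in P. ennreal (W1 \<omega>) = (\<integral>\<^sup>+ k. ennreal (A k \<omega>) \<partial>count_space UNIV)"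
proof -
  have "(\<integral>\<^sup>+ \<omega>. \<integral>\<^sup>+ k. ennreal (A k \<omega>) \<partial>count_space UNIV \<partial>P) \<noteq> \<infinity>"
    by (subst nn_integral_countable_swap) (auto simp: sum_A)
  then have "AE \<omega> in P. (\<integral>\<^sup>+ k. ennreal (A k \<omega>) \<partial>count_space UNIV) \<noteq> \<infinity>"
    by (intro nn_integral_PInf_AE) auto
  then show ?thesis
    by eventually_elim (simp add: W1_def total_def less_top)
qed

lemma sum_AX: "SB (\<lambda>_ _. 1) = 1"
proof -
  have "SB (\<lambda>_ _. 1 * 1) = (\<integral>\<^sup>+ \<omega>. ennreal (X0 \<omega>) * 1 \<partial>P) * SA (\<lambda>_ _. 1)"
    by (rule SB_factor) auto
  then show ?thesis by (simp only: mult_1_right mean_X0 sum_A)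
qed

lemma AE_S: "AE \<omega> in P. ennreal (S \<omega>) = (\<integral>\<^sup>+ k. ennreal (A k \<omega> * X k \<omega>) \<partial>count_space UNIV)"
proof -
  have "(\<integral>\<^sup>+ \<omega>. \<integral>\<^sup>+ k. ennreal (A k \<omega> * X k \<omega>) \<partial>count_space UNIV \<partial>P) \<noteq> \<infinity>"
    by (subst nn_integral_countable_swap) (use sum_AX in auto)
  then have "AE \<omega> in P. (\<integral>\<^sup>+ k. ennreal (A k \<omega> * X k \<omega>) \<partial>count_space UNIV) \<noteq> \<infinity>"
    by (intro nn_integral_PInf_AE) auto
  then show ?thesis
    by eventually_elim (simp add: S_def total_def less_top)
qed

lemma AE_decomposition: "AE \<omega> in P. \<forall>j. S \<omega> = A j \<omega> * X j \<omega> + R j \<omega> \<and> A j \<omega> \<le> W1 \<omega>"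
  using AE_S AE_W1
proof eventually_elim
  case (elim \<omega>)
  show ?case
  proof
    fix j
    let ?s = "\<integral>\<^sup>+ k. ennreal (A k \<omega> * (if k = j then 0 else X k \<omega>)) \<partial>count_space UNIV"
    have "ennreal (S \<omega>) = (\<integral>\<^sup>+ k. ennreal (A j \<omega> * X j \<omega>) * indicator {j} k +
        ennreal (A k \<omega> * (if k = j then 0 else X k \<omega>)) \<partial>count_space UNIV)"
      unfolding elim(1) by (intro nn_integral_cong) (auto simp: indicator_def)
    also have "\<dots> = ennreal (A j \<omega> * X j \<omega>) + ?s"
      by (subst nn_integral_add) (auto simp: nn_integral_cmult_indicator)
    finally have eq: "ennreal (S \<omega>) = ennreal (A j \<omega> * X j \<omega>) + ?s" .
    then have "?s \<noteq> \<infinity>" by auto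
    then have "?s = ennreal (R j \<omega>)"
      by (simp add: R_def cross_def V_def total_def less_top)
    with eq have "ennreal (S \<omega>) = ennreal (A j \<omega> * X j \<omega> + R j \<omega>)"
      by (simp add: A_nonneg X_nonneg R_nonneg)
    then have "S \<omega> = A j \<omega> * X j \<omega> + R j \<omega>"
      by (subst (asm) ennreal_inj) (auto simp: A_nonneg X_nonneg R_nonneg S_nonneg)
    moreover have "ennreal (A j \<omega>) \<le> ennreal (W1 \<omega>)"
      unfolding elim(2) by (rule nn_integral_ge_point) simp
    then have "A j \<omega> \<le> W1 \<omega>" using W1_nonneg by (simp add: ennreal_le_iff)
    ultimately show "S \<omega> = A j \<omega> * X j \<omega> + R j \<omega> \<and> A j \<omega> \<le> W1 \<omega>" ..
  qed
qed

lemma SA_const: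
  assumes [measurable]: "h \<in> borel_measurable P"
  shows "SA (\<lambda>_. h) = (\<integral>\<^sup>+ \<omega>. ennreal (W1 \<omega>) * h \<omega> \<partial>P)"
proof -
  have "SA (\<lambda>_. h) = (\<integral>\<^sup>+ \<omega>. \<integral>\<^sup>+ j. ennreal (A j \<omega>) * h \<omega> \<partial>count_space UNIV \<partial>P)"
    by (rule nn_integral_countable_swap[symmetric]) auto
  also have "\<dots> = (\<integral>\<^sup>+ \<omega>. ennreal (W1 \<omega>) * h \<omega> \<partial>P)"
    using AE_W1 by (intro nn_integral_cong_AE, eventually_elim) (simp add: nn_integral_multc)
  finally show ?thesis .
qed

lemma SB_const:
  assumes [measurable]: "h \<in> borel_measurable P"
  shows "SB (\<lambda>_. h) = (\<integral>\<^sup>+ \<omega>. ennreal (S \<omega>) * h \<omega> \<partial>P)"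
proof -
  have "SB (\<lambda>_. h) = (\<integral>\<^sup>+ \<omega>. \<integral>\<^sup>+ j. ennreal (A j \<omega> * X j \<omega>) * h \<omega> \<partial>count_space UNIV \<partial>P)"
    by (rule nn_integral_countable_swap[symmetric]) auto
  also have "\<dots> = (\<integral>\<^sup>+ \<omega>. ennreal (S \<omega>) * h \<omega> \<partial>P)"
    using AE_S by (intro nn_integral_cong_AE, eventually_elim) (simp add: nn_integral_multc)
  finally show ?thesis .
qed

lemma mean_W1: "(\<integral>\<^sup>+ \<omega>. ennreal (W1 \<omega>) \<partial>P) = 1"
  using SA_const[of "\<lambda>_. 1"] sum_A by simp

lemma SB_add:
  assumes [measurable]: "\<And>j. F j \<in> borel_measurable P" "\<And>j. G j \<in> borel_measurable P"
  shows "SB (\<lambda>j \<omega>. F j \<omega> + G j \<omega>) = SB F + SB G"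
  by (simp add: distrib_left nn_integral_add)

lemma SA_add:
  assumes [measurable]: "\<And>j. F j \<in> borel_measurable P" "\<And>j. G j \<in> borel_measurable P"
  shows "SA (\<lambda>j \<omega>. F j \<omega> + G j \<omega>) = SA F + SA G"
  by (simp add: distrib_left nn_integral_add)

lemma SB_cmult:
  assumes [measurable]: "\<And>j. F j \<in> borel_measurable P"
  shows "SB (\<lambda>j \<omega>. c * F j \<omega>) = c * SB F"
  by (simp add: mult.left_commute[of _ c] nn_integral_cmult)

text \<open>Children of weight 0 carry no mass, so pointwise estimates involving ln (A j) are needed
  only where this logarithm is genuine.\<close>

lemma SB_mono:
  assumes "AE \<omega> in P. \<forall>j. 0 < A j \<omega> \<longrightarrow> F j \<omega> \<le> G j \<omega>"
  shows "SB F \<le> SB G"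
proof (rule nn_integral_mono, rule nn_integral_mono_AE)
  fix j
  show "AE \<omega> in P. ennreal (A j \<omega> * X j \<omega>) * F j \<omega> \<le> ennreal (A j \<omega> * X j \<omega>) * G j \<omega>"
    using assms
  proof eventually_elim
    case (elim \<omega>)
    then show ?case using A_nonneg[of j \<omega>] by (cases "A j \<omega> = 0") (auto intro!: mult_left_mono)
  qed
qed

text \<open>Since k is an arbitrary function of the weights, this says that the conditional mean of
  R_j given the weights is at most W1: R_j is bounded by S, and each X_i has mean 1 independently of
  the weights.\<close>

lemma mean_R:
  fixes k :: "(int \<Rightarrow> real) \<Rightarrow> ennreal"
  assumes k [measurable]: "k \<in> borel_measurable (PiM UNIV (\<lambda>_. borel))"
  shows "(\<integral>\<^sup>+ \<omega>. k (\<lambda>i. A i \<omega>) * ennreal (R j \<omega>) \<partial>P) \<le> (\<integral>\<^sup>+ \<omega>. k (\<lambda>i. A i \<omega>) * ennreal (W1 \<omega>) \<partial>P)"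
proof -
  have kA [measurable]: "(\<lambda>\<omega>. k (\<lambda>i. A i \<omega>)) \<in> borel_measurable P"
    by (rule measurable_compose[OF _ k]) (intro measurable_abs_UNIV, auto)
  have "(\<integral>\<^sup>+ \<omega>. k (\<lambda>i. A i \<omega>) * ennreal (R j \<omega>) \<partial>P)
    \<le> (\<integral>\<^sup>+ \<omega>. \<integral>\<^sup>+ i. k (\<lambda>i. A i \<omega>) * ennreal (A i \<omega> * X i \<omega>) \<partial>count_space UNIV \<partial>P)"
    using AE_decomposition AE_S
  proof (intro nn_integral_mono_AE, eventually_elim)
    case (elim \<omega>)
    then have "ennreal (R j \<omega>) \<le> ennreal (S \<omega>)"
      using mult_nonneg_nonneg[OF A_nonneg[of j \<omega>] X_nonneg[of j \<omega>]]
      by (intro ennreal_leI) (metis add_increasing order_refl)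
    then show ?case using elim by (simp add: nn_integral_cmult mult_left_mono)
  qed
  also have "\<dots> = (\<integral>\<^sup>+ i. \<integral>\<^sup>+ \<omega>. k (\<lambda>i. A i \<omega>) * ennreal (A i \<omega> * X i \<omega>) \<partial>P \<partial>count_space UNIV)"
    by (rule nn_integral_countable_swap) auto
  also have "\<dots> = SB (\<lambda>j \<omega>. 1 * k (fst (V j \<omega>)))" by (simp add: V_def mult_ac)
  also have "\<dots> = SA (\<lambda>j \<omega>. k (fst (V j \<omega>)))"
    by (subst SB_factor[of "\<lambda>_. 1" "\<lambda>_ z. k (fst z)"]) (auto simp: mean_X0)
  also have "\<dots> = (\<integral>\<^sup>+ \<omega>. k (\<lambda>i. A i \<omega>) * ennreal (W1 \<omega>) \<partial>P)"
    using SA_const[of "\<lambda>\<omega>. k (\<lambda>i. A i \<omega>)"] by (simp add: V_def mult.commute)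
  finally show ?thesis .
qed

lemma fst_V: "fst (V j \<omega>) = (\<lambda>i. A i \<omega>)"
  by (simp add: V_def)

lemma SB_X:
  assumes "f \<in> borel_measurable borel"
  shows "SB (\<lambda>j \<omega>. f (X j \<omega>)) = (\<integral>\<^sup>+ \<omega>. ennreal (X0 \<omega>) * f (X0 \<omega>) \<partial>P)"
proof -
  have "SB (\<lambda>j \<omega>. f (X j \<omega>) * 1) = (\<integral>\<^sup>+ \<omega>. ennreal (X0 \<omega>) * f (X0 \<omega>) \<partial>P) * SA (\<lambda>_ _. 1)"
    using assms by (intro SB_factor) auto
  then show ?thesis by (simp only: mult_1_right sum_A)
qed

lemma SB_V:
  fixes g :: "int \<Rightarrow> (int \<Rightarrow> real) \<times> (int \<Rightarrow> real) \<Rightarrow> ennreal"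
  assumes "\<And>j. g j \<in> borel_measurable (PiM UNIV (\<lambda>_. borel) \<Otimes>\<^sub>M PiM UNIV (\<lambda>_. borel))"
  shows "SB (\<lambda>j \<omega>. g j (V j \<omega>)) = SA (\<lambda>j \<omega>. g j (V j \<omega>))"
proof -
  have "SB (\<lambda>j \<omega>. 1 * g j (V j \<omega>)) = (\<integral>\<^sup>+ \<omega>. ennreal (X0 \<omega>) * 1 \<partial>P) * SA (\<lambda>j \<omega>. g j (V j \<omega>))"
    using assms by (intro SB_factor) auto
  then show ?thesis by (simp only: mult_1_right mult_1 mean_X0)
qed

text \<open>Conditionally on the weights \<open>A\<close>, this is Jensen's inequality for \<open>ln\<close>; the proof uses the
  tangent at the conditional mean.\<close>

lemma SA_ln_R_le:
  assumes c: "0 \<le> c"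
  shows "SA (\<lambda>j \<omega>. ennreal (ln (1 + R j \<omega> * c / A j \<omega>))) \<le> SA (\<lambda>j \<omega>. ennreal (ln (1 + W1 \<omega> * c / A j \<omega>)))"
proof (rule nn_integral_mono)
  fix j
  \<comment> \<open>The slope at r = W1 of the concave function A_j ln (1 + r c / A_j), that is, of
    the tangent at the bound for the conditional mean.\<close>
  define k where "k = (\<lambda>\<alpha>. ennreal (if 0 < \<alpha> j then c / (1 + total \<alpha> * c / \<alpha> j) else 0))"
  have k [measurable]: "k \<in> borel_measurable (PiM UNIV (\<lambda>_. borel))"
    unfolding k_def by measurable
  have kA [measurable]: "(\<lambda>\<omega>. k (\<lambda>i. A i \<omega>)) \<in> borel_measurable P"
    by (rule measurable_compose[OF _ k]) (intro measurable_abs_UNIV, auto)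
  let ?L = "\<integral>\<^sup>+ \<omega>. ennreal (A j \<omega>) * ennreal (ln (1 + R j \<omega> * c / A j \<omega>)) \<partial>P"
  let ?M = "\<integral>\<^sup>+ \<omega>. ennreal (A j \<omega>) * ennreal (ln (1 + W1 \<omega> * c / A j \<omega>)) \<partial>P"
  let ?Q = "\<integral>\<^sup>+ \<omega>. k (\<lambda>i. A i \<omega>) * ennreal (W1 \<omega>) \<partial>P"
  \<comment> \<open>The tangent term ?Q will occur on both sides; it can be cancelled because it is
    finite.\<close>
  have "?Q \<le> (\<integral>\<^sup>+ \<omega>. ennreal (A j \<omega>) \<partial>P)"
  proof (rule nn_integral_mono)
    fix \<omega>
    have "c / (1 + W1 \<omega> * c / A j \<omega>) * W1 \<omega> \<le> A j \<omega>" if "0 < A j \<omega>"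
    proof -
      have "0 < A j \<omega> + c * W1 \<omega>" using that c W1_nonneg[of \<omega>] by (simp add: add_pos_nonneg)
      moreover have "0 \<le> A j \<omega> * A j \<omega>" by simp
      ultimately show ?thesis using that by (simp add: field_simps)
    qed
    then show "k (\<lambda>i. A i \<omega>) * ennreal (W1 \<omega>) \<le> ennreal (A j \<omega>)"
      using c W1_nonneg[of \<omega>]
      by (auto simp: k_def W1_def[symmetric] ennreal_mult'[symmetric] intro!: ennreal_leI)
  qed
  also have "\<dots> \<le> (\<integral>\<^sup>+ j. \<integral>\<^sup>+ \<omega>. ennreal (A j \<omega>) \<partial>P \<partial>count_space UNIV)"
    by (rule nn_integral_ge_point) simp
  finally have "?Q \<le> 1" by (simp only: sum_A)
  then have Q: "?Q < \<infinity>" by (rule order.strict_trans1) simp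
  have "?L + ?Q \<le> ?M + (\<integral>\<^sup>+ \<omega>. k (\<lambda>i. A i \<omega>) * ennreal (R j \<omega>) \<partial>P)"
  proof (subst (1 2) nn_integral_add[symmetric], goal_cases)
    case 5
    show ?case
    proof (rule nn_integral_mono)
      fix \<omega>
      show "ennreal (A j \<omega>) * ennreal (ln (1 + R j \<omega> * c / A j \<omega>)) + k (\<lambda>i. A i \<omega>) * ennreal (W1 \<omega>)
        \<le> ennreal (A j \<omega>) * ennreal (ln (1 + W1 \<omega> * c / A j \<omega>)) + k (\<lambda>i. A i \<omega>) * ennreal (R j \<omega>)"
      proof (cases "0 < A j \<omega>")
        case True
        define u m where "u = R j \<omega> * c / A j \<omega>" and "m = W1 \<omega> * c / A j \<omega>"
        have um: "0 \<le> u" "0 \<le> m" using c True R_nonneg W1_nonneg by (auto simp: u_def m_def)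
        have "ln ((1 + u) / (1 + m)) \<le> (1 + u) / (1 + m) - 1" using um by (intro ln_le_minus_one) auto
        also have "(1 + u) / (1 + m) - 1 = u / (1 + m) - m / (1 + m)"
          using um by (simp add: diff_divide_distrib[symmetric] diff_eq_eq divide_eq_eq distrib_right)
        finally have *: "ln (1 + u) + m / (1 + m) \<le> ln (1 + m) + u / (1 + m)"
          using um by (simp add: ln_div)
        have Aum: "A j \<omega> * u = c * R j \<omega>" "A j \<omega> * m = c * W1 \<omega>"
          using True by (auto simp: u_def m_def)
        from mult_left_mono[OF * less_imp_le[OF True]]
        have "A j \<omega> * ln (1 + u) + c / (1 + m) * W1 \<omega> \<le> A j \<omega> * ln (1 + m) + c / (1 + m) * R j \<omega>"
          by (simp add: distrib_left Aum)
        then show ?thesis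
          using True c um R_nonneg[of j \<omega>] W1_nonneg[of \<omega>]
          by (simp add: k_def W1_def[symmetric] u_def[symmetric] m_def[symmetric]
              ennreal_mult'[symmetric] ennreal_plus[symmetric] del: ennreal_plus)
      qed (use A_nonneg[of j \<omega>] in \<open>simp add: k_def\<close>)
    qed
  qed auto
  also have "\<dots> \<le> ?M + ?Q" by (rule add_left_mono[OF mean_R[OF k]])
  finally have "?Q + ?L \<le> ?Q + ?M" by (simp only: add.commute)
  then have "?Q = \<infinity> \<or> ?L \<le> ?M" by (simp only: ennreal_add_left_cancel_le)
  then show "?L \<le> ?M" using Q by (metis less_irrefl)
qed

end

section \<open>The expected increment of B in one step\<close>

locale smoothing_weight = smoothing + growth_weight
begin

text \<open>\<open>B_step_upper\<close> is integrated under the size-biased law. As X_j is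
  independent of the weights and of R_j there, the same factor \<open>e\<close> comes out of the
  downward gain and of the upward loss, so their difference decides. Of the final 2, one unit is the
  total mass and one bounds the mean of R_j / W1.\<close>

lemma drift:
  assumes \<delta>: "0 < \<delta>" and t0: "0 \<le> t0" "t0 \<le> K" "1 + K \<le> (1 + \<delta>) * (1 + K - t0)"
    and CK: "0 \<le> CK" "\<And>w r. 0 < w \<Longrightarrow> 0 \<le> r \<Longrightarrow> \<Psi> (K + ln_plus (w + r)) \<le> CK * (\<Psi> (ln_plus w) + 1 + r / w)"
  defines "q \<equiv> (1 + \<delta>) ^ p" and "C \<equiv> (1 + (1 + 1 / \<delta>) ^ p) * CK"
    and "e \<equiv> (\<integral>\<^sup>+ \<omega>. ennreal (X0 \<omega>) * ennreal (if exp K < X0 \<omega> then b (ln_plus (X0 \<omega>)) else 0) \<partial>P)"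
  shows "(\<integral>\<^sup>+ \<omega>. ennreal (S \<omega>) * ennreal (B (ln_plus (S \<omega>))) \<partial>P)
      + e * SA (\<lambda>j \<omega>. ennreal (min (max 0 (- ln (A j \<omega>))) t0 / q))
    \<le> (\<integral>\<^sup>+ \<omega>. ennreal (X0 \<omega>) * ennreal (B (ln_plus (X0 \<omega>))) \<partial>P)
      + ennreal q * e * (SA (\<lambda>j \<omega>. ennreal (max 0 (ln (A j \<omega>))))
          + SA (\<lambda>j \<omega>. ennreal (ln (1 + W1 \<omega> * exp (- K) / A j \<omega>))))
      + ennreal C * ((\<integral>\<^sup>+ \<omega>. ennreal (W1 \<omega>) * ennreal (\<Psi> (ln_plus (W1 \<omega>))) \<partial>P) + 2)"
proof -
  define E where "E = (\<lambda>x. if exp K < x then b (ln_plus x) else 0)"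
  have [measurable]: "E \<in> borel_measurable borel" unfolding E_def by measurable
  have E0: "0 \<le> E x" for x using b_pos[of "ln_plus x"] by (simp add: E_def)
  have e: "e = (\<integral>\<^sup>+ \<omega>. ennreal (X0 \<omega>) * ennreal (E (X0 \<omega>)) \<partial>P)" by (simp add: e_def E_def)
  have q: "0 < q" using \<delta> by (simp add: q_def)
  have C: "0 \<le> C" using CK \<delta> by (simp add: C_def)
  define \<theta> where "\<theta> = (\<lambda>j \<omega>. ln (1 + R j \<omega> * exp (- K) / A j \<omega>))"
  have [measurable]: "\<theta> j \<in> borel_measurable P" for j unfolding \<theta>_def by measurable
  have "AE \<omega> in P. \<forall>j. 0 < A j \<omega> \<longrightarrow>
      ennreal (B (ln_plus (S \<omega>))) + ennreal (E (X j \<omega>)) * ennreal (min (max 0 (- ln (A j \<omega>))) t0 / q)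
      \<le> ennreal (B (ln_plus (X j \<omega>)))
        + (ennreal q * (ennreal (E (X j \<omega>)) * (ennreal (max 0 (ln (A j \<omega>))) + ennreal (\<theta> j \<omega>)))
        + ennreal C * (ennreal (\<Psi> (ln_plus (W1 \<omega>))) + (1 + ennreal (R j \<omega> / W1 \<omega>))))"
    using AE_decomposition
  proof eventually_elim
    case (elim \<omega>)
    show ?case
    proof (intro allI impI)
      fix j assume A: "0 < A j \<omega>"
      have S: "S \<omega> = A j \<omega> * X j \<omega> + R j \<omega>" and W: "A j \<omega> \<le> W1 \<omega>" using elim by auto
      then have W0: "0 < W1 \<omega>" using A by linarith
      have th: "0 \<le> \<theta> j \<omega>" using A R_nonneg by (simp add: \<theta>_def)
      have \<Psi>0: "0 \<le> \<Psi> (ln_plus (W1 \<omega>))" by (rule \<Psi>_nonneg[OF ln_plus_nonneg])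
      have r0: "0 \<le> R j \<omega> / W1 \<omega>" using W0 R_nonneg by simp
      have "B (ln_plus (S \<omega>)) + E (X j \<omega>) * min (max 0 (- ln (A j \<omega>))) t0 / q
        \<le> B (ln_plus (X j \<omega>)) + q * E (X j \<omega>) * (max 0 (ln (A j \<omega>)) + \<theta> j \<omega>)
          + (1 + (1 + 1 / \<delta>) ^ p) * \<Psi> (K + ln_plus (W1 \<omega> + R j \<omega>))"
        unfolding S E_def q_def \<theta>_def
        using B_step_upper[OF \<delta> t0 A W X_nonneg R_nonneg] .
      also have "(1 + (1 + 1 / \<delta>) ^ p) * \<Psi> (K + ln_plus (W1 \<omega> + R j \<omega>))
          \<le> (1 + (1 + 1 / \<delta>) ^ p) * (CK * (\<Psi> (ln_plus (W1 \<omega>)) + 1 + R j \<omega> / W1 \<omega>))"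
        using \<delta> by (intro mult_left_mono CK(2) W0 R_nonneg) auto
      finally have "B (ln_plus (S \<omega>)) + E (X j \<omega>) * (min (max 0 (- ln (A j \<omega>))) t0 / q)
        \<le> B (ln_plus (X j \<omega>)) + (q * (E (X j \<omega>) * (max 0 (ln (A j \<omega>)) + \<theta> j \<omega>))
          + C * (\<Psi> (ln_plus (W1 \<omega>)) + (1 + R j \<omega> / W1 \<omega>)))"
        by (simp add: C_def mult_ac add_ac)
      then have "ennreal (B (ln_plus (S \<omega>)) + E (X j \<omega>) * (min (max 0 (- ln (A j \<omega>))) t0 / q))
        \<le> ennreal (B (ln_plus (X j \<omega>)) + (q * (E (X j \<omega>) * (max 0 (ln (A j \<omega>)) + \<theta> j \<omega>))
          + C * (\<Psi> (ln_plus (W1 \<omega>)) + (1 + R j \<omega> / W1 \<omega>))))" by (rule ennreal_leI)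
      then show "ennreal (B (ln_plus (S \<omega>))) + ennreal (E (X j \<omega>)) * ennreal (min (max 0 (- ln (A j \<omega>))) t0 / q)
      \<le> ennreal (B (ln_plus (X j \<omega>)))
        + (ennreal q * (ennreal (E (X j \<omega>)) * (ennreal (max 0 (ln (A j \<omega>))) + ennreal (\<theta> j \<omega>)))
        + ennreal C * (ennreal (\<Psi> (ln_plus (W1 \<omega>))) + (1 + ennreal (R j \<omega> / W1 \<omega>))))"
        using th \<Psi>0 r0 E0[of "X j \<omega>"] q C t0 B_nonneg
        by (simp add: ennreal_plus ennreal_mult del: ennreal_plus[symmetric] times_divide_eq_right)
    qed
  qed
  note pointwise = this
  let ?F1 = "\<lambda>j \<omega>. ennreal (B (ln_plus (S \<omega>)))"
  let ?F2 = "\<lambda>j \<omega>. ennreal (E (X j \<omega>)) * ennreal (min (max 0 (- ln (A j \<omega>))) t0 / q)"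
  let ?F3 = "\<lambda>j \<omega>. ennreal (B (ln_plus (X j \<omega>)))"
  let ?F4 = "\<lambda>j \<omega>. ennreal (E (X j \<omega>)) * (ennreal (max 0 (ln (A j \<omega>))) + ennreal (\<theta> j \<omega>))"
  let ?F5 = "\<lambda>j \<omega>. ennreal (\<Psi> (ln_plus (W1 \<omega>))) + (1 + ennreal (R j \<omega> / W1 \<omega>))"
  have "SB ?F1 + SB ?F2 = SB (\<lambda>j \<omega>. ?F1 j \<omega> + ?F2 j \<omega>)" by (rule SB_add[symmetric]) simp_all
  also have "\<dots> \<le> SB (\<lambda>j \<omega>. ?F3 j \<omega> + (ennreal q * ?F4 j \<omega> + ennreal C * ?F5 j \<omega>))"
    using pointwise by (rule SB_mono)
  also have "\<dots> = SB ?F3 + SB (\<lambda>j \<omega>. ennreal q * ?F4 j \<omega> + ennreal C * ?F5 j \<omega>)"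
    by (rule SB_add) simp_all
  also have "SB (\<lambda>j \<omega>. ennreal q * ?F4 j \<omega> + ennreal C * ?F5 j \<omega>)
      = SB (\<lambda>j \<omega>. ennreal q * ?F4 j \<omega>) + SB (\<lambda>j \<omega>. ennreal C * ?F5 j \<omega>)"
    by (rule SB_add) simp_all
  also have "SB (\<lambda>j \<omega>. ennreal q * ?F4 j \<omega>) = ennreal q * SB ?F4" by (rule SB_cmult) simp
  also have "SB (\<lambda>j \<omega>. ennreal C * ?F5 j \<omega>) = ennreal C * SB ?F5" by (rule SB_cmult) simp
  also have "SB (\<lambda>_ \<omega>. ennreal (B (ln_plus (S \<omega>)))) = (\<integral>\<^sup>+ \<omega>. ennreal (S \<omega>) * ennreal (B (ln_plus (S \<omega>))) \<partial>P)"
    by (rule SB_const) simp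
  also have "SB (\<lambda>j \<omega>. ennreal (E (X j \<omega>)) * ennreal (min (max 0 (- ln (A j \<omega>))) t0 / q))
    = e * SA (\<lambda>j \<omega>. ennreal (min (max 0 (- ln (A j \<omega>))) t0 / q))"
    unfolding e using SB_factor[of "\<lambda>x. ennreal (E x)" "\<lambda>j z. ennreal (min (max 0 (- ln (fst z j))) t0 / q)"]
    by (simp add: fst_V)
  also have "SB (\<lambda>j \<omega>. ennreal (B (ln_plus (X j \<omega>))))
      = (\<integral>\<^sup>+ \<omega>. ennreal (X0 \<omega>) * ennreal (B (ln_plus (X0 \<omega>))) \<partial>P)"
    by (rule SB_X) simp
  also have "SB (\<lambda>j \<omega>. ennreal (E (X j \<omega>)) * (ennreal (max 0 (ln (A j \<omega>))) + ennreal (\<theta> j \<omega>)))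
    = e * SA (\<lambda>j \<omega>. ennreal (max 0 (ln (A j \<omega>))) + ennreal (\<theta> j \<omega>))"
    unfolding e \<theta>_def R_def
    using SB_factor[of "\<lambda>x. ennreal (E x)" "\<lambda>j z. ennreal (max 0 (ln (fst z j)))
       + ennreal (ln (1 + cross z * exp (- K) / fst z j))"]
    by (simp add: fst_V)
  also have "SA (\<lambda>j \<omega>. ennreal (max 0 (ln (A j \<omega>))) + ennreal (\<theta> j \<omega>))
    = SA (\<lambda>j \<omega>. ennreal (max 0 (ln (A j \<omega>)))) + SA (\<lambda>j \<omega>. ennreal (\<theta> j \<omega>))"
    by (rule SA_add) auto
  also have "SB (\<lambda>j \<omega>. ennreal (\<Psi> (ln_plus (W1 \<omega>))) + (1 + ennreal (R j \<omega> / W1 \<omega>)))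
    = SA (\<lambda>j \<omega>. ennreal (\<Psi> (ln_plus (W1 \<omega>))) + (1 + ennreal (R j \<omega> / W1 \<omega>)))"
    unfolding R_def W1_def
    using SB_V[of "\<lambda>j z. ennreal (\<Psi> (ln_plus (total (fst z))))
       + (1 + ennreal (cross z / total (fst z)))"]
    by (simp add: fst_V)
  also have "\<dots> = SA (\<lambda>_ \<omega>. ennreal (\<Psi> (ln_plus (W1 \<omega>)))) + SA (\<lambda>j \<omega>. 1 + ennreal (R j \<omega> / W1 \<omega>))"
    by (rule SA_add) simp_all
  also have "SA (\<lambda>j \<omega>. 1 + ennreal (R j \<omega> / W1 \<omega>)) = SA (\<lambda>_ _. 1) + SA (\<lambda>j \<omega>. ennreal (R j \<omega> / W1 \<omega>))"
    by (rule SA_add) simp_all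
  also have "SA (\<lambda>_ \<omega>. ennreal (\<Psi> (ln_plus (W1 \<omega>)))) = (\<integral>\<^sup>+ \<omega>. ennreal (W1 \<omega>) * ennreal (\<Psi> (ln_plus (W1 \<omega>))) \<partial>P)"
    by (rule SA_const) simp
  finally have *: "(\<integral>\<^sup>+ \<omega>. ennreal (S \<omega>) * ennreal (B (ln_plus (S \<omega>))) \<partial>P)
      + e * SA (\<lambda>j \<omega>. ennreal (min (max 0 (- ln (A j \<omega>))) t0 / q))
    \<le> (\<integral>\<^sup>+ \<omega>. ennreal (X0 \<omega>) * ennreal (B (ln_plus (X0 \<omega>))) \<partial>P)
      + (ennreal q * (e * (SA (\<lambda>j \<omega>. ennreal (max 0 (ln (A j \<omega>)))) + SA (\<lambda>j \<omega>. ennreal (\<theta> j \<omega>))))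
      + ennreal C * ((\<integral>\<^sup>+ \<omega>. ennreal (W1 \<omega>) * ennreal (\<Psi> (ln_plus (W1 \<omega>))) \<partial>P)
        + (SA (\<lambda>_ _. 1) + SA (\<lambda>j \<omega>. ennreal (R j \<omega> / W1 \<omega>)))))" .
  have 1: "SA (\<lambda>j \<omega>. ennreal (\<theta> j \<omega>)) \<le> SA (\<lambda>j \<omega>. ennreal (ln (1 + W1 \<omega> * exp (- K) / A j \<omega>)))"
    unfolding \<theta>_def by (rule SA_ln_R_le) simp
  \<comment> \<open>Given the weights, R_j has mean at most W1, so R_j / W1 has mean at most 1; the
    bound \<open>mean_R\<close> is applied with k = A_j / W1.\<close>
  have "SA (\<lambda>j \<omega>. ennreal (R j \<omega> / W1 \<omega>)) \<le> (\<integral>\<^sup>+ j. \<integral>\<^sup>+ \<omega>. ennreal (A j \<omega>) \<partial>P \<partial>count_space UNIV)"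
  proof (rule nn_integral_mono)
    fix j
    have "(\<integral>\<^sup>+ \<omega>. ennreal (A j \<omega>) * ennreal (R j \<omega> / W1 \<omega>) \<partial>P)
        = (\<integral>\<^sup>+ \<omega>. ennreal (A j \<omega> / total (\<lambda>i. A i \<omega>)) * ennreal (R j \<omega>) \<partial>P)"
      using A_nonneg R_nonneg total_nonneg
      by (intro nn_integral_cong) (simp add: ennreal_mult'[symmetric] W1_def)
    also have "\<dots> \<le> (\<integral>\<^sup>+ \<omega>. ennreal (A j \<omega> / total (\<lambda>i. A i \<omega>)) * ennreal (W1 \<omega>) \<partial>P)"
      using mean_R[of "\<lambda>\<alpha>. ennreal (\<alpha> j / total \<alpha>)"] by simp
    also have "\<dots> \<le> (\<integral>\<^sup>+ \<omega>. ennreal (A j \<omega>) \<partial>P)"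
      using A_nonneg total_nonneg
      by (intro nn_integral_mono) (auto simp: ennreal_mult'[symmetric] W1_def[symmetric] W1_nonneg intro!: ennreal_leI)
    finally show "(\<integral>\<^sup>+ \<omega>. ennreal (A j \<omega>) * ennreal (R j \<omega> / W1 \<omega>) \<partial>P) \<le> (\<integral>\<^sup>+ \<omega>. ennreal (A j \<omega>) \<partial>P)" .
  qed
  then have "1 + SA (\<lambda>j \<omega>. ennreal (R j \<omega> / W1 \<omega>)) \<le> 1 + 1"
    unfolding sum_A by (rule add_left_mono)
  then have 2: "SA (\<lambda>_ _. 1) + SA (\<lambda>j \<omega>. ennreal (R j \<omega> / W1 \<omega>)) \<le> 2"
    by (simp only: mult_1_right sum_A one_add_one)
  show ?thesis
    unfolding mult.assoc add.assoc
    by (rule order_trans[OF *]) (intro add_mono mult_left_mono order_refl 1 2 zero_le)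
qed

lemma size_moment_of_fixed_point:
  assumes law: "\<And>h :: real \<Rightarrow> ennreal. h \<in> borel_measurable borel \<Longrightarrow>
      (\<integral>\<^sup>+ \<omega>. h (S \<omega>) \<partial>P) = (\<integral>\<^sup>+ \<omega>. h (X0 \<omega>) \<partial>P)"
    and fin1: "SA (\<lambda>j \<omega>. ennreal (max 0 (- ln (A j \<omega>)))) < \<infinity>"
    and fin2: "(\<integral>\<^sup>+ \<omega>. ennreal (X0 \<omega>) * ennreal (b (ln_plus (X0 \<omega>))) \<partial>P) < \<infinity>"
  shows "(\<integral>\<^sup>+ \<omega>. ennreal (W1 \<omega>) * ennreal (\<Psi> (ln_plus (W1 \<omega>))) \<partial>P) < \<infinity>"
proof -
  \<comment> \<open>Any constant strictly between 1/2 and 1 would serve: 1/2 will be subtracted from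
    it. Such K exists since X0 has mean 1.\<close>
  obtain K where K: "ennreal (3/4) \<le> (\<integral>\<^sup>+ \<omega>. ennreal (X0 \<omega>) * indicator {..K} (X0 \<omega>) \<partial>P)"
  proof -
    let ?f = "\<lambda>n \<omega>. ennreal (X0 \<omega>) * indicator {..real n} (X0 \<omega>)"
    have "1 \<le> (\<integral>\<^sup>+ \<omega>. (SUP n. ?f n \<omega>) \<partial>P)"
      unfolding mean_X0[symmetric]
    proof (rule nn_integral_mono)
      fix \<omega>
      obtain n where "X0 \<omega> \<le> real n" using real_arch_simple by blast
      then show "ennreal (X0 \<omega>) \<le> (SUP n. ?f n \<omega>)" by (intro SUP_upper2[of n]) auto
    qed
    also have "\<dots> = (SUP n. \<integral>\<^sup>+ \<omega>. ?f n \<omega> \<partial>P)"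
      by (intro nn_integral_monotone_convergence_SUP)
        (auto simp: incseq_def le_fun_def indicator_def)
    finally have "ennreal (3/4) < (SUP n. \<integral>\<^sup>+ \<omega>. ?f n \<omega> \<partial>P)"
      by (rule order.strict_trans2[rotated]) (simp add: ennreal_less_one_iff)
    then show ?thesis using that by (auto simp: less_SUP_iff intro: less_imp_le)
  qed
  \<comment> \<open>The bound on the downward part plus the cost B(l K) of the good event; it does
    not depend on the truncation level, which can therefore be removed at the end.\<close>
  define C where "C = (\<integral>\<^sup>+ \<omega>. ennreal (X0 \<omega>) * ennreal (b (ln_plus (X0 \<omega>))) \<partial>P)
      * SA (\<lambda>j \<omega>. ennreal (max 0 (- ln (A j \<omega>)))) + ennreal (B (ln_plus K))"
  have C: "C < \<infinity>" using fin1 fin2 by (simp add: C_def ennreal_mult_less_top)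
  have bound: "(\<integral>\<^sup>+ \<omega>. ennreal (W1 \<omega>) * ennreal (B (min (ln_plus (W1 \<omega> / 2)) (real n))) \<partial>P) \<le> 4 * C" for n
  proof -
    define T where "T = real n"
    define H where "H = (\<lambda>\<omega>. B (min (ln_plus (W1 \<omega> / 2)) T))"
    define good where "good = (\<lambda>j \<omega>. if X j \<omega> \<le> K \<and> W1 \<omega> / 2 \<le> S \<omega> then 1 else 0 :: real)"
    have [measurable]: "H \<in> borel_measurable P" "good j \<in> borel_measurable P" for j
      unfolding H_def good_def by measurable
    have BT: "B (min x T) \<le> B T" for x by (intro B_le) simp
    have "AE \<omega> in P. \<forall>j. 0 < A j \<omega> \<longrightarrow>
        ennreal (B (min (ln_plus (X j \<omega>)) T)) + ennreal (good j \<omega>) * ennreal (H \<omega>)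
        \<le> ennreal (B (min (ln_plus (S \<omega>)) T))
          + (ennreal (b (ln_plus (X j \<omega>))) * ennreal (max 0 (- ln (A j \<omega>))) + ennreal (B (ln_plus K)))"
      using AE_decomposition
    proof eventually_elim
      case (elim \<omega>)
      show ?case
      proof (intro allI impI)
        fix j assume A: "0 < A j \<omega>"
        have "A j \<omega> * X j \<omega> \<le> S \<omega>" using elim[THEN spec, of j] R_nonneg[of j \<omega>] by linarith
        from B_step_lower[OF A X_nonneg this S_nonneg W1_nonneg[of \<omega>], where K = K and T = T]
        have "B (min (ln_plus (X j \<omega>)) T) + good j \<omega> * H \<omega>
          \<le> B (min (ln_plus (S \<omega>)) T) + max 0 (- ln (A j \<omega>)) * b (ln_plus (X j \<omega>)) + good j \<omega> * B (ln_plus K)"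
          unfolding good_def H_def .
        also have "good j \<omega> * B (ln_plus K) \<le> B (ln_plus K)" using B_nonneg by (simp add: good_def)
        finally have "ennreal (B (min (ln_plus (X j \<omega>)) T) + good j \<omega> * H \<omega>)
          \<le> ennreal (B (min (ln_plus (S \<omega>)) T) + (b (ln_plus (X j \<omega>)) * max 0 (- ln (A j \<omega>)) + B (ln_plus K)))"
          by (intro ennreal_leI) (simp add: mult_ac add_ac)
        moreover have "0 \<le> good j \<omega>" "0 \<le> H \<omega>" using B_nonneg by (auto simp: good_def H_def)
        ultimately show "ennreal (B (min (ln_plus (X j \<omega>)) T)) + ennreal (good j \<omega>) * ennreal (H \<omega>)
          \<le> ennreal (B (min (ln_plus (S \<omega>)) T))
            + (ennreal (b (ln_plus (X j \<omega>))) * ennreal (max 0 (- ln (A j \<omega>))) + ennreal (B (ln_plus K)))"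
          using B_nonneg less_imp_le[OF b_pos]
          by (simp add: ennreal_plus ennreal_mult del: ennreal_plus[symmetric])
      qed
    qed
    note pointwise = this
    let ?F1 = "\<lambda>j \<omega>. ennreal (B (min (ln_plus (X j \<omega>)) T))"
    let ?F2 = "\<lambda>j \<omega>. ennreal (good j \<omega>) * ennreal (H \<omega>)"
    let ?F3 = "\<lambda>j \<omega>. ennreal (B (min (ln_plus (S \<omega>)) T))"
    let ?F4 = "\<lambda>j \<omega>. ennreal (b (ln_plus (X j \<omega>))) * ennreal (max 0 (- ln (A j \<omega>)))"
    have "SB ?F1 + SB ?F2 = SB (\<lambda>j \<omega>. ?F1 j \<omega> + ?F2 j \<omega>)" by (rule SB_add[symmetric]) simp_all
    also have "\<dots> \<le> SB (\<lambda>j \<omega>. ?F3 j \<omega> + (?F4 j \<omega> + ennreal (B (ln_plus K))))"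
      using pointwise by (rule SB_mono)
    also have "\<dots> = SB ?F3 + SB (\<lambda>j \<omega>. ?F4 j \<omega> + ennreal (B (ln_plus K)))"
      by (rule SB_add) simp_all
    also have "SB (\<lambda>j \<omega>. ?F4 j \<omega> + ennreal (B (ln_plus K)))
        = SB ?F4 + SB (\<lambda>j \<omega>. ennreal (B (ln_plus K)))"
      by (rule SB_add) simp_all
    also have "SB (\<lambda>j \<omega>. ennreal (B (ln_plus K))) = ennreal (B (ln_plus K))"
      using SB_cmult[of "\<lambda>_ _. 1" "ennreal (B (ln_plus K))"] sum_AX by simp
    also have "SB ?F4 = (\<integral>\<^sup>+ \<omega>. ennreal (X0 \<omega>) * ennreal (b (ln_plus (X0 \<omega>))) \<partial>P)
      * SA (\<lambda>j \<omega>. ennreal (max 0 (- ln (A j \<omega>))))"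
      using SB_factor[of "\<lambda>x. ennreal (b (ln_plus x))" "\<lambda>j z. ennreal (max 0 (- ln (fst z j)))"]
      by (simp add: fst_V)
    also have "SB ?F3 = (\<integral>\<^sup>+ \<omega>. ennreal (S \<omega>) * ennreal (B (min (ln_plus (S \<omega>)) T)) \<partial>P)"
      by (rule SB_const) simp
    also have "\<dots> = (\<integral>\<^sup>+ \<omega>. ennreal (X0 \<omega>) * ennreal (B (min (ln_plus (X0 \<omega>)) T)) \<partial>P)"
      by (rule law) simp
    also have "\<dots> = SB ?F1" by (rule SB_X[symmetric]) simp
    finally have "SB ?F1 + SB ?F2 \<le> SB ?F1 + C" by (simp only: C_def)
    \<comment> \<open>As S and X0 have the same law, the terms for S and for X_j agree; the
      truncation makes them finite, so that they cancel.\<close>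
    moreover have "SB ?F1 \<le> ennreal (B T)"
    proof -
      have "SB ?F1 \<le> SB (\<lambda>_ _. ennreal (B T))"
        using BT by (intro SB_mono AE_I2) (auto intro!: ennreal_leI)
      also have "\<dots> = ennreal (B T)"
        using SB_cmult[of "\<lambda>_ _. 1" "ennreal (B T)"] sum_AX by simp
      finally show ?thesis .
    qed
    then have "SB ?F1 < \<infinity>" by (rule order.strict_trans1) simp
    ultimately have F2: "SB ?F2 \<le> C"
      by (auto simp: ennreal_add_left_cancel_le)
    define y where "y = (\<integral>\<^sup>+ \<omega>. ennreal (W1 \<omega>) * ennreal (H \<omega>) \<partial>P)"
    have "y \<le> (\<integral>\<^sup>+ \<omega>. ennreal (W1 \<omega>) * ennreal (B T) \<partial>P)"
      unfolding y_def H_def using BT by (intro nn_integral_mono mult_left_mono ennreal_leI) auto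
    also have "\<dots> = ennreal (B T)" by (simp add: nn_integral_multc mean_W1)
    finally have "y < \<infinity>" by (rule order.strict_trans1) simp
    have y_SA: "y = SA (\<lambda>j \<omega>. ennreal (H \<omega>))" unfolding y_def by (rule SA_const[symmetric]) simp
    have "ennreal (3/4) * y \<le> (\<integral>\<^sup>+ \<omega>. ennreal (X0 \<omega>) * indicator {..K} (X0 \<omega>) \<partial>P) * y"
      using K by (rule mult_right_mono) simp
    also have "(\<integral>\<^sup>+ \<omega>. ennreal (X0 \<omega>) * indicator {..K} (X0 \<omega>) \<partial>P) * y
        = SB (\<lambda>j \<omega>. indicator {..K} (X j \<omega>) * ennreal (H \<omega>))"
      using SB_factor[of "indicator {..K}" "\<lambda>j z. ennreal (B (min (ln_plus (total (fst z) / 2)) T))"]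
      unfolding y_SA by (simp add: fst_V H_def W1_def)
    also have "\<dots> = (\<integral>\<^sup>+ \<omega>. \<integral>\<^sup>+ j. ennreal (A j \<omega> * X j \<omega>) * (indicator {..K} (X j \<omega>) * ennreal (H \<omega>))
        \<partial>count_space UNIV \<partial>P)"
      by (rule nn_integral_countable_swap[symmetric]) simp
    also have "\<dots> \<le> (\<integral>\<^sup>+ \<omega>. (\<integral>\<^sup>+ j. ennreal (A j \<omega> * X j \<omega>) * (ennreal (good j \<omega>) * ennreal (H \<omega>))
        \<partial>count_space UNIV) + ennreal (1/2) * (ennreal (W1 \<omega>) * ennreal (H \<omega>)) \<partial>P)"
      using AE_S
    proof (intro nn_integral_mono_AE, eventually_elim)
      case (elim \<omega>)
      show ?case
      proof (cases "W1 \<omega> / 2 \<le> S \<omega>")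
        case True
        then have "indicator {..K} (X j \<omega>) = ennreal (good j \<omega>)" for j
          by (simp add: good_def indicator_def)
        then show ?thesis by simp
      next
        case False
        \<comment> \<open>Where S < W1 / 2, the total size-biased mass S of all children is already
          below W1 / 2, so at most half of \<open>y\<close> is lost.\<close>
        have "(\<integral>\<^sup>+ j. ennreal (A j \<omega> * X j \<omega>) * (indicator {..K} (X j \<omega>) * ennreal (H \<omega>)) \<partial>count_space UNIV)
          \<le> (\<integral>\<^sup>+ j. ennreal (A j \<omega> * X j \<omega>) * ennreal (H \<omega>) \<partial>count_space UNIV)"
          by (intro nn_integral_mono mult_left_mono) (auto simp: indicator_def)
        also have "\<dots> = ennreal (S \<omega>) * ennreal (H \<omega>)"
          using elim by (simp add: nn_integral_multc)
        also have "\<dots> \<le> ennreal (1/2 * W1 \<omega>) * ennreal (H \<omega>)"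
          using False by (intro mult_right_mono ennreal_leI) auto
        also have "\<dots> = ennreal (1/2) * (ennreal (W1 \<omega>) * ennreal (H \<omega>))"
          using W1_nonneg[of \<omega>] by (subst ennreal_mult) (auto simp: mult.assoc)
        finally show ?thesis by (simp add: add_increasing)
      qed
    qed
    also have "\<dots> = (\<integral>\<^sup>+ \<omega>. \<integral>\<^sup>+ j. ennreal (A j \<omega> * X j \<omega>) * (ennreal (good j \<omega>) * ennreal (H \<omega>))
        \<partial>count_space UNIV \<partial>P) + ennreal (1/2) * y"
      unfolding y_def by (subst nn_integral_add) (simp_all add: nn_integral_cmult)
    also have "(\<integral>\<^sup>+ \<omega>. \<integral>\<^sup>+ j. ennreal (A j \<omega> * X j \<omega>) * (ennreal (good j \<omega>) * ennreal (H \<omega>))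
        \<partial>count_space UNIV \<partial>P) = SB ?F2"
      by (rule nn_integral_countable_swap) simp
    finally have "ennreal (3/4) * y \<le> SB ?F2 + ennreal (1/2) * y" .
    also have "\<dots> \<le> C + ennreal (1/2) * y" using F2 by (rule add_right_mono)
    finally have le: "ennreal (3/4) * y \<le> C + ennreal (1/2) * y" .
    obtain y' where y': "y = ennreal y'" "0 \<le> y'" using \<open>y < \<infinity>\<close> by (cases y) auto
    obtain C' where C': "C = ennreal C'" "0 \<le> C'" using C by (cases C) auto
    have "ennreal (3/4 * y') \<le> ennreal (C' + 1/2 * y')"
    proof -
      have "ennreal (3/4 * y') = ennreal (3/4) * ennreal y'" "ennreal (1/2 * y') = ennreal (1/2) * ennreal y'"
        using y'(2) by (intro ennreal_mult; simp)+
      moreover have "ennreal (C' + 1/2 * y') = ennreal C' + ennreal (1/2 * y')"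
        using y' C' by (intro ennreal_plus) auto
      ultimately show ?thesis using le unfolding y'(1) C'(1) by (simp only:)
    qed
    then have "3/4 * y' \<le> C' + 1/2 * y'" using y' C' by (subst (asm) ennreal_le_iff) auto
    then have "y \<le> ennreal (4 * C')" unfolding y'(1) by (intro ennreal_leI) simp
    also have "\<dots> = 4 * C" using C' by (simp add: ennreal_mult')
    finally show ?thesis unfolding y_def H_def T_def .
  qed
  have "(\<integral>\<^sup>+ \<omega>. ennreal (W1 \<omega>) * ennreal (B (ln_plus (W1 \<omega> / 2))) \<partial>P) \<le> 4 * C"
  proof -
    let ?f = "\<lambda>n \<omega>. ennreal (W1 \<omega>) * ennreal (B (min (ln_plus (W1 \<omega> / 2)) (real n)))"
    have "(\<integral>\<^sup>+ \<omega>. ennreal (W1 \<omega>) * ennreal (B (ln_plus (W1 \<omega> / 2))) \<partial>P) \<le> (\<integral>\<^sup>+ \<omega>. (SUP n. ?f n \<omega>) \<partial>P)"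
    proof (rule nn_integral_mono)
      fix \<omega>
      obtain n where "ln_plus (W1 \<omega> / 2) \<le> real n" using real_arch_simple by blast
      then show "ennreal (W1 \<omega>) * ennreal (B (ln_plus (W1 \<omega> / 2))) \<le> (SUP n. ?f n \<omega>)"
        by (intro SUP_upper2[of n]) auto
    qed
    also have "\<dots> = (SUP n. \<integral>\<^sup>+ \<omega>. ?f n \<omega> \<partial>P)"
      by (intro nn_integral_monotone_convergence_SUP)
        (auto simp: incseq_def le_fun_def intro!: mult_left_mono ennreal_leI B_le)
    also have "\<dots> \<le> 4 * C" using bound by (intro SUP_least) auto
    finally show ?thesis .
  qed
  also have "4 * C < \<infinity>" using C by (simp add: ennreal_mult_less_top)
  finally have fin: "(\<integral>\<^sup>+ \<omega>. ennreal (W1 \<omega>) * ennreal (B (ln_plus (W1 \<omega> / 2))) \<partial>P) < \<infinity>" .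
  \<comment> \<open>This constant occurs twice: for splitting off ln 2 when W1 / 2 is replaced by
    W1, and for bounding \<Psi> by B.\<close>
  define c where "c = (2::real) ^ (p + 1)"
  have c: "0 \<le> c" by (simp add: c_def)
  have ln2: "0 \<le> \<Psi> (ln 2)" by (intro \<Psi>_nonneg) simp
  have "(\<integral>\<^sup>+ \<omega>. ennreal (W1 \<omega>) * ennreal (\<Psi> (ln_plus (W1 \<omega>))) \<partial>P)
    \<le> (\<integral>\<^sup>+ \<omega>. ennreal (c * c) * (ennreal (W1 \<omega>) * ennreal (B (ln_plus (W1 \<omega> / 2))))
      + ennreal (c * \<Psi> (ln 2)) * ennreal (W1 \<omega>) \<partial>P)"
  proof (rule nn_integral_mono)
    fix \<omega>
    show "ennreal (W1 \<omega>) * ennreal (\<Psi> (ln_plus (W1 \<omega>)))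
      \<le> ennreal (c * c) * (ennreal (W1 \<omega>) * ennreal (B (ln_plus (W1 \<omega> / 2)))) + ennreal (c * \<Psi> (ln 2)) * ennreal (W1 \<omega>)"
    proof (cases "W1 \<omega> = 0")
      case False
      then have W: "0 < W1 \<omega>" using W1_nonneg[of \<omega>] by simp
      have "ln_plus (W1 \<omega>) = ln_plus (W1 \<omega> / 2 * 2)" by simp
      also have "\<dots> \<le> ln_plus (W1 \<omega> / 2) + ln_plus 2" using W by (intro ln_plus_mult_le) auto
      also have "ln_plus 2 = ln 2" by (simp add: ln_plus_def)
      finally have "\<Psi> (ln_plus (W1 \<omega>)) \<le> \<Psi> (ln_plus (W1 \<omega> / 2) + ln 2)"
        by (intro \<Psi>_le ln_plus_nonneg)
      also have "\<dots> \<le> c * (\<Psi> (ln_plus (W1 \<omega> / 2)) + \<Psi> (ln 2))"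
        unfolding c_def by (intro \<Psi>_add ln_plus_nonneg) simp
      also have "\<dots> \<le> c * (c * B (ln_plus (W1 \<omega> / 2)) + \<Psi> (ln 2))"
        unfolding c_def by (intro mult_left_mono add_right_mono \<Psi>_le_B ln_plus_nonneg) simp
      finally have "W1 \<omega> * \<Psi> (ln_plus (W1 \<omega>)) \<le> W1 \<omega> * (c * (c * B (ln_plus (W1 \<omega> / 2)) + \<Psi> (ln 2)))"
        using W by (intro mult_left_mono) auto
      then have "ennreal (W1 \<omega> * \<Psi> (ln_plus (W1 \<omega>)))
        \<le> ennreal ((c * c) * (W1 \<omega> * B (ln_plus (W1 \<omega> / 2))) + (c * \<Psi> (ln 2)) * W1 \<omega>)"
        by (intro ennreal_leI) (simp add: algebra_simps)
      then show ?thesis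
        using W c ln2 B_nonneg \<Psi>_nonneg[OF ln_plus_nonneg]
        by (simp add: ennreal_plus ennreal_mult del: ennreal_plus[symmetric])
    qed simp
  qed
  also have "\<dots> = ennreal (c * c) * (\<integral>\<^sup>+ \<omega>. ennreal (W1 \<omega>) * ennreal (B (ln_plus (W1 \<omega> / 2))) \<partial>P)
      + ennreal (c * \<Psi> (ln 2)) * 1"
    by (subst nn_integral_add) (simp_all add: nn_integral_cmult mean_W1)
  also have "\<dots> < \<infinity>" using fin by (simp add: ennreal_mult_less_top)
  finally show ?thesis .
qed

end

section \<open>The additive martingale on the family tree\<close>

text \<open>The two conventions agree in the divergent case: \<open>infsum\<close> returns 0 and
  \<open>enn2real\<close> sends \<infinity> to 0.\<close>

lemma infsum_eq_enn2real_nn_integral: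
  fixes f :: "'a \<Rightarrow> real"
  assumes nonneg: "\<And>x. x \<in> A \<Longrightarrow> 0 \<le> f x"
  shows "infsum f A = enn2real (\<integral>\<^sup>+ x. ennreal (f x) \<partial>count_space A)"
proof (cases "integrable (count_space A) f")
  case True
  then have "infsum f A = integral\<^sup>L (count_space A) f"
    using infsetsum_infsum[of f A] by (simp add: Infinite_Set_Sum.abs_summable_on_def infsetsum_def)
  also have "\<dots> = enn2real (\<integral>\<^sup>+ x. ennreal (f x) \<partial>count_space A)"
    using nonneg by (intro integral_eq_nn_integral) (auto simp: AE_count_space)
  finally show ?thesis .
next
  case False
  have "\<not> f summable_on A"
  proof
    assume "f summable_on A"
    moreover have "f summable_on A \<longleftrightarrow> (\<lambda>x. norm (f x)) summable_on A"
      using nonneg by (intro summable_on_cong) auto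
    ultimately show False using False abs_summable_equivalent[of f A]
      by (simp add: Infinite_Set_Sum.abs_summable_on_def)
  qed
  then have "infsum f A = 0" by (rule infsum_not_exists)
  moreover have "(\<integral>\<^sup>+ x. ennreal (f x) \<partial>count_space A) = \<infinity>"
  proof -
    have "(\<integral>\<^sup>+ x. ennreal (norm (f x)) \<partial>count_space A) = (\<integral>\<^sup>+ x. ennreal (f x) \<partial>count_space A)"
      using nonneg by (intro nn_integral_cong) auto
    then show ?thesis using False by (simp add: integrable_iff_bounded less_top[symmetric])
  qed
  ultimately show ?thesis by simp
qed

section \<open>Measurability of the points of a point process\<close>

lemma space_point_space: "space point_space = point_measures"
proof -
  have "sets (borel :: real measure) \<noteq> {}" by auto
  then show ?thesis by (auto simp: point_space_def space_Sup_eq_UN)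
qed

lemma emeasure_point_measurable [measurable]:
  assumes "B \<in> sets borel"
  shows "(\<lambda>N. emeasure N B) \<in> borel_measurable point_space"
  unfolding point_space_def using assms
  by (intro measurable_SUP1[OF assms] measurable_vimage_algebra1) auto

lemma has_point_measurable [measurable]: "Measurable.pred point_space (\<lambda>N. has_point N j)"
proof -
  have [measurable]: "(\<lambda>N. emeasure N (if 0 \<le> j then {0..} else {..<0})) \<in> borel_measurable point_space"
    by (rule emeasure_point_measurable) auto
  show ?thesis unfolding has_point_def by measurable
qed

text \<open>The level sets of a point are described by counting points in a bounded interval: from
  above on the nonnegative side, from below on the negative side. Where the point is missing,
  \<open>point\<close> is the infimum or supremum of an empty set, so 0 is put in its place.\<close>

lemma point_measurable [measurable]:
  "(\<lambda>N. if has_point N j then point N j else 0) \<in> borel_measurable point_space"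
proof (cases "0 \<le> j")
  case True
  have *: "{N \<in> space point_space. has_point N j \<and> point N j \<le> x} \<in> sets point_space" for x
  proof (cases "0 \<le> x")
    case x: True
    have "{N \<in> space point_space. has_point N j \<and> point N j \<le> x}
      = {N \<in> space point_space. of_nat (point_rank j) < emeasure N {0..x}}"
      using point_nonneg_iff(1)[OF _ True x] by (auto simp: space_point_space)
    also have "\<dots> \<in> sets point_space" by measurable
    finally show ?thesis .
  next
    case x: False
    have "{N \<in> space point_space. has_point N j \<and> point N j \<le> x} = {}"
      using point_nonneg_iff(2)[OF _ True, of _ 0] x by (force simp: space_point_space)
    then show ?thesis by (simp only: sets.empty_sets)
  qed
  show ?thesis
  proof (rule borel_measurable_iff_le[THEN iffD2], intro allI)
    fix x
    have "{N \<in> space point_space. (if has_point N j then point N j else 0) \<le> x} =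
      {N \<in> space point_space. has_point N j \<and> point N j \<le> x} \<union>
      {N \<in> space point_space. \<not> has_point N j \<and> 0 \<le> x}" by auto
    also have "\<dots> \<in> sets point_space" by (intro sets.Un *) measurable
    finally show "{N \<in> space point_space. (if has_point N j then point N j else 0) \<le> x} \<in> sets point_space" .
  qed
next
  case False
  then have j: "j < 0" by simp
  have *: "{N \<in> space point_space. has_point N j \<and> x \<le> point N j} \<in> sets point_space" for x
  proof (cases "x < 0")
    case x: True
    have "{N \<in> space point_space. has_point N j \<and> x \<le> point N j}
      = {N \<in> space point_space. of_nat (point_rank j) < emeasure N {x..<0}}"
      using point_neg_iff(1)[OF _ j x] by (auto simp: space_point_space)
    also have "\<dots> \<in> sets point_space" by measurable
    finally show ?thesis .
  next
    case x: False
    have "{N \<in> space point_space. has_point N j \<and> x \<le> point N j} = {}"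
      using point_neg_iff(2)[OF _ j, of _ "-1"] x by (force simp: space_point_space)
    then show ?thesis by (simp only: sets.empty_sets)
  qed
  show ?thesis
  proof (rule borel_measurable_iff_ge[THEN iffD2], intro allI)
    fix x
    have "{N \<in> space point_space. x \<le> (if has_point N j then point N j else 0)} =
      {N \<in> space point_space. has_point N j \<and> x \<le> point N j} \<union>
      {N \<in> space point_space. \<not> has_point N j \<and> x \<le> 0}" by auto
    also have "\<dots> \<in> sets point_space" by (intro sets.Un *) measurable
    finally show "{N \<in> space point_space. x \<le> (if has_point N j then point N j else 0)} \<in> sets point_space" .
  qed
qed

section \<open>Subtrees and the martingale as a recursion at the root\<close>

definition shift :: "int \<Rightarrow> (int list \<Rightarrow> 'a) \<Rightarrow> int list \<Rightarrow> 'a" where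
  "shift j d v = d (v @ [j])"

text \<open>Labels are written youngest first, so the last entry is a child of the ancestor;
  removing it makes that child the root.\<close>

lemma individual_append:
  "individual d (v @ [j]) \<longleftrightarrow> has_point (d []) j \<and> individual (shift j d) v"
  by (induction v) (auto simp: shift_def)

lemma position_append: "position d (v @ [j]) = point (d []) j + position (shift j d) v"
  by (induction v) (auto simp: shift_def)

abbreviation tree_space :: "(int list \<Rightarrow> real measure) measure" where
  "tree_space \<equiv> PiM UNIV (\<lambda>_. point_space)"

lemma shift_measurable [measurable]: "shift j \<in> measurable tree_space tree_space"
  unfolding shift_def by (intro measurable_abs_UNIV) measurable

locale additive_martingale =
  fixes \<gamma> \<mu> :: real
  assumes \<mu>_pos: "0 < \<mu>"
begin

text \<open>Missing children get weight 0, so sums run over the fixed index set of all integers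
  instead of a random one.\<close>

definition child_weight :: "real measure \<Rightarrow> int \<Rightarrow> real" where
  "child_weight N j = (if has_point N j then exp (\<gamma> * point N j) / \<mu> else 0)"

lemma child_weight_nonneg: "0 \<le> child_weight N j"
  using \<mu>_pos by (simp add: child_weight_def)

lemma child_weight_measurable [measurable]: "(\<lambda>N. child_weight N j) \<in> borel_measurable point_space"
proof -
  have "child_weight N j = (if has_point N j then exp (\<gamma> * (if has_point N j then point N j else 0)) / \<mu> else 0)" for N
    by (simp add: child_weight_def)
  then show ?thesis by simp
qed

text \<open>This is W_n as an extended real, defined on every tree. Branching at the ancestor, not
  at generation n, yields the smoothing recursion by definition and allows evaluation on
  subtrees.\<close>

primrec V_n :: "nat \<Rightarrow> (int list \<Rightarrow> real measure) \<Rightarrow> ennreal" where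
  "V_n 0 d = 1"
| "V_n (Suc n) d = (\<integral>\<^sup>+ j. ennreal (child_weight (d []) j) * V_n n (shift j d) \<partial>count_space UNIV)"

lemma V_n_measurable [measurable]: "V_n n \<in> borel_measurable tree_space"
proof (induction n)
  case (Suc n)
  note [measurable] = Suc
  show ?case unfolding V_n.simps by measurable
qed simp

definition node_weight :: "(int list \<Rightarrow> real measure) \<Rightarrow> int list \<Rightarrow> real" where
  "node_weight d u = (if individual d u then exp (\<gamma> * position d u) / \<mu> ^ length u else 0)"

lemma node_weight_nonneg: "0 \<le> node_weight d u"
  using \<mu>_pos by (simp add: node_weight_def)

lemma node_weight_append:
  "node_weight d (v @ [j]) = child_weight (d []) j * node_weight (shift j d) v"
  by (simp add: node_weight_def child_weight_def individual_append position_append distrib_left exp_add)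

text \<open>The induction runs over all labels of length n, since the generations of a tree and of
  its subtrees are different sets; \<open>node_weight\<close> vanishes at labels that are not
  individuals.\<close>

lemma V_n_eq: "V_n n d = (\<integral>\<^sup>+ u. ennreal (node_weight d u) \<partial>count_space (generation d n))"
proof -
  have "V_n n d = (\<integral>\<^sup>+ u. (if length u = n then ennreal (node_weight d u) else 0) \<partial>count_space UNIV)" for d
  proof (induction n arbitrary: d)
    case 0
    have "(\<integral>\<^sup>+ u. (if length u = 0 then ennreal (node_weight d u) else 0) \<partial>count_space UNIV)
      = (\<integral>\<^sup>+ u. indicator {[] :: int list} u \<partial>count_space UNIV)"
      by (rule nn_integral_cong) (auto simp: node_weight_def)
    then show ?case by simp
  next
    case (Suc n)
    let ?f = "\<lambda>u. if length u = Suc n then ennreal (node_weight d u) else 0"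
    have bij: "bij_betw (\<lambda>(j, v). v @ [j]) UNIV (- {[]} :: int list set)"
      by (rule bij_betw_byWitness[where f' = "\<lambda>u. (last u, butlast u)"]) auto
    have "(\<integral>\<^sup>+ u. ?f u \<partial>count_space UNIV) = (\<integral>\<^sup>+ u. ?f u \<partial>count_space (- {[]}))"
      by (subst (2) nn_integral_count_space_indicator)
        (auto intro!: nn_integral_cong simp: indicator_def)
    also have "\<dots> = (\<integral>\<^sup>+ (j, v). ?f (v @ [j]) \<partial>count_space UNIV)"
      using nn_integral_bij_count_space[OF bij, symmetric, of ?f] by (simp only: case_prod_beta')
    also have "\<dots> = (\<integral>\<^sup>+ j. \<integral>\<^sup>+ v. ?f (v @ [j]) \<partial>count_space UNIV \<partial>count_space UNIV)"
      by (subst nn_integral_fst_count_space[symmetric]) simp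
    also have "\<dots> = (\<integral>\<^sup>+ j. ennreal (child_weight (d []) j) * V_n n (shift j d) \<partial>count_space UNIV)"
    proof (rule nn_integral_cong)
      fix j
      have "(\<integral>\<^sup>+ v. ?f (v @ [j]) \<partial>count_space UNIV)
        = (\<integral>\<^sup>+ v. ennreal (child_weight (d []) j) *
            (if length v = n then ennreal (node_weight (shift j d) v) else 0) \<partial>count_space UNIV)"
        by (intro nn_integral_cong)
          (simp add: node_weight_append ennreal_mult child_weight_nonneg node_weight_nonneg)
      then show "(\<integral>\<^sup>+ v. ?f (v @ [j]) \<partial>count_space UNIV)
          = ennreal (child_weight (d []) j) * V_n n (shift j d)"
        by (simp add: nn_integral_cmult Suc)
    qed
    finally show ?case by simp
  qed
  also have "(\<integral>\<^sup>+ u. (if length u = n then ennreal (node_weight d u) else 0) \<partial>count_space UNIV)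
    = (\<integral>\<^sup>+ u. ennreal (node_weight d u) \<partial>count_space (generation d n))"
    by (subst nn_integral_count_space_indicator[of "generation d n"])
      (auto intro!: nn_integral_cong simp: generation_def indicator_def node_weight_def)
  finally show ?thesis .
qed

end

section \<open>Independence of the subtrees\<close>

lemma (in prob_space) indep_var_nn_integral_mult:
  fixes f g :: "_ \<Rightarrow> ennreal"
  assumes ind: "indep_var S X T Y"
    and f: "f \<in> borel_measurable S" and g: "g \<in> borel_measurable T"
  shows "(\<integral>\<^sup>+ \<omega>. f (X \<omega>) * g (Y \<omega>) \<partial>M) = (\<integral>\<^sup>+ \<omega>. f (X \<omega>) \<partial>M) * (\<integral>\<^sup>+ \<omega>. g (Y \<omega>) \<partial>M)"
proof -
  have "indep_vars (case_bool borel borel) (case_bool (f \<circ> X) (g \<circ> Y)) UNIV"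
    using indep_var_compose[OF ind f g] by (simp add: indep_var_def)
  also have "case_bool borel borel = (\<lambda>_. borel)" by (auto split: bool.split)
  finally have "(\<integral>\<^sup>+ \<omega>. (\<Prod>i\<in>UNIV. case_bool (f \<circ> X) (g \<circ> Y) i \<omega>) \<partial>M)
      = (\<Prod>i\<in>UNIV. \<integral>\<^sup>+ \<omega>. case_bool (f \<circ> X) (g \<circ> Y) i \<omega> \<partial>M)"
    by (intro indep_vars_nn_integral) auto
  then show ?thesis by (simp add: UNIV_bool mult.commute comp_def)
qed

locale brw_moment = branching_random_walk P M D + additive_martingale \<gamma> \<mu>
  for P :: "'w measure" and M D and \<gamma> \<mu> :: real +
  assumes \<mu>_eq: "brw_m P D \<gamma> = ennreal \<mu>"
begin

lemma D_node_measurable [measurable]: "(\<lambda>\<omega>. D \<omega> u) \<in> measurable P point_space"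
  using indep_copies by (auto simp: indep_vars_def)

lemma D_measurable [measurable]: "D \<in> measurable P tree_space"
proof -
  have "(\<lambda>\<omega> u. D \<omega> u) \<in> measurable P tree_space" by (intro measurable_abs_UNIV) measurable
  then show ?thesis by simp
qed

text \<open>Independent copies stay so under injective relabelling, hence their joint law is the
  infinite product. Comparing the relabelling by a subtree with the identity shows that a subtree
  has the law of the whole tree.\<close>

lemma distr_subfamily:
  assumes f: "inj f"
  shows "distr P tree_space (\<lambda>\<omega> v. D \<omega> (f v)) = PiM UNIV (\<lambda>_. distr P point_space M)"
proof -
  have "indep_vars (\<lambda>v. PiM {f v} (\<lambda>_. point_space)) (\<lambda>v \<omega>. restrict (D \<omega>) {f v}) UNIV"
    by (rule indep_vars_restrict[OF indep_copies]) (use f in \<open>simp_all add: disjoint_family_on_def inj_eq\<close>)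
  then have "indep_vars (\<lambda>_. point_space) (\<lambda>v \<omega>. (\<lambda>h. h (f v)) (restrict (D \<omega>) {f v})) UNIV"
    by (rule indep_vars_compose2) (auto intro: measurable_component_singleton)
  then have "indep_vars (\<lambda>_. point_space) (\<lambda>v \<omega>. D \<omega> (f v)) UNIV" by simp
  then show ?thesis
    by (subst (asm) indep_vars_iff_distr_eq_PiM') (auto simp: distr_copies restrict_def)
qed

lemma nn_integral_shift:
  assumes f: "f \<in> borel_measurable tree_space"
  shows "(\<integral>\<^sup>+ \<omega>. f (shift j (D \<omega>)) \<partial>P) = (\<integral>\<^sup>+ \<omega>. f (D \<omega>) \<partial>P)"
proof -
  have "distr P tree_space (\<lambda>\<omega>. shift j (D \<omega>)) = distr P tree_space D"
    using distr_subfamily[of "\<lambda>v. v @ [j]"] distr_subfamily[of "\<lambda>v. v"]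
    by (simp add: shift_def[abs_def] inj_def)
  then have "(\<integral>\<^sup>+ d. f d \<partial>distr P tree_space (\<lambda>\<omega>. shift j (D \<omega>))) = (\<integral>\<^sup>+ d. f d \<partial>distr P tree_space D)"
    by simp
  then show ?thesis using f by (simp add: nn_integral_distr)
qed

text \<open>The labels outside the subtree of child \<open>j\<close> of the ancestor.\<close>

abbreviation rest :: "int \<Rightarrow> int list set" where "rest j \<equiv> - range (\<lambda>v. v @ [j])"

text \<open>The labels ending in j and the remaining ones are disjoint. The root belongs to the
  remaining ones, so all weights of first-generation children, that of j included, are independent
  of the subtree of j.\<close>

lemma subtree_factor:
  assumes f: "f \<in> borel_measurable tree_space"
    and g: "g \<in> borel_measurable (PiM (rest j) (\<lambda>_. point_space))"
  shows "(\<integral>\<^sup>+ \<omega>. f (shift j (D \<omega>)) * g (restrict (D \<omega>) (rest j)) \<partial>P)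
    = (\<integral>\<^sup>+ \<omega>. f (D \<omega>) \<partial>P) * (\<integral>\<^sup>+ \<omega>. (g (restrict (D \<omega>) (rest j)) :: ennreal) \<partial>P)"
proof -
  let ?T = "range (\<lambda>v. v @ [j])"
  have ind: "indep_var (PiM ?T (\<lambda>_. point_space)) (\<lambda>\<omega>. restrict (\<lambda>u. D \<omega> u) ?T)
      (PiM (rest j) (\<lambda>_. point_space)) (\<lambda>\<omega>. restrict (\<lambda>u. D \<omega> u) (rest j))"
    by (rule indep_var_restrict[OF indep_copies]) auto
  have fT: "(\<lambda>h. f (\<lambda>v. h (v @ [j]))) \<in> borel_measurable (PiM ?T (\<lambda>_. point_space))"
    by (rule measurable_compose[OF _ f]) (intro measurable_abs_UNIV measurable_component_singleton, auto)
  from indep_var_nn_integral_mult[OF ind fT g]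
  show ?thesis
    using nn_integral_shift[OF f, of j] by (simp add: shift_def[abs_def])
qed

lemma Nil_rest: "[] \<in> rest j" by auto

lemma shift_restrict_rest: "i \<noteq> j \<Longrightarrow> shift i (restrict d (rest j)) = shift i d"
  by (auto simp: shift_def fun_eq_iff)

lemma shift_rest_measurable:
  assumes "i \<noteq> j"
  shows "shift i \<in> measurable (PiM (rest j) (\<lambda>_. point_space)) tree_space"
  unfolding shift_def using assms
  by (intro measurable_abs_UNIV measurable_component_singleton) auto

lemma child_weight_rest_measurable [measurable]:
  "(\<lambda>h. child_weight (h []) i) \<in> borel_measurable (PiM (rest j) (\<lambda>_. point_space))"
  by (rule measurable_compose[OF measurable_component_singleton[OF Nil_rest] child_weight_measurable])

lemma D_point_measures: "\<omega> \<in> space P \<Longrightarrow> D \<omega> u \<in> point_measures"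
  using measurable_space[OF D_node_measurable, of \<omega> u] by (simp add: space_point_space)

lemma sum_child_weight:
  "(\<integral>\<^sup>+ j. \<integral>\<^sup>+ \<omega>. ennreal (child_weight (D \<omega> []) j) \<partial>P \<partial>count_space UNIV) = 1"
proof -
  have "ennreal \<mu> = (\<integral>\<^sup>+ \<omega>. ennreal \<mu> * V_n 1 (D \<omega>) \<partial>P)"
    unfolding \<mu>_eq[symmetric] brw_m_def
  proof (rule nn_integral_cong, goal_cases)
    case (1 \<omega>)
    have "brw (D \<omega>) 1 = distr (count_space (generation (D \<omega>) 1)) borel (position (D \<omega>))"
      using D_point_measures[OF 1] by (intro brw_eq_distr) auto
    then have "(\<integral>\<^sup>+ x. ennreal (exp (\<gamma> * x)) \<partial>brw (D \<omega>) 1)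
        = (\<integral>\<^sup>+ u. ennreal (exp (\<gamma> * position (D \<omega>) u)) \<partial>count_space (generation (D \<omega>) 1))"
      by (simp add: nn_integral_distr)
    also have "\<dots> = (\<integral>\<^sup>+ u. ennreal \<mu> * ennreal (node_weight (D \<omega>) u) \<partial>count_space (generation (D \<omega>) 1))"
      using \<mu>_pos by (intro nn_integral_cong)
        (auto simp: generation_def node_weight_def ennreal_mult'[symmetric])
    also have "\<dots> = ennreal \<mu> * V_n 1 (D \<omega>)"
      unfolding V_n_eq by (rule nn_integral_cmult) simp
    finally show ?case using \<mu>_eq by (simp add: brw_m_def)
  qed
  also have "\<dots> = ennreal \<mu> * (\<integral>\<^sup>+ \<omega>. V_n 1 (D \<omega>) \<partial>P)" by (rule nn_integral_cmult) measurable
  finally have "(\<integral>\<^sup>+ \<omega>. V_n 1 (D \<omega>) \<partial>P) = 1"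
    using \<mu>_pos by (metis ennreal_mult_cancel_left ennreal_eq_0_iff ennreal_neq_top mult_1_right not_less)
  then have "(\<integral>\<^sup>+ \<omega>. \<integral>\<^sup>+ j. ennreal (child_weight (D \<omega> []) j) \<partial>count_space UNIV \<partial>P) = 1" by simp
  then show ?thesis by (subst nn_integral_countable_swap[symmetric]) auto
qed

lemma mean_V_n: "(\<integral>\<^sup>+ \<omega>. V_n n (D \<omega>) \<partial>P) = 1"
proof (induction n)
  case 0
  show ?case by (simp add: emeasure_space_1)
next
  case (Suc n)
  have "(\<integral>\<^sup>+ \<omega>. V_n (Suc n) (D \<omega>) \<partial>P) = (\<integral>\<^sup>+ j. \<integral>\<^sup>+ \<omega>. ennreal (child_weight (D \<omega> []) j) * V_n n (shift j (D \<omega>)) \<partial>P \<partial>count_space UNIV)"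
    by (simp add: nn_integral_countable_swap)
  also have "\<dots> = (\<integral>\<^sup>+ j. \<integral>\<^sup>+ \<omega>. ennreal (child_weight (D \<omega> []) j) \<partial>P \<partial>count_space UNIV)"
  proof (rule nn_integral_cong)
    fix j
    have "(\<lambda>h. ennreal (child_weight (h []) j)) \<in> borel_measurable (PiM (rest j) (\<lambda>_. point_space))"
      by measurable
    from subtree_factor[OF V_n_measurable[of n] this]
    show "(\<integral>\<^sup>+ \<omega>. ennreal (child_weight (D \<omega> []) j) * V_n n (shift j (D \<omega>)) \<partial>P)
        = (\<integral>\<^sup>+ \<omega>. ennreal (child_weight (D \<omega> []) j) \<partial>P)"
      using Suc Nil_rest by (simp add: mult.commute)
  qed
  also have "\<dots> = 1" by (rule sum_child_weight)
  finally show ?case .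
qed

lemma AE_V_n_finite: "AE \<omega> in P. \<forall>n. V_n n (D \<omega>) < \<infinity>"
  unfolding AE_all_countable
proof
  fix n
  have "AE \<omega> in P. V_n n (D \<omega>) \<noteq> \<infinity>"
    by (rule nn_integral_PInf_AE) (auto simp: mean_V_n)
  then show "AE \<omega> in P. V_n n (D \<omega>) < \<infinity>" by (simp add: less_top)
qed

lemma AE_V_n_shift_finite: "AE \<omega> in P. \<forall>j. V_n n (shift j (D \<omega>)) < \<infinity>"
  unfolding AE_all_countable
proof
  fix j
  have "AE \<omega> in P. V_n n (shift j (D \<omega>)) \<noteq> \<infinity>"
    using nn_integral_shift[OF V_n_measurable, of n j] by (intro nn_integral_PInf_AE) (auto simp: mean_V_n)
  then show "AE \<omega> in P. V_n n (shift j (D \<omega>)) < \<infinity>" by (simp add: less_top)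
qed

lemma brw_Y_eq: "u \<in> generation (D \<omega>) n \<Longrightarrow> brw_Y P D \<gamma> u \<omega> = node_weight (D \<omega>) u"
  using \<mu>_pos by (simp add: brw_Y_def node_weight_def generation_def \<mu>_eq)

lemma brw_W_eq: "brw_W P D \<gamma> n \<omega> = enn2real (V_n n (D \<omega>))"
proof -
  have "brw_W P D \<gamma> n \<omega> = (\<Sum>\<^sub>\<infinity>u\<in>generation (D \<omega>) n. node_weight (D \<omega>) u)"
    unfolding brw_W_def using brw_Y_eq by (intro infsum_cong) auto
  also have "\<dots> = enn2real (V_n n (D \<omega>))"
    unfolding V_n_eq by (rule infsum_eq_enn2real_nn_integral) (rule node_weight_nonneg)
  finally show ?thesis .
qed

text \<open>The functional F is left free because the recursion serves twice: with
  \<open>V_n n\<close>, and with the limit as a functional of the tree.\<close>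

lemma smoothing:
  assumes F [measurable]: "F \<in> borel_measurable tree_space"
    and nonneg: "\<And>d. 0 \<le> F d" and mean: "(\<integral>\<^sup>+ \<omega>. ennreal (F (D \<omega>)) \<partial>P) = 1"
  shows "smoothing P (\<lambda>j \<omega>. child_weight (D \<omega> []) j) (\<lambda>j \<omega>. F (shift j (D \<omega>))) (\<lambda>\<omega>. F (D \<omega>))"
proof
  fix j and f :: "real \<Rightarrow> ennreal" and g :: "(int \<Rightarrow> real) \<times> (int \<Rightarrow> real) \<Rightarrow> ennreal"
  assume f [measurable]: "f \<in> borel_measurable borel"
    and g: "g \<in> borel_measurable (PiM UNIV (\<lambda>_. borel) \<Otimes>\<^sub>M PiM UNIV (\<lambda>_. borel))"
  let ?G = "\<lambda>h. (\<lambda>i. child_weight (h []) i, \<lambda>i. if i = j then 0 else F (shift i h))"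
  have "(\<lambda>h. if i = j then 0 else F (shift i h)) \<in> borel_measurable (PiM (rest j) (\<lambda>_. point_space))" for i
  proof (cases "i = j")
    case False
    then show ?thesis using measurable_compose[OF shift_rest_measurable[OF False] F] by simp
  qed simp
  then have "?G \<in> measurable (PiM (rest j) (\<lambda>_. point_space)) (PiM UNIV (\<lambda>_. borel) \<Otimes>\<^sub>M PiM UNIV (\<lambda>_. borel))"
    by (intro measurable_Pair measurable_abs_UNIV child_weight_rest_measurable)
  from measurable_compose[OF this g]
  have "(\<lambda>h. g (?G h)) \<in> borel_measurable (PiM (rest j) (\<lambda>_. point_space))" .
  from subtree_factor[OF _ this, of "\<lambda>d. f (F d)"]
  have "(\<integral>\<^sup>+ \<omega>. f (F (shift j (D \<omega>))) * g (?G (restrict (D \<omega>) (rest j))) \<partial>P)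
    = (\<integral>\<^sup>+ \<omega>. f (F (D \<omega>)) \<partial>P) * (\<integral>\<^sup>+ \<omega>. g (?G (restrict (D \<omega>) (rest j))) \<partial>P)" by simp
  moreover have "?G (restrict d (rest j)) = ?G d" for d
    using Nil_rest[of j] by (auto simp: shift_restrict_rest intro!: ext)
  ultimately show "(\<integral>\<^sup>+ \<omega>. f (F (shift j (D \<omega>))) *
        g (\<lambda>i. child_weight (D \<omega> []) i, \<lambda>i. if i = j then 0 else F (shift i (D \<omega>))) \<partial>P) =
      (\<integral>\<^sup>+ \<omega>. f (F (D \<omega>)) \<partial>P) *
      (\<integral>\<^sup>+ \<omega>. g (\<lambda>i. child_weight (D \<omega> []) i, \<lambda>i. if i = j then 0 else F (shift i (D \<omega>))) \<partial>P)"
    by (simp only:)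
qed (use sum_child_weight mean nonneg child_weight_nonneg in auto)

end

section \<open>The two implications\<close>

text \<open>With distortion (1 + \<delta>)^p, the net downward drift tends to m - p1 as \<delta>
  decreases to 0; at least half of it is retained.\<close>

lemma eventually_drift_negative:
  fixes m p1 :: real
  assumes "p1 < m"
  obtains \<delta> where "0 < \<delta>" "(m - p1) / 2 < m / (1 + \<delta>) ^ p - (1 + \<delta>) ^ p * p1"
proof -
  have "((\<lambda>\<delta>. m / (1 + \<delta>) ^ p - (1 + \<delta>) ^ p * p1) \<longlongrightarrow> m / (1 + 0) ^ p - (1 + 0) ^ p * p1) (at_right 0)"
    by (intro tendsto_intros) auto
  then have "\<forall>\<^sub>F \<delta> in at_right 0. (m - p1) / 2 < m / (1 + \<delta>) ^ p - (1 + \<delta>) ^ p * p1"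
    by (rule order_tendstoD) (use assms in auto)
  moreover have "\<forall>\<^sub>F \<delta> in at_right (0::real). 0 < \<delta>" by (rule eventually_at_right_less)
  ultimately have "\<forall>\<^sub>F \<delta> in at_right 0. 0 < \<delta> \<and> (m - p1) / 2 < m / (1 + \<delta>) ^ p - (1 + \<delta>) ^ p * p1"
    by eventually_elim simp
  then show ?thesis using that eventually_happens'[of "at_right (0::real)"] by auto
qed

text \<open>If all terms from n0 on exceeded c + 1, then k further terms would contribute more than
  (n0 + k) c as soon as k > n0 c.\<close>

lemma liminf_le_of_sums_le:
  fixes x :: "nat \<Rightarrow> ennreal"
  assumes sum: "\<And>n. (\<Sum>i<n. x i) \<le> of_nat n * ennreal c" and c: "0 \<le> c"
  shows "liminf x \<le> ennreal (c + 1)"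
proof (rule ccontr)
  assume "\<not> liminf x \<le> ennreal (c + 1)"
  then have "ennreal (c + 1) < liminf x" by simp
  then have "\<forall>\<^sub>F n in sequentially. ennreal (c + 1) < x n" by (rule less_LiminfD)
  then obtain n0 where n0: "\<And>n. n0 \<le> n \<Longrightarrow> ennreal (c + 1) < x n"
    by (auto simp: eventually_sequentially)
  obtain k where k: "real n0 * c < real k" using reals_Archimedean2 by blast
  have "of_nat k * ennreal (c + 1) = (\<Sum>i\<in>{n0..<n0 + k}. ennreal (c + 1))" by simp
  also have "\<dots> \<le> (\<Sum>i\<in>{n0..<n0 + k}. x i)" using n0 by (intro sum_mono) (auto intro: less_imp_le)
  also have "\<dots> \<le> (\<Sum>i<n0 + k. x i)" by (intro sum_mono2) auto
  also have "\<dots> \<le> of_nat (n0 + k) * ennreal c" by (rule sum)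
  finally have "ennreal (real k * (c + 1)) \<le> ennreal (real (n0 + k) * c)"
    using c by (simp add: ennreal_mult ennreal_of_nat_eq_real_of_nat del: of_nat_add)
  then have "real k * (c + 1) \<le> real (n0 + k) * c"
    using c by (subst (asm) ennreal_le_iff) auto
  with k show False by (simp add: algebra_simps)
qed

context brw_moment
begin

abbreviation Wn :: "nat \<Rightarrow> 'w \<Rightarrow> real" where "Wn n \<omega> \<equiv> brw_W P D \<gamma> n \<omega>"

abbreviation cw :: "int \<Rightarrow> 'w \<Rightarrow> real" where "cw j \<omega> \<equiv> child_weight (D \<omega> []) j"

abbreviation CS :: "(int \<Rightarrow> 'w \<Rightarrow> ennreal) \<Rightarrow> ennreal" where
  "CS F \<equiv> (\<integral>\<^sup>+ j. \<integral>\<^sup>+ \<omega>. ennreal (cw j \<omega>) * F j \<omega> \<partial>P \<partial>count_space UNIV)"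

lemma Wn_measurable [measurable]: "(\<lambda>\<omega>. Wn n \<omega>) \<in> borel_measurable P"
  unfolding brw_W_eq by measurable

lemma Wn_nonneg: "0 \<le> Wn n \<omega>" by (simp add: brw_W_eq)

lemma Wn_0: "Wn 0 \<omega> = 1" by (simp add: brw_W_eq)

lemma AE_Wn: "AE \<omega> in P. \<forall>n. ennreal (Wn n \<omega>) = V_n n (D \<omega>)"
  using AE_V_n_finite by eventually_elim (simp add: brw_W_eq)

lemma mean_Wn: "(\<integral>\<^sup>+ \<omega>. ennreal (Wn n \<omega>) \<partial>P) = 1"
  unfolding mean_V_n[of n, symmetric] using AE_Wn by (intro nn_integral_cong_AE) auto

text \<open>Connects the sum over first-generation individuals that defines the law of Z with the
  sum over all child indices.\<close>

lemma sum_generation_1: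
  assumes h [measurable]: "h \<in> borel_measurable borel"
  shows "(\<integral>\<^sup>+ \<omega>. (\<integral>\<^sup>+ u. ennreal (brw_Y P D \<gamma> u \<omega>) * h (brw_Y P D \<gamma> u \<omega>) \<partial>count_space (generation (D \<omega>) 1)) \<partial>P)
    = CS (\<lambda>j \<omega>. h (cw j \<omega>))"
proof -
  have "(\<integral>\<^sup>+ u. ennreal (brw_Y P D \<gamma> u \<omega>) * h (brw_Y P D \<gamma> u \<omega>) \<partial>count_space (generation (D \<omega>) 1))
    = (\<integral>\<^sup>+ j. ennreal (cw j \<omega>) * h (cw j \<omega>) \<partial>count_space UNIV)" for \<omega>
  proof -
    have bij: "bij_betw (\<lambda>j. [j]) {j. has_point (D \<omega> []) j} (generation (D \<omega>) 1)"
      by (rule bij_betw_byWitness[where f' = hd]) (auto simp: generation_def length_Suc_conv)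
    have eq: "brw_Y P D \<gamma> [j] \<omega> = cw j \<omega>" if "has_point (D \<omega> []) j" for j
      using that \<mu>_pos by (simp add: brw_Y_def child_weight_def \<mu>_eq)
    have "(\<integral>\<^sup>+ u. ennreal (brw_Y P D \<gamma> u \<omega>) * h (brw_Y P D \<gamma> u \<omega>) \<partial>count_space (generation (D \<omega>) 1))
      = (\<integral>\<^sup>+ j. ennreal (brw_Y P D \<gamma> [j] \<omega>) * h (brw_Y P D \<gamma> [j] \<omega>) \<partial>count_space {j. has_point (D \<omega> []) j})"
      by (rule nn_integral_bij_count_space[OF bij, symmetric])
    also have "\<dots> = (\<integral>\<^sup>+ j. ennreal (cw j \<omega>) * h (cw j \<omega>) \<partial>count_space UNIV)"
      by (subst nn_integral_count_space_indicator)
        (auto intro!: nn_integral_cong simp: indicator_def eq, simp add: child_weight_def)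
    finally show ?thesis .
  qed
  then have "(\<integral>\<^sup>+ \<omega>. (\<integral>\<^sup>+ u. ennreal (brw_Y P D \<gamma> u \<omega>) * h (brw_Y P D \<gamma> u \<omega>) \<partial>count_space (generation (D \<omega>) 1)) \<partial>P)
    = (\<integral>\<^sup>+ \<omega>. \<integral>\<^sup>+ j. ennreal (cw j \<omega>) * h (cw j \<omega>) \<partial>count_space UNIV \<partial>P)" by simp
  also have "\<dots> = CS (\<lambda>j \<omega>. h (cw j \<omega>))"
    by (rule nn_integral_countable_swap) measurable
  finally show ?thesis .
qed

lemma AE_W1_eq: "AE \<omega> in P. ennreal (Wn 1 \<omega>) = (\<integral>\<^sup>+ j. ennreal (cw j \<omega>) \<partial>count_space UNIV)"
  using AE_Wn
proof eventually_elim
  case (elim \<omega>)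
  from elim[THEN spec, of "Suc 0"] show ?case by simp
qed

lemma CS_W1:
  assumes [measurable]: "h \<in> borel_measurable P"
  shows "CS (\<lambda>_. h) = (\<integral>\<^sup>+ \<omega>. ennreal (Wn 1 \<omega>) * h \<omega> \<partial>P)"
proof -
  have "CS (\<lambda>_. h) = (\<integral>\<^sup>+ \<omega>. \<integral>\<^sup>+ j. ennreal (cw j \<omega>) * h \<omega> \<partial>count_space UNIV \<partial>P)"
    by (rule nn_integral_countable_swap[symmetric]) auto
  also have "\<dots> = (\<integral>\<^sup>+ \<omega>. ennreal (Wn 1 \<omega>) * h \<omega> \<partial>P)"
    using AE_W1_eq by (intro nn_integral_cong_AE, eventually_elim) (simp add: nn_integral_multc)
  finally show ?thesis .
qed

text \<open>Dominated convergence, over the probability space and then over the children. Since 1 +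
  W_1 / A is at most (1 + W_1) (1 + 1 / A), the logarithm is dominated by 2 + l W_1 + (ln A)^-,
  which the two hypotheses make integrable.\<close>

lemma perturbation_tendsto_0:
  assumes fin: "CS (\<lambda>j \<omega>. ennreal (max 0 (- ln (cw j \<omega>)))) < \<infinity>"
    and W1: "(\<integral>\<^sup>+ \<omega>. ennreal (Wn 1 \<omega>) * ennreal (ln_plus (Wn 1 \<omega>)) \<partial>P) < \<infinity>"
  shows "(\<lambda>n. CS (\<lambda>j \<omega>. ennreal (ln (1 + Wn 1 \<omega> * exp (- real n) / cw j \<omega>)))) \<longlonglongrightarrow> 0"
proof -
  let ?f = "\<lambda>n j \<omega>. ennreal (cw j \<omega>) * ennreal (ln (1 + Wn 1 \<omega> * exp (- real n) / cw j \<omega>))"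
  let ?g = "\<lambda>j \<omega>. ennreal (cw j \<omega>) * (ennreal (ln_plus (Wn 1 \<omega>)) + (2 + ennreal (max 0 (- ln (cw j \<omega>)))))"
  have fg: "?f n j \<omega> \<le> ?g j \<omega>" for n j \<omega>
  proof (cases "cw j \<omega> = 0")
    case False
    then have A: "0 < cw j \<omega>" using child_weight_nonneg by (simp add: less_le)
    have W: "0 \<le> Wn 1 \<omega>" by (rule Wn_nonneg)
    have "Wn 1 \<omega> * exp (- real n) \<le> Wn 1 \<omega> * 1" using W by (intro mult_left_mono) auto
    then have "1 + Wn 1 \<omega> * exp (- real n) / cw j \<omega> \<le> 1 + Wn 1 \<omega> / cw j \<omega>"
      using A by (simp add: divide_right_mono)
    also have "\<dots> \<le> (1 + Wn 1 \<omega>) * (1 + 1 / cw j \<omega>)"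
    proof -
      have "0 \<le> Wn 1 \<omega> + 1 / cw j \<omega>" using A W by simp
      then show ?thesis by (simp add: distrib_left distrib_right add_divide_distrib)
    qed
    finally have "ln (1 + Wn 1 \<omega> * exp (- real n) / cw j \<omega>) \<le> ln ((1 + Wn 1 \<omega>) * (1 + 1 / cw j \<omega>))"
      using A W by (subst ln_le_cancel_iff) (auto intro!: add_pos_nonneg mult_pos_pos)
    also have "\<dots> = ln (1 + Wn 1 \<omega>) + ln (1 + 1 / cw j \<omega>)"
      using A W by (intro ln_mult_pos add_pos_nonneg) auto
    also have "\<dots> \<le> (1 + ln_plus (Wn 1 \<omega>)) + (1 + ln_plus (1 / cw j \<omega>))"
      using A W by (intro add_mono ln_1_plus_le) auto
    also have "ln_plus (1 / cw j \<omega>) = max 0 (- ln (cw j \<omega>))"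
      using A by (simp add: ln_plus_def ln_div max.commute)
    finally have "ennreal (ln (1 + Wn 1 \<omega> * exp (- real n) / cw j \<omega>))
      \<le> ennreal (ln_plus (Wn 1 \<omega>) + (2 + max 0 (- ln (cw j \<omega>))))" by (intro ennreal_leI) simp
    also have "\<dots> = ennreal (ln_plus (Wn 1 \<omega>)) + (2 + ennreal (max 0 (- ln (cw j \<omega>))))"
      by (simp add: ln_plus_nonneg ennreal_plus del: ennreal_plus[symmetric])
    finally show ?thesis by (rule mult_left_mono) simp
  qed simp
  have lim: "(\<lambda>n. ?f n j \<omega>) \<longlonglongrightarrow> 0" for j \<omega>
  proof (cases "cw j \<omega> = 0")
    case False
    have "(\<lambda>n. ln (1 + Wn 1 \<omega> * exp (- real n) / cw j \<omega>)) \<longlonglongrightarrow> ln (1 + Wn 1 \<omega> * 0 / cw j \<omega>)"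
    proof (intro tendsto_intros)
      show "(\<lambda>n. exp (- real n)) \<longlonglongrightarrow> 0"
        by (intro filterlim_compose[OF exp_at_bot] filterlim_uminus_at_bot[THEN iffD2])
          (simp add: filterlim_real_sequentially)
    qed (use False in auto)
    then have "(\<lambda>n. ennreal (ln (1 + Wn 1 \<omega> * exp (- real n) / cw j \<omega>))) \<longlonglongrightarrow> ennreal 0"
      by (intro tendsto_ennrealI) simp
    then have "(\<lambda>n. ennreal (cw j \<omega>) * ennreal (ln (1 + Wn 1 \<omega> * exp (- real n) / cw j \<omega>)))
        \<longlonglongrightarrow> ennreal (cw j \<omega>) * ennreal 0"
      by (intro ennreal_tendsto_cmult) auto
    then show ?thesis by simp
  qed simp
  have G: "(\<integral>\<^sup>+ j. \<integral>\<^sup>+ \<omega>. ?g j \<omega> \<partial>P \<partial>count_space UNIV) < \<infinity>"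
  proof -
    have "(\<integral>\<^sup>+ j. \<integral>\<^sup>+ \<omega>. ?g j \<omega> \<partial>P \<partial>count_space UNIV)
      = CS (\<lambda>_ \<omega>. ennreal (ln_plus (Wn 1 \<omega>))) + (CS (\<lambda>_ _. 2) + CS (\<lambda>j \<omega>. ennreal (max 0 (- ln (cw j \<omega>)))))"
      by (simp add: distrib_left nn_integral_add)
    also have "CS (\<lambda>_ \<omega>. ennreal (ln_plus (Wn 1 \<omega>))) = (\<integral>\<^sup>+ \<omega>. ennreal (Wn 1 \<omega>) * ennreal (ln_plus (Wn 1 \<omega>)) \<partial>P)"
      by (rule CS_W1) measurable
    also have "CS (\<lambda>_ _. 2) = 2"
      using CS_W1[of "\<lambda>_. 2"] mean_Wn[of 1] by (simp add: nn_integral_multc)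
    finally show ?thesis using fin W1 by simp
  qed
  have inner: "(\<lambda>n. \<integral>\<^sup>+ \<omega>. ?f n j \<omega> \<partial>P) \<longlonglongrightarrow> (\<integral>\<^sup>+ \<omega>. 0 \<partial>P)" for j
  proof (rule nn_integral_dominated_convergence[where w = "?g j"])
    have "(\<integral>\<^sup>+ \<omega>. ?g j \<omega> \<partial>P) \<le> (\<integral>\<^sup>+ j. \<integral>\<^sup>+ \<omega>. ?g j \<omega> \<partial>P \<partial>count_space UNIV)"
      by (rule nn_integral_ge_point) simp
    then show "(\<integral>\<^sup>+ \<omega>. ?g j \<omega> \<partial>P) < \<infinity>" using G by (rule order.strict_trans1)
  qed (use fg lim in auto)
  have "(\<lambda>n. \<integral>\<^sup>+ j. \<integral>\<^sup>+ \<omega>. ?f n j \<omega> \<partial>P \<partial>count_space UNIV) \<longlonglongrightarrow> (\<integral>\<^sup>+ (j::int). 0 \<partial>count_space UNIV)"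
    by (rule nn_integral_dominated_convergence[where w = "\<lambda>j. \<integral>\<^sup>+ \<omega>. ?g j \<omega> \<partial>P"])
      (use fg G inner in \<open>auto intro!: nn_integral_mono simp: AE_count_space\<close>)
  then show ?thesis by simp
qed

lemma AE_smoothing_S:
  "AE \<omega> in P. enn2real (\<integral>\<^sup>+ j. ennreal (cw j \<omega> * enn2real (V_n n (shift j (D \<omega>)))) \<partial>count_space UNIV)
    = Wn (Suc n) \<omega>"
  using AE_V_n_shift_finite[of n]
proof eventually_elim
  case (elim \<omega>)
  then have "ennreal (cw j \<omega> * enn2real (V_n n (shift j (D \<omega>)))) = ennreal (cw j \<omega>) * V_n n (shift j (D \<omega>))" for j
    by (simp add: ennreal_mult child_weight_nonneg)
  then show ?case by (simp add: brw_W_eq)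
qed

end

section \<open>From the first generation to the limit\<close>

locale brw_weight = brw_moment + growth_weight
begin

lemma size_biased_drift:
  assumes \<delta>: "0 < \<delta>" and t0: "0 \<le> t0" "t0 \<le> K" "1 + K \<le> (1 + \<delta>) * (1 + K - t0)"
    and CK: "0 \<le> CK" "\<And>w r. 0 < w \<Longrightarrow> 0 \<le> r \<Longrightarrow> \<Psi> (K + ln_plus (w + r)) \<le> CK * (\<Psi> (ln_plus w) + 1 + r / w)"
  defines "q \<equiv> (1 + \<delta>) ^ p" and "C \<equiv> (1 + (1 + 1 / \<delta>) ^ p) * CK"
    and "e \<equiv> (\<lambda>n. \<integral>\<^sup>+ \<omega>. ennreal (Wn n \<omega>) * ennreal (if exp K < Wn n \<omega> then b (ln_plus (Wn n \<omega>)) else 0) \<partial>P)"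
  shows "(\<integral>\<^sup>+ \<omega>. ennreal (Wn (Suc n) \<omega>) * ennreal (B (ln_plus (Wn (Suc n) \<omega>))) \<partial>P)
      + e n * CS (\<lambda>j \<omega>. ennreal (min (max 0 (- ln (cw j \<omega>))) t0 / q))
    \<le> (\<integral>\<^sup>+ \<omega>. ennreal (Wn n \<omega>) * ennreal (B (ln_plus (Wn n \<omega>))) \<partial>P)
      + ennreal q * e n * (CS (\<lambda>j \<omega>. ennreal (max 0 (ln (cw j \<omega>))))
          + CS (\<lambda>j \<omega>. ennreal (ln (1 + Wn 1 \<omega> * exp (- K) / cw j \<omega>))))
      + ennreal C * ((\<integral>\<^sup>+ \<omega>. ennreal (Wn 1 \<omega>) * ennreal (\<Psi> (ln_plus (Wn 1 \<omega>))) \<partial>P) + 2)"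
proof -
  have "smoothing P cw (\<lambda>j \<omega>. enn2real (V_n n (shift j (D \<omega>)))) (\<lambda>\<omega>. enn2real (V_n n (D \<omega>)))"
    by (rule smoothing) (use mean_Wn[of n] in \<open>simp_all add: brw_W_eq\<close>)
  then interpret st: smoothing P cw "\<lambda>j \<omega>. enn2real (V_n n (shift j (D \<omega>)))" "\<lambda>\<omega>. enn2real (V_n n (D \<omega>))" .
  interpret st: smoothing_weight P cw "\<lambda>j \<omega>. enn2real (V_n n (shift j (D \<omega>)))" "\<lambda>\<omega>. enn2real (V_n n (D \<omega>))" b p ..
  have W1: "st.W1 \<omega> = Wn 1 \<omega>" for \<omega>
    by (simp add: st.W1_def st.total_def brw_W_eq)
  have "AE \<omega> in P. st.S \<omega> = Wn (Suc n) \<omega>"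
    using AE_smoothing_S[of n] by (simp add: st.S_def st.total_def)
  then have S: "(\<integral>\<^sup>+ \<omega>. ennreal (st.S \<omega>) * ennreal (B (ln_plus (st.S \<omega>))) \<partial>P)
    = (\<integral>\<^sup>+ \<omega>. ennreal (Wn (Suc n) \<omega>) * ennreal (B (ln_plus (Wn (Suc n) \<omega>))) \<partial>P)"
    by (intro nn_integral_cong_AE) auto
  show ?thesis
    using st.drift[OF \<delta> t0 CK] unfolding W1 S brw_W_eq[symmetric] q_def C_def e_def .
qed

text \<open>The constants are fixed in the order \<open>t0\<close> and m, then \<delta> from the gap
  between m and p1, then K so large that the perturbation is small and \<open>t0\<close> is
  negligible relative to K.\<close>

lemma limit_moment:
  assumes W [measurable]: "W \<in> borel_measurable P"
    and lim: "AE \<omega> in P. (\<lambda>n. Wn n \<omega>) \<longlonglongrightarrow> W \<omega>"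
    and up: "CS (\<lambda>j \<omega>. ennreal (max 0 (ln (cw j \<omega>)))) \<le> ennreal p1" and p1: "0 \<le> p1" "p1 < m"
    and t0: "0 \<le> t0" and down: "ennreal m \<le> CS (\<lambda>j \<omega>. ennreal (min (max 0 (- ln (cw j \<omega>))) t0))"
    and down_fin: "CS (\<lambda>j \<omega>. ennreal (max 0 (- ln (cw j \<omega>)))) < \<infinity>"
    and W1_ln: "(\<integral>\<^sup>+ \<omega>. ennreal (Wn 1 \<omega>) * ennreal (ln_plus (Wn 1 \<omega>)) \<partial>P) < \<infinity>"
    and W1: "(\<integral>\<^sup>+ \<omega>. ennreal (Wn 1 \<omega>) * ennreal (\<Psi> (ln_plus (Wn 1 \<omega>))) \<partial>P) < \<infinity>"
  shows "(\<integral>\<^sup>+ \<omega>. ennreal (W \<omega>) * ennreal (b (ln_plus (W \<omega>))) \<partial>P) < \<infinity>"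
proof -
  obtain \<delta> where \<delta>: "0 < \<delta>" and gap: "(m - p1) / 2 < m / (1 + \<delta>) ^ p - (1 + \<delta>) ^ p * p1"
    using eventually_drift_negative[OF p1(2)] by blast
  define q where "q = (1 + \<delta>) ^ p"
  \<comment> \<open>The retained gap exceeds 2 c: one c pays for the perturbation, the other is the
    gain per step.\<close>
  define c where "c = (m - p1) / 4"
  have q: "0 < q" using \<delta> by (simp add: q_def)
  have c: "0 < c" using p1 by (simp add: c_def)
  have mq: "q * p1 + c + c \<le> m / q" using gap unfolding q_def c_def by linarith
  have "\<forall>\<^sub>F n in sequentially. CS (\<lambda>j \<omega>. ennreal (ln (1 + Wn 1 \<omega> * exp (- real n) / cw j \<omega>))) < ennreal (c / q)"
    using perturbation_tendsto_0[OF down_fin W1_ln] by (rule order_tendstoD) (use c q in simp)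
  \<comment> \<open>The three summands guarantee K \<ge> 1, K \<ge> t0 and (1 + \<delta>) t0 \<le>
    \<delta> K; the last one makes the cut at t0 distort 1 + K by at most a factor 1 +
    \<delta>.\<close>
  moreover have "\<forall>\<^sub>F n in sequentially. 1 + t0 + (1 + \<delta>) * t0 / \<delta> \<le> real n"
    using filterlim_real_sequentially by (simp add: filterlim_at_top)
  ultimately have "\<forall>\<^sub>F n in sequentially. CS (\<lambda>j \<omega>. ennreal (ln (1 + Wn 1 \<omega> * exp (- real n) / cw j \<omega>))) < ennreal (c / q)
      \<and> 1 + t0 + (1 + \<delta>) * t0 / \<delta> \<le> real n"
    by eventually_elim simp
  then obtain n0 where n0: "CS (\<lambda>j \<omega>. ennreal (ln (1 + Wn 1 \<omega> * exp (- real n0) / cw j \<omega>))) < ennreal (c / q)"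
      "1 + t0 + (1 + \<delta>) * t0 / \<delta> \<le> real n0"
    by (auto simp: eventually_sequentially)
  define K where "K = real n0"
  note \<theta> = n0(1)[folded K_def]
  have frac0: "0 \<le> (1 + \<delta>) * t0 / \<delta>" using \<delta> t0 by simp
  have K: "t0 \<le> K" "1 \<le> K" using n0(2) frac0 t0 by (auto simp: K_def)
  have "(1 + \<delta>) * t0 / \<delta> \<le> K" using n0(2) t0 by (simp add: K_def)
  then have "(1 + \<delta>) * t0 \<le> K * \<delta>" using \<delta> by (simp add: divide_le_eq)
  then have K\<delta>: "1 + K \<le> (1 + \<delta>) * (1 + K - t0)" using \<delta> by (simp add: algebra_simps)
  obtain CK where CK: "0 \<le> CK" "\<And>w r. 0 < w \<Longrightarrow> 0 \<le> r \<Longrightarrow> \<Psi> (K + ln_plus (w + r)) \<le> CK * (\<Psi> (ln_plus w) + 1 + r / w)"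
    using \<Psi>_ln_plus_add_le[of K] K by auto
  define E where "E = (\<lambda>n. \<integral>\<^sup>+ \<omega>. ennreal (Wn n \<omega>) * ennreal (B (ln_plus (Wn n \<omega>))) \<partial>P)"
  define e where "e = (\<lambda>n. \<integral>\<^sup>+ \<omega>. ennreal (Wn n \<omega>) * ennreal (if exp K < Wn n \<omega> then b (ln_plus (Wn n \<omega>)) else 0) \<partial>P)"
  define C where "C = ennreal ((1 + (1 + 1 / \<delta>) ^ p) * CK)
    * ((\<integral>\<^sup>+ \<omega>. ennreal (Wn 1 \<omega>) * ennreal (\<Psi> (ln_plus (Wn 1 \<omega>))) \<partial>P) + 2)"
  have C: "C < \<infinity>" using W1 by (simp add: C_def ennreal_mult_less_top)
  \<comment> \<open>Above exp K the logarithm is at least 1, so b \<le> \<Psi> there. This transfers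
    finiteness from E n to e n, without which the drift terms could not be cancelled.\<close>
  have e_le: "e n \<le> ennreal (2 ^ (p + 1)) * E n" for n
  proof -
    have "e n \<le> (\<integral>\<^sup>+ \<omega>. ennreal (2 ^ (p + 1)) * (ennreal (Wn n \<omega>) * ennreal (B (ln_plus (Wn n \<omega>)))) \<partial>P)"
      unfolding e_def
    proof (rule nn_integral_mono)
      fix \<omega>
      show "ennreal (Wn n \<omega>) * ennreal (if exp K < Wn n \<omega> then b (ln_plus (Wn n \<omega>)) else 0)
        \<le> ennreal (2 ^ (p + 1)) * (ennreal (Wn n \<omega>) * ennreal (B (ln_plus (Wn n \<omega>))))"
      proof (cases "exp K < Wn n \<omega>")
        case True
        define l where "l = ln_plus (Wn n \<omega>)"
        have "ln (exp K) \<le> ln (Wn n \<omega>)" using True by (subst ln_le_cancel_iff) (auto intro: less_trans[OF exp_gt_zero])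
        then have l: "1 \<le> l" using K by (simp add: l_def ln_plus_def)
        have "1 * b l \<le> l * b l" using l b_pos[of l] by (intro mult_right_mono) auto
        also have "\<dots> \<le> 2 ^ (p + 1) * B l" using \<Psi>_le_B[of l] l by (simp add: \<Psi>_def)
        finally have "ennreal (b l) \<le> ennreal (2 ^ (p + 1)) * ennreal (B l)"
          by (subst ennreal_mult[symmetric]) (auto intro!: ennreal_leI simp: B_nonneg)
        then have "ennreal (Wn n \<omega>) * ennreal (b l) \<le> ennreal (Wn n \<omega>) * (ennreal (2 ^ (p + 1)) * ennreal (B l))"
          by (rule mult_left_mono) simp
        then show ?thesis using True by (simp only: l_def if_True mult.left_commute)
      qed simp
    qed
    also have "\<dots> = ennreal (2 ^ (p + 1)) * E n" unfolding E_def by (rule nn_integral_cmult) measurable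
    finally show ?thesis .
  qed
  have step: "E (Suc n) + ennreal c * e n \<le> E n + C" if "E n < \<infinity>" for n
  proof -
    have e_fin: "e n < \<infinity>"
      using e_le[of n] by (rule order.strict_trans1) (use that in \<open>simp add: ennreal_mult_less_top\<close>)
    have "E (Suc n) + e n * CS (\<lambda>j \<omega>. ennreal (min (max 0 (- ln (cw j \<omega>))) t0 / q))
      \<le> E n + ennreal q * e n * (CS (\<lambda>j \<omega>. ennreal (max 0 (ln (cw j \<omega>))))
          + CS (\<lambda>j \<omega>. ennreal (ln (1 + Wn 1 \<omega> * exp (- K) / cw j \<omega>)))) + C"
      unfolding E_def e_def q_def C_def by (rule size_biased_drift[OF \<delta> t0 K(1) K\<delta> CK])
    also have "\<dots> \<le> E n + ennreal q * e n * (ennreal p1 + ennreal (c / q)) + C"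
      using up \<theta> by (intro add_mono mult_left_mono order_refl) auto
    also have "ennreal q * e n * (ennreal p1 + ennreal (c / q)) = e n * ennreal (q * p1 + c)"
    proof -
      have "ennreal q * (ennreal p1 + ennreal (c / q)) = ennreal (q * p1 + c)"
        using q c p1 by (simp add: ennreal_mult[symmetric] ennreal_plus[symmetric] distrib_left del: ennreal_plus)
      then show ?thesis by (metis mult.assoc mult.commute)
    qed
    finally have 1: "E (Suc n) + e n * CS (\<lambda>j \<omega>. ennreal (min (max 0 (- ln (cw j \<omega>))) t0 / q))
      \<le> E n + e n * ennreal (q * p1 + c) + C" .
    have "ennreal (q * p1 + c + c) \<le> ennreal (m / q)" using mq by (rule ennreal_leI)
    also have "\<dots> = ennreal (1 / q) * ennreal m"
      using q p1 by (subst ennreal_mult[symmetric]) auto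
    also have "\<dots> \<le> ennreal (1 / q) * CS (\<lambda>j \<omega>. ennreal (min (max 0 (- ln (cw j \<omega>))) t0))"
      using down by (rule mult_left_mono) simp
    also have "\<dots> = CS (\<lambda>j \<omega>. ennreal (min (max 0 (- ln (cw j \<omega>))) t0 / q))"
    proof -
      have "ennreal (cw j \<omega>) * ennreal (min (max 0 (- ln (cw j \<omega>))) t0 / q)
        = ennreal (1 / q) * (ennreal (cw j \<omega>) * ennreal (min (max 0 (- ln (cw j \<omega>))) t0))" for j \<omega>
        using q t0 by (subst mult.left_commute, subst ennreal_mult[symmetric]) auto
      then show ?thesis by (simp add: nn_integral_cmult)
    qed
    finally have 2: "ennreal (q * p1 + c + c) \<le> CS (\<lambda>j \<omega>. ennreal (min (max 0 (- ln (cw j \<omega>))) t0 / q))" .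
    have "E (Suc n) + e n * ennreal (q * p1 + c + c) \<le> E n + e n * ennreal (q * p1 + c) + C"
      using order_trans[OF add_left_mono[OF mult_left_mono[OF 2]] 1] by simp
    moreover have "ennreal (q * p1 + c + c) = ennreal (q * p1 + c) + ennreal c"
      using q p1 c by (intro ennreal_plus) auto
    ultimately have "e n * ennreal (q * p1 + c) + (E (Suc n) + ennreal c * e n)
      \<le> e n * ennreal (q * p1 + c) + (E n + C)"
      by (simp add: distrib_left ac_simps)
    moreover have "e n * ennreal (q * p1 + c) < \<infinity>" using e_fin by (simp add: ennreal_mult_less_top)
    ultimately show ?thesis by (simp only: ennreal_add_left_cancel_le) (metis less_irrefl)
  qed
  \<comment> \<open>The induction hypothesis itself supplies the finiteness of E n that the next
    step requires.\<close>
  have sum: "E n + ennreal c * (\<Sum>i<n. e i) \<le> of_nat n * C" for n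
  proof (induction n)
    case 0
    have "ln_plus 1 = 0" by (simp add: ln_plus_def)
    then show ?case by (simp add: E_def Wn_0 B_0)
  next
    case (Suc n)
    have "E n \<le> of_nat n * C" using Suc by (rule order_trans[rotated]) (simp add: add_increasing2)
    then have "E n < \<infinity>" by (rule order.strict_trans1) (use C in \<open>simp add: ennreal_mult_less_top of_nat_less_top\<close>)
    from step[OF this]
    have "E (Suc n) + ennreal c * e n + ennreal c * (\<Sum>i<n. e i) \<le> E n + C + ennreal c * (\<Sum>i<n. e i)"
      by (rule add_right_mono)
    also have "\<dots> \<le> of_nat n * C + C" using add_right_mono[OF Suc, of C] by (simp add: ac_simps)
    finally show ?case by (simp add: distrib_left distrib_right ac_simps)
  qed
  define x where "x = (\<lambda>n. \<integral>\<^sup>+ \<omega>. ennreal (Wn n \<omega>) * ennreal (b (ln_plus (Wn n \<omega>))) \<partial>P)"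
  obtain C' where C': "C = ennreal C'" "0 \<le> C'" using C by (cases C) auto
  have x_le: "x n \<le> e n + ennreal (b K)" for n
  proof -
    have "x n \<le> (\<integral>\<^sup>+ \<omega>. ennreal (Wn n \<omega>) * ennreal (if exp K < Wn n \<omega> then b (ln_plus (Wn n \<omega>)) else 0)
        + ennreal (b K) * ennreal (Wn n \<omega>) \<partial>P)"
      unfolding x_def
    proof (rule nn_integral_mono)
      fix \<omega>
      show "ennreal (Wn n \<omega>) * ennreal (b (ln_plus (Wn n \<omega>)))
        \<le> ennreal (Wn n \<omega>) * ennreal (if exp K < Wn n \<omega> then b (ln_plus (Wn n \<omega>)) else 0) + ennreal (b K) * ennreal (Wn n \<omega>)"
      proof (cases "exp K < Wn n \<omega>")
        case False
        have "ln_plus (Wn n \<omega>) \<le> ln_plus (exp K)" using False Wn_nonneg by (intro ln_plus_mono) auto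
        also have "ln_plus (exp K) = K" using K by (simp add: ln_plus_def)
        finally have "b (ln_plus (Wn n \<omega>)) \<le> b K" by (rule b_le)
        then have "ennreal (Wn n \<omega>) * ennreal (b (ln_plus (Wn n \<omega>))) \<le> ennreal (Wn n \<omega>) * ennreal (b K)"
          by (intro mult_left_mono ennreal_leI) auto
        then show ?thesis using False by (simp add: mult.commute)
      qed (simp add: add_increasing2)
    qed
    also have "\<dots> = e n + ennreal (b K)"
      unfolding e_def by (subst nn_integral_add) (simp_all add: nn_integral_cmult mean_Wn)
    finally show ?thesis .
  qed
  have "(\<Sum>i<n. x i) \<le> of_nat n * ennreal (C' / c + b K)" for n
  proof -
    have "ennreal c * (\<Sum>i<n. e i) \<le> of_nat n * C" using sum[of n] by (rule order_trans[rotated]) (simp add: add_increasing)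
    then have "ennreal (1 / c) * (ennreal c * (\<Sum>i<n. e i)) \<le> ennreal (1 / c) * (of_nat n * C)"
      by (rule mult_left_mono) simp
    moreover have "ennreal (1 / c) * ennreal c = 1"
      using c by (subst ennreal_mult[symmetric]) auto
    moreover have "ennreal (1 / c) * C = ennreal (C' / c)"
      unfolding C'(1) using c C'(2) by (subst ennreal_mult[symmetric]) auto
    ultimately have *: "(\<Sum>i<n. e i) \<le> of_nat n * ennreal (C' / c)"
      by (metis mult.assoc mult.left_commute mult_1)
    have "(\<Sum>i<n. x i) \<le> (\<Sum>i<n. e i + ennreal (b K))" using x_le by (rule sum_mono)
    also have "\<dots> = (\<Sum>i<n. e i) + of_nat n * ennreal (b K)" by (simp add: sum.distrib)
    also have "\<dots> \<le> of_nat n * ennreal (C' / c) + of_nat n * ennreal (b K)" using * by (rule add_right_mono)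
    also have "\<dots> = of_nat n * ennreal (C' / c + b K)"
      using c C' less_imp_le[OF b_pos] by (simp add: distrib_left ennreal_plus del: ennreal_plus[symmetric])
    finally show ?thesis .
  qed
  then have liminf_x: "liminf x \<le> ennreal (C' / c + b K + 1)"
    by (rule liminf_le_of_sums_le) (use c C' less_imp_le[OF b_pos] in simp)
  \<comment> \<open>The weight \<open>b\<close> need not be continuous, so the integrands need not
    converge. Instead l W_n is eventually at least l W / 2, and doubling the argument of
    \<open>b\<close> costs 2^p.\<close>
  have "ennreal (1 / 2 ^ p) * (\<integral>\<^sup>+ \<omega>. ennreal (W \<omega>) * ennreal (b (ln_plus (W \<omega>))) \<partial>P)
    = (\<integral>\<^sup>+ \<omega>. ennreal (1 / 2 ^ p) * (ennreal (W \<omega>) * ennreal (b (ln_plus (W \<omega>)))) \<partial>P)"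
    by (rule nn_integral_cmult[symmetric]) measurable
  also have "\<dots> \<le> (\<integral>\<^sup>+ \<omega>. liminf (\<lambda>n. ennreal (Wn n \<omega>) * ennreal (b (ln_plus (Wn n \<omega>)))) \<partial>P)"
    using lim
  proof (intro nn_integral_mono_AE, eventually_elim)
    case (elim \<omega>)
    show ?case
    proof (cases "W \<omega> \<le> 0")
      case False
      define y where "y = b (ln_plus (W \<omega>)) / 2 ^ p"
      have y: "0 \<le> y" using less_imp_le[OF b_pos] by (simp add: y_def)
      have "(\<lambda>n. ln_plus (Wn n \<omega>)) \<longlonglongrightarrow> ln_plus (W \<omega>)"
        unfolding ln_plus_def using elim False by (intro tendsto_intros) auto
      have "\<forall>\<^sub>F n in sequentially. ln_plus (W \<omega>) / 2 \<le> ln_plus (Wn n \<omega>)"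
      proof (cases "ln_plus (W \<omega>) = 0")
        case True
        then show ?thesis using ln_plus_nonneg by simp
      next
        case False
        then have "ln_plus (W \<omega>) / 2 < ln_plus (W \<omega>)" using ln_plus_nonneg[of "W \<omega>"] by simp
        then have "\<forall>\<^sub>F n in sequentially. ln_plus (W \<omega>) / 2 < ln_plus (Wn n \<omega>)"
          by (rule order_tendstoD(1)[OF \<open>(\<lambda>n. ln_plus (Wn n \<omega>)) \<longlonglongrightarrow> ln_plus (W \<omega>)\<close>])
        then show ?thesis by eventually_elim simp
      qed
      then have "\<forall>\<^sub>F n in sequentially. ennreal (Wn n \<omega>) * ennreal y
          \<le> ennreal (Wn n \<omega>) * ennreal (b (ln_plus (Wn n \<omega>)))"
      proof eventually_elim
        case (elim n)
        have "b (ln_plus (W \<omega>)) = b (2 * (ln_plus (W \<omega>) / 2))" by simp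
        also have "\<dots> \<le> 2 ^ p * b (ln_plus (W \<omega>) / 2)" by (rule b_scale) (simp_all add: ln_plus_nonneg)
        also have "\<dots> \<le> 2 ^ p * b (ln_plus (Wn n \<omega>))" using elim by (intro mult_left_mono b_le) auto
        finally have "y \<le> b (ln_plus (Wn n \<omega>))" by (simp add: y_def divide_le_eq mult.commute)
        then show ?case by (intro mult_left_mono ennreal_leI) auto
      qed
      then have "liminf (\<lambda>n. ennreal (Wn n \<omega>) * ennreal y)
          \<le> liminf (\<lambda>n. ennreal (Wn n \<omega>) * ennreal (b (ln_plus (Wn n \<omega>))))"
        by (rule Liminf_mono)
      moreover have "(\<lambda>n. ennreal (Wn n \<omega>) * ennreal y) \<longlonglongrightarrow> ennreal (W \<omega>) * ennreal y"
        using ennreal_tendsto_cmult[of "ennreal y" "\<lambda>n. ennreal (Wn n \<omega>)" "ennreal (W \<omega>)" sequentially]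
          tendsto_ennrealI[OF elim(2)] by (simp add: mult.commute)
      then have "liminf (\<lambda>n. ennreal (Wn n \<omega>) * ennreal y) = ennreal (W \<omega>) * ennreal y"
        by (rule lim_imp_Liminf[OF sequentially_bot])
      moreover have "ennreal y = ennreal (1 / 2 ^ p) * ennreal (b (ln_plus (W \<omega>)))"
        using less_imp_le[OF b_pos] by (subst ennreal_mult[symmetric]) (auto simp: y_def)
      ultimately show ?thesis by (simp add: mult_ac)
    qed (simp add: ennreal_neg)
  qed
  also have "\<dots> \<le> liminf x" unfolding x_def by (rule nn_integral_liminf) measurable
  also have "\<dots> \<le> ennreal (C' / c + b K + 1)" by (rule liminf_x)
  finally have "ennreal (1 / 2 ^ p) * (\<integral>\<^sup>+ \<omega>. ennreal (W \<omega>) * ennreal (b (ln_plus (W \<omega>))) \<partial>P) < \<infinity>"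
    by (rule order.strict_trans1) simp
  then show ?thesis by (auto simp: ennreal_mult_less_top)
qed

end

section \<open>The limit as a fixed point, and back to the first generation\<close>

lemma ennreal_plus_le: "ennreal (x + y) \<le> ennreal x + ennreal y"
proof (cases "0 \<le> x \<and> 0 \<le> y")
  case False
  then have "ennreal (x + y) \<le> ennreal x \<or> ennreal (x + y) \<le> ennreal y"
    by (auto intro!: ennreal_leI)
  then show ?thesis by (auto intro: order_trans)
qed simp

lemma ennreal_abs_diff_sums_le:
  fixes a x y :: "'i \<Rightarrow> real"
  assumes u: "ennreal u = (\<integral>\<^sup>+ j. ennreal (a j * x j) \<partial>count_space UNIV)" "0 \<le> u"
    and v: "ennreal v = (\<integral>\<^sup>+ j. ennreal (a j * y j) \<partial>count_space UNIV)" "0 \<le> v"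
    and a: "\<And>j. 0 \<le> a j"
  shows "ennreal \<bar>u - v\<bar> \<le> (\<integral>\<^sup>+ j. ennreal (a j) * ennreal \<bar>x j - y j\<bar> \<partial>count_space UNIV)" (is "_ \<le> ?D")
proof -
  have *: "(\<integral>\<^sup>+ j. ennreal (a j * x j) \<partial>count_space UNIV) \<le> (\<integral>\<^sup>+ j. ennreal (a j * y j) \<partial>count_space UNIV)
      + (\<integral>\<^sup>+ j. ennreal (a j) * ennreal \<bar>x j - y j\<bar> \<partial>count_space UNIV)" for x y :: "'i \<Rightarrow> real"
  proof (subst nn_integral_add[symmetric], simp, simp, rule nn_integral_mono)
    fix j
    have "a j * x j \<le> a j * y j + a j * \<bar>x j - y j\<bar>"
      using mult_left_mono[OF _ a, of "x j" "y j + \<bar>x j - y j\<bar>" j] by (simp add: distrib_left)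
    then have "ennreal (a j * x j) \<le> ennreal (a j * y j + a j * \<bar>x j - y j\<bar>)" by (rule ennreal_leI)
    also have "\<dots> \<le> ennreal (a j * y j) + ennreal (a j * \<bar>x j - y j\<bar>)" by (rule ennreal_plus_le)
    finally show "ennreal (a j * x j) \<le> ennreal (a j * y j) + ennreal (a j) * ennreal \<bar>x j - y j\<bar>"
      by (simp add: ennreal_mult a)
  qed
  have uv: "ennreal u \<le> ennreal v + ?D" using *[of x y] u v by simp
  have vu: "ennreal v \<le> ennreal u + ?D" using *[of y x] u v by (simp add: abs_minus_commute)
  show ?thesis
  proof (cases "?D")
    case (real D)
    then have "ennreal u \<le> ennreal (v + D)" "ennreal v \<le> ennreal (u + D)"
      using uv vu u v by (simp_all add: ennreal_plus)
    then have "u \<le> v + D" "v \<le> u + D"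
      using u(2) v(2) real(1) by (simp_all only: ennreal_le_iff add_nonneg_nonneg)
    then show ?thesis using real by (auto intro!: ennreal_leI)
  qed simp
qed

context brw_moment
begin

lemma CS_shift:
  assumes f [measurable]: "f \<in> borel_measurable tree_space"
  shows "CS (\<lambda>j \<omega>. f (shift j (D \<omega>))) = (\<integral>\<^sup>+ \<omega>. f (D \<omega>) \<partial>P)"
proof -
  have "(\<integral>\<^sup>+ \<omega>. ennreal (cw j \<omega>) * f (shift j (D \<omega>)) \<partial>P)
      = (\<integral>\<^sup>+ \<omega>. f (D \<omega>) \<partial>P) * (\<integral>\<^sup>+ \<omega>. ennreal (cw j \<omega>) \<partial>P)" for j
  proof -
    have "(\<lambda>h. ennreal (child_weight (h []) j)) \<in> borel_measurable (PiM (rest j) (\<lambda>_. point_space))"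
      by measurable
    from subtree_factor[OF f this] show ?thesis using Nil_rest by (simp add: mult.commute)
  qed
  then show ?thesis by (simp add: nn_integral_cmult sum_child_weight)
qed

text \<open>W is given only as a random variable, whereas the recursion evaluates it on subtrees;
  the lower limit of \<open>V_n\<close> is a functional of the tree that agrees with W almost
  surely.\<close>

lemma limit_is_fixed_point:
  assumes W [measurable]: "W \<in> borel_measurable P"
    and lim: "AE \<omega> in P. (\<lambda>n. Wn n \<omega>) \<longlonglongrightarrow> W \<omega>"
    and L1: "(\<lambda>n. \<integral>\<^sup>+ \<omega>. ennreal \<bar>Wn n \<omega> - W \<omega>\<bar> \<partial>P) \<longlonglongrightarrow> 0"
  obtains F where "F \<in> borel_measurable tree_space" "\<And>d. 0 \<le> F d"
    "(\<integral>\<^sup>+ \<omega>. ennreal (F (D \<omega>)) \<partial>P) = 1" "AE \<omega> in P. F (D \<omega>) = W \<omega>"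
    "AE \<omega> in P. enn2real (\<integral>\<^sup>+ j. ennreal (cw j \<omega> * F (shift j (D \<omega>))) \<partial>count_space UNIV) = W \<omega>"
proof -
  define \<epsilon> where "\<epsilon> = (\<lambda>n. \<integral>\<^sup>+ \<omega>. ennreal \<bar>Wn n \<omega> - W \<omega>\<bar> \<partial>P)"
  have \<epsilon>: "\<epsilon> \<longlonglongrightarrow> 0" using L1 by (simp add: \<epsilon>_def)
  define F where "F = (\<lambda>d. enn2real (liminf (\<lambda>n. V_n n d)))"
  have F [measurable]: "F \<in> borel_measurable tree_space" unfolding F_def by measurable
  have F0: "0 \<le> F d" for d by (simp add: F_def)
  have AE_nonneg: "AE \<omega> in P. 0 \<le> W \<omega>"
    using lim by eventually_elim (rule LIMSEQ_le_const, assumption, use Wn_nonneg in auto)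
  have FW: "AE \<omega> in P. F (D \<omega>) = W \<omega>"
    using lim AE_Wn AE_nonneg
  proof eventually_elim
    case (elim \<omega>)
    have "(\<lambda>n. V_n n (D \<omega>)) \<longlonglongrightarrow> ennreal (W \<omega>)"
      using tendsto_ennrealI[OF elim(1)] elim(2) by simp
    then have "liminf (\<lambda>n. V_n n (D \<omega>)) = ennreal (W \<omega>)"
      by (rule lim_imp_Liminf[OF sequentially_bot])
    then show ?case using elim(3) by (simp add: F_def)
  qed
  have add0: "(\<lambda>n. c + \<epsilon> n) \<longlonglongrightarrow> c" for c
    using tendsto_add[OF tendsto_const \<epsilon>, of c] by simp
  have mean_W: "(\<integral>\<^sup>+ \<omega>. ennreal (W \<omega>) \<partial>P) = 1"
  proof (rule antisym)
    have "(\<integral>\<^sup>+ \<omega>. ennreal (W \<omega>) \<partial>P) \<le> 1 + \<epsilon> n" for n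
    proof -
      have "(\<integral>\<^sup>+ \<omega>. ennreal (W \<omega>) \<partial>P) \<le> (\<integral>\<^sup>+ \<omega>. ennreal (Wn n \<omega>) + ennreal \<bar>Wn n \<omega> - W \<omega>\<bar> \<partial>P)"
        by (intro nn_integral_mono order_trans[OF ennreal_leI ennreal_plus_le]) auto
      also have "\<dots> = 1 + \<epsilon> n" unfolding \<epsilon>_def by (subst nn_integral_add) (simp_all add: mean_Wn)
      finally show ?thesis .
    qed
    then show "(\<integral>\<^sup>+ \<omega>. ennreal (W \<omega>) \<partial>P) \<le> 1" by (intro LIMSEQ_le_const[OF add0]) auto
    have "1 \<le> (\<integral>\<^sup>+ \<omega>. ennreal (W \<omega>) \<partial>P) + \<epsilon> n" for n
    proof -
      have "1 = (\<integral>\<^sup>+ \<omega>. ennreal (Wn n \<omega>) \<partial>P)" by (simp add: mean_Wn)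
      also have "\<dots> \<le> (\<integral>\<^sup>+ \<omega>. ennreal (W \<omega>) + ennreal \<bar>Wn n \<omega> - W \<omega>\<bar> \<partial>P)"
        by (intro nn_integral_mono order_trans[OF ennreal_leI ennreal_plus_le]) auto
      also have "\<dots> = (\<integral>\<^sup>+ \<omega>. ennreal (W \<omega>) \<partial>P) + \<epsilon> n" unfolding \<epsilon>_def by (subst nn_integral_add) simp_all
      finally show ?thesis .
    qed
    then show "1 \<le> (\<integral>\<^sup>+ \<omega>. ennreal (W \<omega>) \<partial>P)" by (intro LIMSEQ_le_const[OF add0]) auto
  qed
  have mean_F: "(\<integral>\<^sup>+ \<omega>. ennreal (F (D \<omega>)) \<partial>P) = 1"
    unfolding mean_W[symmetric] using FW by (intro nn_integral_cong_AE) auto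
  interpret st: smoothing P cw "\<lambda>j \<omega>. F (shift j (D \<omega>))" "\<lambda>\<omega>. F (D \<omega>)"
    by (rule smoothing[OF F F0 mean_F])
  have S_eq: "st.S \<omega> = enn2real (\<integral>\<^sup>+ j. ennreal (cw j \<omega> * F (shift j (D \<omega>))) \<partial>count_space UNIV)" for \<omega>
    by (simp add: st.S_def st.total_def)
  \<comment> \<open>One step of the recursion does not increase the mean absolute distance, because
    the weights have total mean 1 and are independent of the subtrees. So W_(n+1) is as close to S
    in mean as W_n is to W.\<close>
  have "(\<integral>\<^sup>+ \<omega>. ennreal \<bar>W \<omega> - st.S \<omega>\<bar> \<partial>P) \<le> \<epsilon> (Suc n) + \<epsilon> n" for n
  proof -
    have "(\<integral>\<^sup>+ \<omega>. ennreal \<bar>W \<omega> - st.S \<omega>\<bar> \<partial>P)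
      \<le> (\<integral>\<^sup>+ \<omega>. ennreal \<bar>Wn (Suc n) \<omega> - W \<omega>\<bar> + ennreal \<bar>Wn (Suc n) \<omega> - st.S \<omega>\<bar> \<partial>P)"
      by (intro nn_integral_mono order_trans[OF ennreal_leI ennreal_plus_le]) auto
    also have "\<dots> = \<epsilon> (Suc n) + (\<integral>\<^sup>+ \<omega>. ennreal \<bar>Wn (Suc n) \<omega> - st.S \<omega>\<bar> \<partial>P)"
      unfolding \<epsilon>_def by (rule nn_integral_add) measurable
    also have "(\<integral>\<^sup>+ \<omega>. ennreal \<bar>Wn (Suc n) \<omega> - st.S \<omega>\<bar> \<partial>P)
      \<le> (\<integral>\<^sup>+ \<omega>. \<integral>\<^sup>+ j. ennreal (cw j \<omega>) * ennreal \<bar>enn2real (V_n n (shift j (D \<omega>))) - F (shift j (D \<omega>))\<bar>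
          \<partial>count_space UNIV \<partial>P)"
      using AE_Wn AE_V_n_shift_finite[of n] st.AE_S
    proof (intro nn_integral_mono_AE, eventually_elim)
      case (elim \<omega>)
      have "ennreal (cw j \<omega> * enn2real (V_n n (shift j (D \<omega>)))) = ennreal (cw j \<omega>) * V_n n (shift j (D \<omega>))" for j
        using elim(5) by (simp add: ennreal_mult child_weight_nonneg)
      then have "ennreal (Wn (Suc n) \<omega>) = (\<integral>\<^sup>+ j. ennreal (cw j \<omega> * enn2real (V_n n (shift j (D \<omega>)))) \<partial>count_space UNIV)"
        using elim(4)[THEN spec, of "Suc n"] by simp
      from ennreal_abs_diff_sums_le[OF this Wn_nonneg elim(6) st.S_nonneg child_weight_nonneg]
      show ?case .
    qed
    also have "\<dots> = CS (\<lambda>j \<omega>. ennreal \<bar>enn2real (V_n n (shift j (D \<omega>))) - F (shift j (D \<omega>))\<bar>)"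
      by (rule nn_integral_countable_swap) measurable
    also have "\<dots> = (\<integral>\<^sup>+ \<omega>. ennreal \<bar>enn2real (V_n n (D \<omega>)) - F (D \<omega>)\<bar> \<partial>P)"
      by (rule CS_shift) measurable
    also have "\<dots> = \<epsilon> n"
      unfolding \<epsilon>_def brw_W_eq using FW by (intro nn_integral_cong_AE) auto
    finally show ?thesis by simp
  qed
  moreover have "(\<lambda>n. \<epsilon> (Suc n) + \<epsilon> n) \<longlonglongrightarrow> 0"
    using tendsto_add[OF LIMSEQ_Suc[OF \<epsilon>] \<epsilon>] by simp
  ultimately have "(\<integral>\<^sup>+ \<omega>. ennreal \<bar>W \<omega> - st.S \<omega>\<bar> \<partial>P) \<le> 0" by (intro LIMSEQ_le_const) auto
  then have "AE \<omega> in P. ennreal \<bar>W \<omega> - st.S \<omega>\<bar> = 0"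
    by (subst (asm) le_zero_eq, subst (asm) nn_integral_0_iff_AE) auto
  then have "AE \<omega> in P. enn2real (\<integral>\<^sup>+ j. ennreal (cw j \<omega> * F (shift j (D \<omega>))) \<partial>count_space UNIV) = W \<omega>"
    by eventually_elim (simp add: S_eq)
  then show ?thesis using that F F0 mean_F FW by blast
qed

end

lemma (in brw_weight) first_generation_moment:
  assumes W [measurable]: "W \<in> borel_measurable P"
    and lim: "AE \<omega> in P. (\<lambda>n. Wn n \<omega>) \<longlonglongrightarrow> W \<omega>"
    and L1: "(\<lambda>n. \<integral>\<^sup>+ \<omega>. ennreal \<bar>Wn n \<omega> - W \<omega>\<bar> \<partial>P) \<longlonglongrightarrow> 0"
    and down_fin: "CS (\<lambda>j \<omega>. ennreal (max 0 (- ln (cw j \<omega>)))) < \<infinity>"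
    and fin: "(\<integral>\<^sup>+ \<omega>. ennreal (W \<omega>) * ennreal (b (ln_plus (W \<omega>))) \<partial>P) < \<infinity>"
  shows "(\<integral>\<^sup>+ \<omega>. ennreal (Wn 1 \<omega>) * ennreal (\<Psi> (ln_plus (Wn 1 \<omega>))) \<partial>P) < \<infinity>"
proof -
  obtain F where F: "F \<in> borel_measurable tree_space" "\<And>d. 0 \<le> F d"
    "(\<integral>\<^sup>+ \<omega>. ennreal (F (D \<omega>)) \<partial>P) = 1" and FW: "AE \<omega> in P. F (D \<omega>) = W \<omega>"
    and SW: "AE \<omega> in P. enn2real (\<integral>\<^sup>+ j. ennreal (cw j \<omega> * F (shift j (D \<omega>))) \<partial>count_space UNIV) = W \<omega>"
    using limit_is_fixed_point[OF W lim L1] by blast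
  interpret st: smoothing P cw "\<lambda>j \<omega>. F (shift j (D \<omega>))" "\<lambda>\<omega>. F (D \<omega>)"
    by (rule smoothing[OF F])
  interpret st: smoothing_weight P cw "\<lambda>j \<omega>. F (shift j (D \<omega>))" "\<lambda>\<omega>. F (D \<omega>)" b p ..
  have W1: "st.W1 \<omega> = Wn 1 \<omega>" for \<omega>
    by (simp add: st.W1_def st.total_def brw_W_eq)
  have "AE \<omega> in P. st.S \<omega> = F (D \<omega>)"
    using SW FW by eventually_elim (simp add: st.S_def st.total_def)
  then have law: "(\<integral>\<^sup>+ \<omega>. h (st.S \<omega>) \<partial>P) = (\<integral>\<^sup>+ \<omega>. h (F (D \<omega>)) \<partial>P)" for h :: "real \<Rightarrow> ennreal"
    by (intro nn_integral_cong_AE) auto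
  have "(\<integral>\<^sup>+ \<omega>. ennreal (F (D \<omega>)) * ennreal (b (ln_plus (F (D \<omega>)))) \<partial>P)
    = (\<integral>\<^sup>+ \<omega>. ennreal (W \<omega>) * ennreal (b (ln_plus (W \<omega>))) \<partial>P)"
    using FW by (intro nn_integral_cong_AE) auto
  with fin have "(\<integral>\<^sup>+ \<omega>. ennreal (F (D \<omega>)) * ennreal (b (ln_plus (F (D \<omega>)))) \<partial>P) < \<infinity>" by simp
  from st.size_moment_of_fixed_point[OF law down_fin this] show ?thesis
    unfolding W1 .
qed

section \<open>Translation between \<open>a\<close>, the law of Z and the estimates above\<close>

lemma nn_integral_weight_finite_iff:
  fixes a b :: "real \<Rightarrow> real"
  assumes b: "growth_weight b p"
    and a_meas: "a \<in> borel_measurable (restrict_space borel {0<..})"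
    and nonneg: "\<And>x. 0 < x \<Longrightarrow> 0 \<le> a x"
    and bdd: "bounded ((\<lambda>x. x * a x) ` {0<..X})" and X: "0 < X"
    and le: "\<And>x. X \<le> x \<Longrightarrow> x * a x \<le> b x" and ge: "\<And>x. X \<le> x \<Longrightarrow> b x \<le> C * (x * a x)" and C: "0 < C"
    and G [measurable]: "G \<in> borel_measurable P" and L [measurable]: "L \<in> borel_measurable P"
    and L_nonneg: "\<And>\<omega>. 0 \<le> L \<omega>" and G_fin: "(\<integral>\<^sup>+ \<omega>. ennreal (G \<omega>) \<partial>P) < \<infinity>"
  shows "(\<integral>\<^sup>+ \<omega>. ennreal (G \<omega>) * ennreal (L \<omega> * a (L \<omega>)) \<partial>P) < \<infinity> \<longleftrightarrow>
    (\<integral>\<^sup>+ \<omega>. ennreal (G \<omega>) * ennreal (b (L \<omega>)) \<partial>P) < \<infinity>"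
proof -
  interpret growth_weight b p by (rule b)
  \<comment> \<open>The function \<open>a\<close> is controlled only on the positive half-line; at 0
    the product x a(x) is 0 whatever \<open>a 0\<close> is, so this extension is measurable and
    loses nothing.\<close>
  define b0 where "b0 = (\<lambda>x. if x \<in> {0<..} then x * a x else 0)"
  have "(\<lambda>x. x * a x) \<in> borel_measurable (restrict_space borel {0<..})"
    by (rule borel_measurable_times[OF measurable_restrict_space1 a_meas]) simp
  then have b0 [measurable]: "b0 \<in> borel_measurable borel"
    unfolding b0_def by (subst measurable_restrict_space_iff[symmetric]) auto
  have b0_eq: "x * a x = b0 x" if "0 \<le> x" for x using that by (auto simp: b0_def)
  have b0_nonneg: "0 \<le> b0 x" for x using nonneg by (auto simp: b0_def)
  obtain c where c: "\<And>x. 0 < x \<Longrightarrow> x \<le> X \<Longrightarrow> \<bar>x * a x\<bar> \<le> c"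
    using bdd unfolding bounded_iff by fastforce
  have c0: "0 \<le> c" using c[of X] X by simp
  have 1: "b0 x \<le> b x + c" if "0 \<le> x" for x
    using le[of x] c[of x] c0 b_pos[of x] that by (cases "X \<le> x"; cases "0 < x") (auto simp: b0_def)
  have 2: "b x \<le> C * b0 x + b X" if "0 \<le> x" for x
  proof (cases "X \<le> x")
    case True
    then show ?thesis using ge[OF True] b0_eq[OF that] b_pos[of X] by simp
  next
    case False
    then have "b x \<le> b X" by (intro b_le) simp
    moreover have "0 \<le> C * b0 x" using C b0_nonneg[of x] by simp
    ultimately show ?thesis by simp
  qed
  have bX: "0 \<le> b X" using b_pos[of X] by simp
  show ?thesis
  proof
    assume *: "(\<integral>\<^sup>+ \<omega>. ennreal (G \<omega>) * ennreal (L \<omega> * a (L \<omega>)) \<partial>P) < \<infinity>"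
    have "(\<integral>\<^sup>+ \<omega>. ennreal (G \<omega>) * ennreal (b (L \<omega>)) \<partial>P)
      \<le> (\<integral>\<^sup>+ \<omega>. ennreal C * (ennreal (G \<omega>) * ennreal (b0 (L \<omega>))) + ennreal (b X) * ennreal (G \<omega>) \<partial>P)"
    proof (rule nn_integral_mono)
      fix \<omega>
      have "ennreal (b (L \<omega>)) \<le> ennreal (C * b0 (L \<omega>) + b X)" using 2[OF L_nonneg] by (rule ennreal_leI)
      also have "\<dots> = ennreal C * ennreal (b0 (L \<omega>)) + ennreal (b X)"
        using C bX b0_nonneg by (simp add: ennreal_mult)
      finally have "ennreal (G \<omega>) * ennreal (b (L \<omega>)) \<le> ennreal (G \<omega>) * (ennreal C * ennreal (b0 (L \<omega>)) + ennreal (b X))"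
        by (rule mult_left_mono) simp
      then show "ennreal (G \<omega>) * ennreal (b (L \<omega>))
        \<le> ennreal C * (ennreal (G \<omega>) * ennreal (b0 (L \<omega>))) + ennreal (b X) * ennreal (G \<omega>)"
        by (simp add: distrib_left mult_ac)
    qed
    also have "\<dots> = ennreal C * (\<integral>\<^sup>+ \<omega>. ennreal (G \<omega>) * ennreal (b0 (L \<omega>)) \<partial>P) + ennreal (b X) * (\<integral>\<^sup>+ \<omega>. ennreal (G \<omega>) \<partial>P)"
      by (subst nn_integral_add) (simp_all add: nn_integral_cmult)
    also have "\<dots> < \<infinity>"
      using * G_fin by (simp add: ennreal_mult_less_top b0_eq[OF L_nonneg])
    finally show "(\<integral>\<^sup>+ \<omega>. ennreal (G \<omega>) * ennreal (b (L \<omega>)) \<partial>P) < \<infinity>" .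
  next
    assume *: "(\<integral>\<^sup>+ \<omega>. ennreal (G \<omega>) * ennreal (b (L \<omega>)) \<partial>P) < \<infinity>"
    have "(\<integral>\<^sup>+ \<omega>. ennreal (G \<omega>) * ennreal (L \<omega> * a (L \<omega>)) \<partial>P)
      \<le> (\<integral>\<^sup>+ \<omega>. ennreal (G \<omega>) * ennreal (b (L \<omega>)) + ennreal c * ennreal (G \<omega>) \<partial>P)"
    proof (rule nn_integral_mono)
      fix \<omega>
      have "ennreal (L \<omega> * a (L \<omega>)) \<le> ennreal (b (L \<omega>) + c)"
        unfolding b0_eq[OF L_nonneg] using 1[OF L_nonneg] by (rule ennreal_leI)
      also have "\<dots> = ennreal (b (L \<omega>)) + ennreal c" using c0 less_imp_le[OF b_pos] by simp
      finally have "ennreal (G \<omega>) * ennreal (L \<omega> * a (L \<omega>)) \<le> ennreal (G \<omega>) * (ennreal (b (L \<omega>)) + ennreal c)"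
        by (rule mult_left_mono) simp
      then show "ennreal (G \<omega>) * ennreal (L \<omega> * a (L \<omega>))
        \<le> ennreal (G \<omega>) * ennreal (b (L \<omega>)) + ennreal c * ennreal (G \<omega>)"
        by (simp add: distrib_left mult_ac)
    qed
    also have "\<dots> = (\<integral>\<^sup>+ \<omega>. ennreal (G \<omega>) * ennreal (b (L \<omega>)) \<partial>P) + ennreal c * (\<integral>\<^sup>+ \<omega>. ennreal (G \<omega>) \<partial>P)"
      by (subst nn_integral_add) (simp_all add: nn_integral_cmult)
    also have "\<dots> < \<infinity>" using * G_fin by (simp add: ennreal_mult_less_top)
    finally show "(\<integral>\<^sup>+ \<omega>. ennreal (G \<omega>) * ennreal (L \<omega> * a (L \<omega>)) \<partial>P) < \<infinity>" .
  qed
qed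

lemma SUP_ennreal_min: "(SUP n. ennreal (min x (real n))) = ennreal x"
proof (rule antisym)
  obtain n where "x \<le> real n" using real_arch_simple by blast
  then show "ennreal x \<le> (SUP n. ennreal (min x (real n)))" by (intro SUP_upper2[of n]) auto
qed (auto intro!: SUP_least ennreal_leI)

text \<open>The law of Z is prescribed on bounded functions only; monotone truncation extends it to
  the unbounded positive and negative parts of the logarithm.\<close>

lemma (in brw_moment) size_biased_law:
  fixes Q :: "'z measure" and r :: "real \<Rightarrow> real"
  assumes Z [measurable]: "Z \<in> borel_measurable Q"
    and law: "\<And>r :: real \<Rightarrow> real. r \<in> borel_measurable borel \<Longrightarrow> (\<And>x. 0 \<le> r x) \<Longrightarrow> bounded (range r) \<Longrightarrow>
      (\<integral>\<^sup>+ z. ennreal (r (Z z)) \<partial>Q) =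
      (\<integral>\<^sup>+ \<omega>. (\<integral>\<^sup>+ u. ennreal (brw_Y P D \<gamma> u \<omega> * r (brw_Y P D \<gamma> u \<omega>))
                  \<partial>count_space (generation (D \<omega>) 1)) \<partial>P)"
    and r [measurable]: "r \<in> borel_measurable borel" and r0: "\<And>x. 0 \<le> r x"
  shows "(\<integral>\<^sup>+ z. ennreal (r (Z z)) \<partial>Q) = CS (\<lambda>j \<omega>. ennreal (r (cw j \<omega>)))"
proof -
  have bdd: "(\<integral>\<^sup>+ z. ennreal (min (r (Z z)) (real n)) \<partial>Q) = CS (\<lambda>j \<omega>. ennreal (min (r (cw j \<omega>)) (real n)))" for n
  proof -
    have "bounded (range (\<lambda>x. min (r x) (real n)))"
      unfolding bounded_iff using r0 by (intro exI[of _ "real n"]) auto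
    from law[OF _ _ this] r0
    have "(\<integral>\<^sup>+ z. ennreal (min (r (Z z)) (real n)) \<partial>Q) =
      (\<integral>\<^sup>+ \<omega>. (\<integral>\<^sup>+ u. ennreal (brw_Y P D \<gamma> u \<omega> * min (r (brw_Y P D \<gamma> u \<omega>)) (real n))
                  \<partial>count_space (generation (D \<omega>) 1)) \<partial>P)" by simp
    also have "\<dots> = (\<integral>\<^sup>+ \<omega>. (\<integral>\<^sup>+ u. ennreal (brw_Y P D \<gamma> u \<omega>) * ennreal (min (r (brw_Y P D \<gamma> u \<omega>)) (real n))
                  \<partial>count_space (generation (D \<omega>) 1)) \<partial>P)"
      using r0 by (intro nn_integral_cong ennreal_mult) (auto simp: brw_Y_def)
    also have "\<dots> = CS (\<lambda>j \<omega>. ennreal (min (r (cw j \<omega>)) (real n)))"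
      by (rule sum_generation_1) measurable
    finally show ?thesis .
  qed
  have "(\<integral>\<^sup>+ z. ennreal (r (Z z)) \<partial>Q) = (\<integral>\<^sup>+ z. (SUP n. ennreal (min (r (Z z)) (real n))) \<partial>Q)"
    by (simp only: SUP_ennreal_min)
  also have "\<dots> = (SUP n. \<integral>\<^sup>+ z. ennreal (min (r (Z z)) (real n)) \<partial>Q)"
    by (rule nn_integral_monotone_convergence_SUP) (auto simp: incseq_def le_fun_def intro!: ennreal_leI)
  also have "\<dots> = (SUP n. CS (\<lambda>j \<omega>. ennreal (min (r (cw j \<omega>)) (real n))))" by (simp only: bdd)
  also have "\<dots> = (\<integral>\<^sup>+ j. (SUP n. \<integral>\<^sup>+ \<omega>. ennreal (cw j \<omega>) * ennreal (min (r (cw j \<omega>)) (real n)) \<partial>P) \<partial>count_space UNIV)"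
    by (rule nn_integral_monotone_convergence_SUP[symmetric])
      (auto simp: incseq_def le_fun_def intro!: nn_integral_mono mult_left_mono ennreal_leI)
  also have "\<dots> = (\<integral>\<^sup>+ j. (\<integral>\<^sup>+ \<omega>. (SUP n. ennreal (cw j \<omega>) * ennreal (min (r (cw j \<omega>)) (real n))) \<partial>P) \<partial>count_space UNIV)"
    by (intro nn_integral_cong nn_integral_monotone_convergence_SUP[symmetric])
      (auto simp: incseq_def le_fun_def intro!: mult_left_mono ennreal_leI)
  also have "\<dots> = CS (\<lambda>j \<omega>. ennreal (r (cw j \<omega>)))"
    by (simp only: SUP_mult_left_ennreal[symmetric] SUP_ennreal_min)
  finally show ?thesis .
qed

theorem theorem1p2:
  fixes P :: "'w measure" and M :: "'w \<Rightarrow> real measure"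
    and D :: "'w \<Rightarrow> int list \<Rightarrow> real measure" and \<gamma> :: real
    and Q :: "'z measure" and Z :: "'z \<Rightarrow> real" and W :: "'w \<Rightarrow> real"
    and a :: "real \<Rightarrow> real" and \<alpha> :: real
  assumes "branching_random_walk P M D"
    and "0 < \<gamma>" and "0 < brw_m P D \<gamma>" and "brw_m P D \<gamma> < \<infinity>"
    \<comment> \<open>\<open>Z\<close> is a random variable with the prescribed distribution, on a space of its own\<close>
    and "prob_space Q" and "Z \<in> borel_measurable Q"
    and "\<And>r :: real \<Rightarrow> real. r \<in> borel_measurable borel \<Longrightarrow> (\<And>x. 0 \<le> r x) \<Longrightarrow> bounded (range r) \<Longrightarrow>
      (\<integral>\<^sup>+ z. ennreal (r (Z z)) \<partial>Q) =
      (\<integral>\<^sup>+ \<omega>. (\<integral>\<^sup>+ u. ennreal (brw_Y P D \<gamma> u \<omega> * r (brw_Y P D \<gamma> u \<omega>))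
                  \<partial>count_space (generation (D \<omega>) 1)) \<partial>P)"
    \<comment> \<open>\<open>a\<close> is only used on the positive half-line\<close>
    and "\<And>x. 0 < x \<Longrightarrow> 0 \<le> a x" and "-1 < \<alpha>" and "regularly_varying a \<alpha>"
    and "\<alpha> = 0 \<Longrightarrow> \<exists>x0>0. mono_on {x0..} a"
    \<comment> \<open>\<open>x a(x)\<close> is locally bounded on the closed half-line\<close>
    and "\<And>c. 0 < c \<Longrightarrow> bounded ((\<lambda>x. x * a x) ` {0<..c})"
    \<comment> \<open>\<open>W\<close> is the almost sure and \<open>L\<^sub>1\<close> limit of the martingale\<close>
    and "W \<in> borel_measurable P"
    and "AE \<omega> in P. (\<lambda>n. brw_W P D \<gamma> n \<omega>) \<longlonglongrightarrow> W \<omega>"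
    and "(\<lambda>n. \<integral>\<^sup>+ \<omega>. ennreal \<bar>brw_W P D \<gamma> n \<omega> - W \<omega>\<bar> \<partial>P) \<longlonglongrightarrow> 0"
    and "integrable Q (\<lambda>z. ln (Z z))" and "(\<integral>z. ln (Z z) \<partial>Q) < 0"
    and "(\<integral>\<^sup>+ \<omega>. ennreal (brw_W P D \<gamma> 1 \<omega> * ln_plus (brw_W P D \<gamma> 1 \<omega>)) \<partial>P) < \<infinity>"
  shows "(\<integral>\<^sup>+ \<omega>. ennreal (W \<omega> * ln_plus (W \<omega>) * a (ln_plus (W \<omega>))) \<partial>P) < \<infinity> \<longleftrightarrow>
    (\<integral>\<^sup>+ \<omega>. ennreal (brw_W P D \<gamma> 1 \<omega> * (ln_plus (brw_W P D \<gamma> 1 \<omega>))\<^sup>2 *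
      a (ln_plus (brw_W P D \<gamma> 1 \<omega>))) \<partial>P) < \<infinity>"
proof -
  note BRW = assms(1) and m = assms(3,4) and Z [measurable] = assms(6) and law = assms(7)
    and a_nonneg = assms(8) and \<alpha> = assms(9) and rv = assms(10) and bdd = assms(12)
    and W [measurable] = assms(13) and lim = assms(14) and L1 = assms(15)
    and ln_Z = assms(16) and neg = assms(17) and W1_ln = assms(18)
  define \<mu> where "\<mu> = enn2real (brw_m P D \<gamma>)"
  have \<mu>_eq: "brw_m P D \<gamma> = ennreal \<mu>" using m by (simp add: \<mu>_def)
  interpret branching_random_walk P M D by (rule BRW)
  interpret brw_moment P M D \<gamma> \<mu>
    by unfold_locales (use m in \<open>auto simp: \<mu>_eq\<close>)
  obtain b p X C where b: "growth_weight b p" and X: "0 < X" and C: "0 < C"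
    and le: "\<And>x. X \<le> x \<Longrightarrow> x * a x \<le> b x" and ge: "\<And>x. X \<le> x \<Longrightarrow> b x \<le> C * (x * a x)"
    using growth_weight_exists[OF rv \<alpha> a_nonneg] by blast
  interpret growth_weight b p by (rule b)
  interpret brw_weight P M D \<gamma> \<mu> b p ..
  have a_meas: "a \<in> borel_measurable (restrict_space borel {0<..})"
    using rv by (simp add: regularly_varying_def)
  note iff = nn_integral_weight_finite_iff[OF b a_meas a_nonneg bdd[OF X] X le ge C]
  have AE_nonneg: "AE \<omega> in P. 0 \<le> W \<omega>"
    using lim by eventually_elim (rule LIMSEQ_le_const, assumption, use Wn_nonneg in auto)
  have W_fin: "(\<integral>\<^sup>+ \<omega>. ennreal (W \<omega>) \<partial>P) < \<infinity>"
  proof -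
    obtain F where "(\<integral>\<^sup>+ \<omega>. ennreal (F (D \<omega>)) \<partial>P) = 1" "AE \<omega> in P. F (D \<omega>) = W \<omega>"
      using limit_is_fixed_point[OF W lim L1] by blast
    moreover from this(2) have "(\<integral>\<^sup>+ \<omega>. ennreal (F (D \<omega>)) \<partial>P) = (\<integral>\<^sup>+ \<omega>. ennreal (W \<omega>) \<partial>P)"
      by (intro nn_integral_cong_AE) auto
    ultimately show ?thesis by simp
  qed
  have "(\<integral>\<^sup>+ \<omega>. ennreal (W \<omega> * ln_plus (W \<omega>) * a (ln_plus (W \<omega>))) \<partial>P)
    = (\<integral>\<^sup>+ \<omega>. ennreal (W \<omega>) * ennreal (ln_plus (W \<omega>) * a (ln_plus (W \<omega>))) \<partial>P)"
    using AE_nonneg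
    by (intro nn_integral_cong_AE, eventually_elim) (simp add: ennreal_mult'[symmetric] mult.assoc)
  then have lhs: "(\<integral>\<^sup>+ \<omega>. ennreal (W \<omega> * ln_plus (W \<omega>) * a (ln_plus (W \<omega>))) \<partial>P) < \<infinity> \<longleftrightarrow>
      (\<integral>\<^sup>+ \<omega>. ennreal (W \<omega>) * ennreal (b (ln_plus (W \<omega>))) \<partial>P) < \<infinity>"
    using iff[of W P "\<lambda>\<omega>. ln_plus (W \<omega>)"] W_fin ln_plus_nonneg by simp
  have W1l: "0 \<le> Wn 1 \<omega> * ln_plus (Wn 1 \<omega>)" for \<omega> using Wn_nonneg ln_plus_nonneg by simp
  \<comment> \<open>One logarithm is grouped with W_1, giving an integrable factor by hypothesis,
    the other with \<open>a\<close>. Replacing x a(x) by b(x) then produces \<Psi>.\<close>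
  have "(\<integral>\<^sup>+ \<omega>. ennreal (Wn 1 \<omega> * (ln_plus (Wn 1 \<omega>))\<^sup>2 * a (ln_plus (Wn 1 \<omega>))) \<partial>P)
    = (\<integral>\<^sup>+ \<omega>. ennreal (Wn 1 \<omega> * ln_plus (Wn 1 \<omega>)) * ennreal (ln_plus (Wn 1 \<omega>) * a (ln_plus (Wn 1 \<omega>))) \<partial>P)"
    using W1l by (intro nn_integral_cong) (simp add: ennreal_mult'[symmetric] power2_eq_square mult_ac)
  moreover have "(\<integral>\<^sup>+ \<omega>. ennreal (Wn 1 \<omega> * ln_plus (Wn 1 \<omega>)) * ennreal (b (ln_plus (Wn 1 \<omega>))) \<partial>P)
    = (\<integral>\<^sup>+ \<omega>. ennreal (Wn 1 \<omega>) * ennreal (\<Psi> (ln_plus (Wn 1 \<omega>))) \<partial>P)"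
    by (simp only: ennreal_mult'[OF W1l, symmetric] ennreal_mult'[OF Wn_nonneg, symmetric] \<Psi>_def mult.assoc)
  ultimately have rhs: "(\<integral>\<^sup>+ \<omega>. ennreal (Wn 1 \<omega> * (ln_plus (Wn 1 \<omega>))\<^sup>2 * a (ln_plus (Wn 1 \<omega>))) \<partial>P) < \<infinity> \<longleftrightarrow>
      (\<integral>\<^sup>+ \<omega>. ennreal (Wn 1 \<omega>) * ennreal (\<Psi> (ln_plus (Wn 1 \<omega>))) \<partial>P) < \<infinity>"
    using iff[of "\<lambda>\<omega>. Wn 1 \<omega> * ln_plus (Wn 1 \<omega>)" P "\<lambda>\<omega>. ln_plus (Wn 1 \<omega>)"] W1_ln ln_plus_nonneg by simp
  have W1_ln': "(\<integral>\<^sup>+ \<omega>. ennreal (Wn 1 \<omega>) * ennreal (ln_plus (Wn 1 \<omega>)) \<partial>P) < \<infinity>"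
    using W1_ln by (simp add: ennreal_mult Wn_nonneg ln_plus_nonneg)
  define p1 where "p1 = (\<integral>z. max 0 (ln (Z z)) \<partial>Q)"
  define p2 where "p2 = (\<integral>z. max 0 (- ln (Z z)) \<partial>Q)"
  have int: "integrable Q (\<lambda>z. max 0 (ln (Z z)))" "integrable Q (\<lambda>z. max 0 (- ln (Z z)))"
    using ln_Z by auto
  have "(\<integral>z. ln (Z z) \<partial>Q) = (\<integral>z. max 0 (ln (Z z)) - max 0 (- ln (Z z)) \<partial>Q)"
    by (intro Bochner_Integration.integral_cong) auto
  then have p12: "p1 < p2" using neg int by (simp add: p1_def p2_def)
  have p1: "0 \<le> p1" unfolding p1_def by (rule integral_nonneg_AE) simp
  note Z_law = size_biased_law[OF Z law]
  have up: "CS (\<lambda>j \<omega>. ennreal (max 0 (ln (cw j \<omega>)))) = ennreal p1"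
  proof -
    have "ennreal p1 = (\<integral>\<^sup>+ z. ennreal (max 0 (ln (Z z))) \<partial>Q)"
      unfolding p1_def by (rule nn_integral_eq_integral[OF int(1), symmetric]) simp
    also have "\<dots> = CS (\<lambda>j \<omega>. ennreal (max 0 (ln (cw j \<omega>))))" by (rule Z_law) simp_all
    finally show ?thesis by (rule sym)
  qed
  have down: "CS (\<lambda>j \<omega>. ennreal (max 0 (- ln (cw j \<omega>)))) = ennreal p2"
  proof -
    have "ennreal p2 = (\<integral>\<^sup>+ z. ennreal (max 0 (- ln (Z z))) \<partial>Q)"
      unfolding p2_def by (rule nn_integral_eq_integral[OF int(2), symmetric]) simp
    also have "\<dots> = CS (\<lambda>j \<omega>. ennreal (max 0 (- ln (cw j \<omega>))))" by (rule Z_law) simp_all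
    finally show ?thesis by (rule sym)
  qed
  \<comment> \<open>The midpoint lies strictly between the means of the positive and negative parts
    of ln Z, so the negative part can be truncated and still dominate the positive one.\<close>
  have "ennreal ((p1 + p2) / 2) < ennreal p2" using p1 p12 by (simp add: ennreal_less_iff)
  also have "\<dots> = (\<integral>\<^sup>+ z. (SUP n. ennreal (min (max 0 (- ln (Z z))) (real n))) \<partial>Q)"
    unfolding SUP_ennreal_min p2_def by (rule nn_integral_eq_integral[OF int(2), symmetric]) simp
  also have "\<dots> = (SUP n. \<integral>\<^sup>+ z. ennreal (min (max 0 (- ln (Z z))) (real n)) \<partial>Q)"
    by (rule nn_integral_monotone_convergence_SUP) (auto simp: incseq_def le_fun_def intro!: ennreal_leI)
  finally obtain n where n: "ennreal ((p1 + p2) / 2) < (\<integral>\<^sup>+ z. ennreal (min (max 0 (- ln (Z z))) (real n)) \<partial>Q)"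
    by (auto simp: less_SUP_iff)
  also have "(\<integral>\<^sup>+ z. ennreal (min (max 0 (- ln (Z z))) (real n)) \<partial>Q)
      = CS (\<lambda>j \<omega>. ennreal (min (max 0 (- ln (cw j \<omega>))) (real n)))"
    by (rule Z_law) simp_all
  finally have trunc: "ennreal ((p1 + p2) / 2) \<le> CS (\<lambda>j \<omega>. ennreal (min (max 0 (- ln (cw j \<omega>))) (real n)))"
    by simp
  have down_fin: "CS (\<lambda>j \<omega>. ennreal (max 0 (- ln (cw j \<omega>)))) < \<infinity>" unfolding down by simp
  show ?thesis
    unfolding lhs rhs
  proof
    assume "(\<integral>\<^sup>+ \<omega>. ennreal (W \<omega>) * ennreal (b (ln_plus (W \<omega>))) \<partial>P) < \<infinity>"
    then show "(\<integral>\<^sup>+ \<omega>. ennreal (Wn 1 \<omega>) * ennreal (\<Psi> (ln_plus (Wn 1 \<omega>))) \<partial>P) < \<infinity>"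
      by (rule first_generation_moment[OF W lim L1 down_fin])
  next
    assume "(\<integral>\<^sup>+ \<omega>. ennreal (Wn 1 \<omega>) * ennreal (\<Psi> (ln_plus (Wn 1 \<omega>))) \<partial>P) < \<infinity>"
    then show "(\<integral>\<^sup>+ \<omega>. ennreal (W \<omega>) * ennreal (b (ln_plus (W \<omega>))) \<partial>P) < \<infinity>"
      using p12 by (intro limit_moment[OF W lim eq_refl[OF up] p1 _ _ trunc down_fin W1_ln']) auto
  qed
qed

end
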